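(* Let $0<p<\infty$, $0<q\le\infty$, and $\alpha>d(1/p-1)_+$. Then there exists a function $f\in F^{\alpha q}_p$ such that $\|f\|_{F^{\alpha q}_p(H)}=\infty$ and hence $f\notin F^{\alpha q}_p(H)$. Here $F^{\alpha q}_p$ and $F^{\alpha q}_p(H)$ are, respectively, the classical Triebel–Lizorkin space on $\mathbb{R}^d$ and the Hermite–Triebel–Lizorkin space.
   Context: $F^{\alpha q}_p$ is the classical (inhomogeneous) Triebel–Lizorkin space on $\mathbb{R}^d$ with smoothness $\alpha$, integrability index $p$ and summability index $q$; $(t)_+:=\max\{t,0\}$. Hermite functions and kernels: $H_n(t)=(-1)^n e^{t^2}(\frac{d}{dt})^n e^{-t^2}$, $h_n(t)=(2^n n!\sqrt\pi)^{-1/2}H_n(t)e^{-t^2/2}$, $\mathcal{H}_\beta(x)=h_{\beta_1}(x_1)\cdots h_{\beta_d}(x_d)$ for $\beta\in\mathbb{N}_0^d$, and $\mathcal{H}_\nu(x,y)=\sum_{|\beta|=\nu}\mathcal{H}_\beta(x)\mathcal{H}_\beta(y)$, with $|\beta|=\beta_1+\dots+\beta_d$. For tempered distributions $f\in\mathcal{S}'$ put $\langle f,\phi\rangle:=f(\overline\phi)$, and for a kernel $\Phi$ with $\Phi(x,\cdot)\in\mathcal{S}$ put $\Phi*f(x):=\langle f,\overline{\Phi(x,\cdot)}\rangle$. Let $\widehat a\in C^\infty[0,\infty)$, $\operatorname{supp}\widehat a\subset[1/4,4]$, $|\widehat a(t)|>c>0$ for $t\in[1/3,3]$; set $\Phi_0:=\mathcal{H}_0(\cdot,\cdot)$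 and $\Phi_j:=\sum_{\nu=0}^\infty\widehat a(\nu/4^{j-1})\mathcal{H}_\nu(\cdot,\cdot)$, $j\ge1$. The Hermite–Triebel–Lizorkin space $F^{\alpha q}_p(H)$ is the set of all $f\in\mathcal{S}'$ with $$\|f\|_{F^{\alpha q}_p(H)}:=\Big\|\Big(\sum_{j=0}^\infty(2^{\alpha j}|\Phi_j*f(\cdot)|)^q\Big)^{1/q}\Big\|_{L^p(\mathbb{R}^d)}<\infty$$ (sup norm in place of the $\ell^q$-norm if $q=\infty$). Different choices of $\widehat a$ give equivalent quasi-norms. *)

theory Defs
  imports "HOL-Analysis.Analysis"
begin

section \<open>Schwartz functions and tempered distributions\<close>

text \<open>Points are vectors in \<open>real ^ 'n\<close>, so the dimension is \<open>d = CARD('n)\<close> and a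
  multi-index is a function \<open>'n \<Rightarrow> nat\<close>. Iterated partial derivatives are indexed by the list of
  the directions of differentiation.\<close>

definition partial_deriv :: "'n::finite \<Rightarrow> (real ^ 'n \<Rightarrow> complex) \<Rightarrow> real ^ 'n \<Rightarrow> complex" where
  "partial_deriv i \<phi> x = frechet_derivative \<phi> (at x) (axis i 1)"

primrec partial_derivs ::
    "'n::finite list \<Rightarrow> (real ^ 'n \<Rightarrow> complex) \<Rightarrow> real ^ 'n \<Rightarrow> complex" where
  "partial_derivs [] \<phi> = \<phi>"
| "partial_derivs (i # is) \<phi> = partial_deriv i (partial_derivs is \<phi>)"

text \<open>Smoothness: every iterated partial derivative is differentiable everywhere, hence continuous.\<close>

definition schwartz :: "(real ^ 'n::finite \<Rightarrow> complex) set" where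
  "schwartz = {\<phi>. (\<forall>is x. partial_derivs is \<phi> differentiable (at x)) \<and>
     (\<forall>k is. bounded (range (\<lambda>x. of_real ((1 + norm x) ^ k) * partial_derivs is \<phi> x)))}"

definition schwartz_norm :: "nat \<Rightarrow> (real ^ 'n::finite \<Rightarrow> complex) \<Rightarrow> real" where
  "schwartz_norm k \<phi> =
     (\<Sum>is | length is \<le> k. SUP x. (1 + norm x) ^ k * norm (partial_derivs is \<phi> x))"

text \<open>A distribution is a functional on all functions of which only the values on Schwartz functions
  matter. As the seminorms above increase with \<open>k\<close> and generate the topology of the Schwartz
  space, a linear functional is continuous iff it is dominated by a multiple of one of them.\<close>

definition tempered_distribution :: "((real ^ 'n::finite \<Rightarrow> complex) \<Rightarrow> complex) \<Rightarrow> bool" where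
  "tempered_distribution u \<longleftrightarrow>
     (\<forall>\<phi>\<in>schwartz. \<forall>\<psi>\<in>schwartz. u (\<lambda>x. \<phi> x + \<psi> x) = u \<phi> + u \<psi>) \<and>
     (\<forall>c. \<forall>\<phi>\<in>schwartz. u (\<lambda>x. c * \<phi> x) = c * u \<phi>) \<and>
     (\<exists>C k. \<forall>\<phi>\<in>schwartz. norm (u \<phi>) \<le> C * schwartz_norm k \<phi>)"

definition distribution_of ::
    "(real ^ 'n::finite \<Rightarrow> complex) \<Rightarrow> (real ^ 'n \<Rightarrow> complex) \<Rightarrow> complex" where
  "distribution_of f \<phi> = (\<integral>x. f x * \<phi> x \<partial>lborel)"

text \<open>The sesquilinear pairing, and the action of a kernel on a distribution.
  The two conjugations cancel: \<open>kernel_conv \<Phi> u x = u (\<Phi> x)\<close>.\<close>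

definition pairing ::
    "((real ^ 'n::finite \<Rightarrow> complex) \<Rightarrow> complex) \<Rightarrow> (real ^ 'n \<Rightarrow> complex) \<Rightarrow> complex" where
  "pairing u \<phi> = u (\<lambda>y. cnj (\<phi> y))"

definition kernel_conv ::
    "(real ^ 'n::finite \<Rightarrow> real ^ 'n \<Rightarrow> complex) \<Rightarrow> ((real ^ 'n \<Rightarrow> complex) \<Rightarrow> complex)
      \<Rightarrow> real ^ 'n \<Rightarrow> complex" where
  "kernel_conv \<Phi> u x = pairing u (\<lambda>y. cnj (\<Phi> x y))"

section \<open>Mixed \<open>L\<^sup>p(\<ell>\<^sup>q)\<close> quasi-norms with values in \<open>[0, \<infinity>]\<close>\<close>

text \<open>Only used for positive exponents, so that \<open>\<infinity>\<close> is mapped to \<open>\<infinity>\<close> and \<open>0\<close> to \<open>0\<close>.\<close>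

definition ennreal_powr :: "ennreal \<Rightarrow> real \<Rightarrow> ennreal" where
  "ennreal_powr x r = (if x = \<infinity> then \<infinity> else ennreal (enn2real x powr r))"

definition lq_norm :: "ennreal \<Rightarrow> (nat \<Rightarrow> ennreal) \<Rightarrow> ennreal" where
  "lq_norm q s = (if q = \<infinity> then (SUP j. s j)
     else ennreal_powr (\<Sum>j. ennreal_powr (s j) (enn2real q)) (1 / enn2real q))"

definition Lp_norm :: "real \<Rightarrow> (real ^ 'n::finite \<Rightarrow> ennreal) \<Rightarrow> ennreal" where
  "Lp_norm p g = ennreal_powr (\<integral>\<^sup>+x. ennreal_powr (g x) p \<partial>lborel) (1 / p)"

text \<open>The Triebel--Lizorkin quasi-norm built from a sequence of kernels.\<close>

definition kernel_TL_norm ::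
    "(nat \<Rightarrow> real ^ 'n::finite \<Rightarrow> real ^ 'n \<Rightarrow> complex) \<Rightarrow> real \<Rightarrow> real \<Rightarrow> ennreal
      \<Rightarrow> ((real ^ 'n \<Rightarrow> complex) \<Rightarrow> complex) \<Rightarrow> ennreal" where
  "kernel_TL_norm \<Phi> \<alpha> p q u =
     Lp_norm p (\<lambda>x. lq_norm q (\<lambda>j. ennreal (2 powr (\<alpha> * real j) * norm (kernel_conv (\<Phi> j) u x))))"

section \<open>Classical Triebel--Lizorkin spaces\<close>

text \<open>The radii below refer to the Fourier transform with kernel \<open>exp (- \<i> x\<bullet>\<xi>)\<close>.\<close>

definition fourier :: "(real ^ 'n::finite \<Rightarrow> complex) \<Rightarrow> real ^ 'n \<Rightarrow> complex" where
  "fourier \<phi> \<xi> = (\<integral>x. \<phi> x * cis (- (x \<bullet> \<xi>)) \<partial>lborel)"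

text \<open>Admissible pairs in the sense of Frazier and Jawerth. All of them give the same space, with
  equivalent quasi-norms.\<close>

definition LP_admissible ::
    "(real ^ 'n::finite \<Rightarrow> complex) \<Rightarrow> (real ^ 'n \<Rightarrow> complex) \<Rightarrow> bool" where
  "LP_admissible \<phi>\<^sub>0 \<phi> \<longleftrightarrow> \<phi>\<^sub>0 \<in> schwartz \<and> \<phi> \<in> schwartz \<and>
     closure {\<xi>. fourier \<phi>\<^sub>0 \<xi> \<noteq> 0} \<subseteq> {\<xi>. norm \<xi> \<le> 2} \<and>
     closure {\<xi>. fourier \<phi> \<xi> \<noteq> 0} \<subseteq> {\<xi>. 1 / 2 \<le> norm \<xi> \<and> norm \<xi> \<le> 2} \<and>
     (\<exists>c>0. (\<forall>\<xi>. norm \<xi> \<le> 5 / 3 \<longrightarrow> c \<le> norm (fourier \<phi>\<^sub>0 \<xi>)) \<and>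
            (\<forall>\<xi>. 3 / 5 \<le> norm \<xi> \<and> norm \<xi> \<le> 5 / 3 \<longrightarrow> c \<le> norm (fourier \<phi> \<xi>)))"

text \<open>The convolution kernels \<open>\<phi>\<^sub>j (x - y)\<close> with \<open>\<phi>\<^sub>j = 2^(j d) \<phi> (2^j \<cdot>)\<close> for \<open>j \<ge> 1\<close>.\<close>

definition LP_kernel ::
    "(real ^ 'n::finite \<Rightarrow> complex) \<Rightarrow> (real ^ 'n \<Rightarrow> complex)
      \<Rightarrow> nat \<Rightarrow> real ^ 'n \<Rightarrow> real ^ 'n \<Rightarrow> complex" where
  "LP_kernel \<phi>\<^sub>0 \<phi> j x y =
     (if j = 0 then \<phi>\<^sub>0 (x - y) else 2 ^ (j * CARD('n)) * \<phi> ((2 ^ j) *\<^sub>R (x - y)))"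

definition TL_norm ::
    "(real ^ 'n::finite \<Rightarrow> complex) \<Rightarrow> (real ^ 'n \<Rightarrow> complex) \<Rightarrow> real \<Rightarrow> real \<Rightarrow> ennreal
      \<Rightarrow> ((real ^ 'n \<Rightarrow> complex) \<Rightarrow> complex) \<Rightarrow> ennreal" where
  "TL_norm \<phi>\<^sub>0 \<phi> = kernel_TL_norm (LP_kernel \<phi>\<^sub>0 \<phi>)"

definition TL_space ::
    "(real ^ 'n::finite \<Rightarrow> complex) \<Rightarrow> (real ^ 'n \<Rightarrow> complex) \<Rightarrow> real \<Rightarrow> real \<Rightarrow> ennreal
      \<Rightarrow> ((real ^ 'n \<Rightarrow> complex) \<Rightarrow> complex) set" where
  "TL_space \<phi>\<^sub>0 \<phi> \<alpha> p q = {u. tempered_distribution u \<and> TL_norm \<phi>\<^sub>0 \<phi> \<alpha> p q u < \<infinity>}"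

section \<open>Hermite--Triebel--Lizorkin spaces\<close>

definition hermite_poly :: "nat \<Rightarrow> real \<Rightarrow> real" where
  "hermite_poly n t = (- 1) ^ n * exp (t\<^sup>2) * (deriv ^^ n) (\<lambda>s. exp (- s\<^sup>2)) t"

definition hermite_fun :: "nat \<Rightarrow> real \<Rightarrow> real" where
  "hermite_fun n t =
     (2 ^ n * fact n * sqrt pi) powr (- 1 / 2) * hermite_poly n t * exp (- t\<^sup>2 / 2)"

definition hermite_multi :: "('n::finite \<Rightarrow> nat) \<Rightarrow> real ^ 'n \<Rightarrow> real" where
  "hermite_multi \<beta> x = (\<Prod>i\<in>UNIV. hermite_fun (\<beta> i) (x $ i))"

definition hermite_kernel :: "nat \<Rightarrow> real ^ 'n::finite \<Rightarrow> real ^ 'n \<Rightarrow> real" where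
  "hermite_kernel \<nu> x y =
     (\<Sum>\<beta> | (\<Sum>i\<in>UNIV. \<beta> i) = \<nu>. hermite_multi \<beta> x * hermite_multi \<beta> y)"

definition halfline_deriv :: "(real \<Rightarrow> complex) \<Rightarrow> real \<Rightarrow> complex" where
  "halfline_deriv a t = vector_derivative a (at t within {0..})"

text \<open>Smoothness, support and lower bound only involve the values of \<open>a\<close> on \<open>[0, \<infinity>)\<close>.
  Complex values are allowed.\<close>

definition hermite_admissible :: "(real \<Rightarrow> complex) \<Rightarrow> bool" where
  "hermite_admissible a \<longleftrightarrow>
     (\<forall>n. \<forall>t\<ge>0. (halfline_deriv ^^ n) a differentiable (at t within {0..})) \<and>
     closure {t. 0 \<le> t \<and> a t \<noteq> 0} \<subseteq> {1 / 4..4} \<and>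
     (\<exists>c>0. \<forall>t\<in>{1 / 3..3}. c < norm (a t))"

text \<open>For \<open>j \<ge> 1\<close> the series has only finitely many nonzero terms.\<close>

definition HTL_kernel ::
    "(real \<Rightarrow> complex) \<Rightarrow> nat \<Rightarrow> real ^ 'n::finite \<Rightarrow> real ^ 'n \<Rightarrow> complex" where
  "HTL_kernel a j x y =
     (if j = 0 then of_real (hermite_kernel 0 x y)
      else (\<Sum>\<nu>. a (real \<nu> / 4 ^ (j - 1)) * of_real (hermite_kernel \<nu> x y)))"

definition HTL_norm ::
    "(real \<Rightarrow> complex) \<Rightarrow> real \<Rightarrow> real \<Rightarrow> ennreal
      \<Rightarrow> ((real ^ 'n::finite \<Rightarrow> complex) \<Rightarrow> complex) \<Rightarrow> ennreal" where
  "HTL_norm a = kernel_TL_norm (HTL_kernel a)"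

definition HTL_space ::
    "(real \<Rightarrow> complex) \<Rightarrow> real \<Rightarrow> real \<Rightarrow> ennreal
      \<Rightarrow> ((real ^ 'n::finite \<Rightarrow> complex) \<Rightarrow> complex) set" where
  "HTL_space a \<alpha> p q = {u. tempered_distribution u \<and> HTL_norm a \<alpha> p q u < \<infinity>}"

end

theory Submission
  imports Defs "HOL-Probability.Probability"
begin

text \<open>The Hermite operator contains the potential \<open>|x|\<^sup>2\<close>, so translating a function far away
  raises its Hermite frequency, whereas classical Triebel--Lizorkin quasi-norms are
  translation invariant. The witness is \<open>f = \<Sum>\<^sub>k 2^(-k) g(\<cdot> - s\<^sub>k e)\<close> with
  \<open>g(x) = exp(-|x|\<^sup>2/2)\<close>, a coordinate vector \<open>e\<close>, and \<open>s\<^sub>k\<^sup>2/2 = 4^(j\<^sub>k - 1)\<close> for \<open>j\<^sub>k\<close>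
  growing linearly in \<open>k\<close> with a large slope. In the classical norm the blocks of \<open>g\<close> decay rapidly in both
  scale and space, so \<open>f\<close> has finite quasi-norm.

  A translated Gaussian \<open>g(\<cdot> - s e)\<close> is a coherent state: its squared Hermite coefficients are
  Poisson distributed with mean \<open>s\<^sup>2/2\<close>. Hence pairing \<open>u = \<Phi>\<^sub>j * f\<close>, \<open>j = j\<^sub>k\<close>, with
  \<open>g(\<cdot> - s\<^sub>k e)\<close> gives at least \<open>c 2^(-k)\<close>, since \<open>a(\<nu>/4^(j-1))\<close> is close to \<open>a(1)\<close> where
  the coefficients concentrate and all coefficients of \<open>f\<close> are nonnegative. For \<open>p \<ge> 1\<close> this
  bounds \<open>\<parallel>u\<parallel>\<^sub>p\<close> from below directly; for \<open>p < 1\<close> one loses the factor \<open>\<parallel>u\<parallel>\<^sub>\<infinity>\<close> to the power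
  \<open>1/p - 1\<close>, which is at most of order \<open>2^(j(1/p - 1))\<close>. The factor \<open>2^(\<alpha>j)\<close> beats both.\<close>


section \<open>Gaussian integrals\<close>

text \<open>Interactions between different translates are summed crudely rather than by separation.
  The pairing for the \<open>k\<close>-th translate is therefore bounded below by
  \<open>c 2^(-k) - C 2^(-m)\<close> with \<open>m = j - 1\<close>: the error is the relative width
  2^(-m) of a Poisson law of mean 4^m, and it carries no factor 2^(-k) because the heavier
  translates enter it too. So m has to outgrow k, and the same slope lets the smoothness gain pay
  for the weight 2^(-k). The mean is put at 4^m because block m + 1 evaluates the cutoff at \<nu> /
  4^m, so the coefficients sit where the cutoff takes the value \<open>a 1\<close>, which is
  nonzero.

  Keeping all centres on one axis makes the Hermite side one-dimensional: in the other variables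
  everything stays in the ground state, so blocks of index j have sup norm O(2^j) in every
  dimension. Testing a block with the coherent state itself turns it into a sum of values of
  \<open>a\<close> against nonnegative weights, so a lower bound needs no knowledge of the shape of
  the block and suffers no cancellation beyond the oscillation of \<open>a\<close>.\<close>

lemma
  fixes f :: "'n::finite \<Rightarrow> real \<Rightarrow> 'b::{real_normed_field,banach,second_countable_topology}"
  assumes int: "\<And>i. integrable lborel (f i)"
  shows integrable_prod_vec: "integrable lborel (\<lambda>x::real^'n. \<Prod>i\<in>UNIV. f i (x $ i))"
    and integral_prod_vec: "integral\<^sup>L lborel (\<lambda>x::real^'n. \<Prod>i\<in>UNIV. f i (x $ i)) = (\<Prod>i\<in>UNIV. integral\<^sup>L lborel (f i))"
proof -
  interpret product_sigma_finite "\<lambda>_::real^'n. lborel :: real measure" ..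
  \<comment> \<open>The product description of Lebesgue measure is indexed by basis vectors, so the
    factors are transported from coordinates to \<open>Basis\<close> along
    \<open>axis i 1\<close>.\<close>
  define e :: "'n \<Rightarrow> real^'n" where "e i = axis i 1" for i
  define h where "h b = f (inv e b)" for b
  have inj: "inj e" by (auto simp: inj_def e_def axis_eq_axis)
  have bij: "bij_betw e UNIV Basis"
    by (intro bij_betw_imageI inj) (auto simp: e_def Basis_vec_def)
  have [simp]: "h (e i) = f i" for i by (simp add: h_def inv_f_f[OF inj])
  have nth: "(\<Sum>b\<in>Basis. y b *\<^sub>R b) $ i = y (e i)" for y :: "real^'n \<Rightarrow> real" and i
    unfolding cart_eq_inner_axis
    using inner_sum_left_Basis[of "e i" y] by (simp add: e_def)
  have reidx: "(\<Prod>i\<in>UNIV. f i ((\<Sum>b\<in>Basis. y b *\<^sub>R b) $ i)) = (\<Prod>b\<in>Basis. h b (y b))"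
    for y :: "real^'n \<Rightarrow> real"
    unfolding nth using prod.reindex_bij_betw[OF bij, of "\<lambda>b. h b (y b)"] by simp
  have intb: "integrable lborel (h b)" for b using int by (simp add: h_def)
  have [measurable]: "f i \<in> borel_measurable borel" for i
    using borel_measurable_integrable[OF int[of i]] by simp
  have m1 [measurable]: "(\<lambda>f. \<Sum>b\<in>Basis. f b *\<^sub>R b) \<in> (\<Pi>\<^sub>M b\<in>Basis. lborel) \<rightarrow>\<^sub>M (borel :: (real^'n) measure)"
    by measurable
  have m2: "(\<lambda>x::real^'n. \<Prod>i\<in>UNIV. f i (x $ i)) \<in> borel_measurable borel"
    by measurable
  show "integrable lborel (\<lambda>x::real^'n. \<Prod>i\<in>UNIV. f i (x $ i))"
    apply (subst lborel_eq)
    apply (subst integrable_distr_eq[OF m1 m2])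
    unfolding reidx by (intro product_integrable_prod intb) auto
  have "integral\<^sup>L lborel (\<lambda>x::real^'n. \<Prod>i\<in>UNIV. f i (x $ i)) = integral\<^sup>L (\<Pi>\<^sub>M b\<in>(Basis::(real^'n) set). lborel) (\<lambda>y. \<Prod>b\<in>Basis. h b (y b))"
    apply (subst lborel_eq)
    apply (subst integral_distr[OF m1 m2])
    unfolding reidx ..
  also have "\<dots> = (\<Prod>b\<in>Basis. integral\<^sup>L lborel (h b))"
    by (intro product_integral_prod intb) auto
  also have "\<dots> = (\<Prod>i\<in>UNIV. integral\<^sup>L lborel (f i))"
    using prod.reindex_bij_betw[OF bij, of "\<lambda>b. integral\<^sup>L lborel (h b)"] by simp
  finally show "integral\<^sup>L lborel (\<lambda>x::real^'n. \<Prod>i\<in>UNIV. f i (x $ i)) = (\<Prod>i\<in>UNIV. integral\<^sup>L lborel (f i))" .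
qed

lemma integrable_poly_gaussian: "integrable lborel (\<lambda>t::real. t ^ k * exp (- t\<^sup>2 / 2))"
proof -
  have "integrable lborel (\<lambda>x. sqrt (2 * pi) * (std_normal_density x * x ^ k))"
    by (intro integrable_mult_right integrable_std_normal_moment)
  then show ?thesis by (simp add: std_normal_density_def field_simps)
qed

lemma gaussian_integral: "(\<integral>t. exp (- t\<^sup>2 / 2 :: real) \<partial>lborel) = sqrt (2 * pi)"
proof -
  have "(\<integral>t. std_normal_density t \<partial>lborel) = 1"
    by simp
  then show ?thesis by (simp add: std_normal_density_def field_simps)
qed

text \<open>This is the characteristic function of the standard normal law, with the normalising
  factor of the density moved to the other side.\<close>

lemma fourier_gaussian_1:
  "(\<integral>t. of_real (exp (- t\<^sup>2 / 2)) * cis (v * t) \<partial>lborel) = of_real (sqrt (2 * pi) * exp (- v\<^sup>2 / 2))"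
proof -
  have "complex_of_real (exp (- v\<^sup>2 / 2)) = (\<integral>t. cis (v * t) \<partial>density lborel std_normal_density)"
    using fun_cong[OF char_std_normal_distribution, of v]
    by (simp add: char_def  cis_conv_exp)
  also have "\<dots> = (\<integral>t. std_normal_density t *\<^sub>R cis (v * t) \<partial>lborel)"
    by (subst integral_density) (auto simp: cis_conv_exp)
  also have "\<dots> = (\<integral>t. (1 / sqrt (2 * pi)) *\<^sub>R (of_real (exp (- t\<^sup>2 / 2)) * cis (v * t)) \<partial>lborel)"
    by (simp add: std_normal_density_def scaleR_conv_of_real mult_ac)
  also have "\<dots> = (1 / sqrt (2 * pi)) *\<^sub>R (\<integral>t. (of_real (exp (- t\<^sup>2 / 2)) * cis (v * t)) \<partial>lborel)"
    by (rule integral_scaleR_right)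
  finally show ?thesis by (simp add: scaleR_conv_of_real field_simps)
qed

lemma integrable_inverse_square: "integrable lborel (\<lambda>t::real. 1 / (1 + t\<^sup>2))"
  using Sinc_Integral.integrable_inverse_1_plus_square
  by (simp add: set_integrable_def inverse_eq_divide)

text \<open>The exponent is twice the dimension because each of the factors
  \<open>1 + (x $ i)\<^sup>2\<close> is at most \<open>(1 + norm x)\<^sup>2\<close>; the product of
  these factors is inverted by a product of integrable functions of one variable.\<close>

lemma integrable_pow_decay:
  "integrable lborel (\<lambda>x::real^'n::finite. 1 / (1 + norm x) ^ (2 * CARD('n)))"
proof (rule Bochner_Integration.integrable_bound)
  show "integrable lborel (\<lambda>x::real^'n. \<Prod>i\<in>UNIV. 1 / (1 + (x $ i)\<^sup>2))"
    by (rule integrable_prod_vec[OF integrable_inverse_square])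
  show "AE x::real^'n in lborel. norm (1 / (1 + norm x) ^ (2 * CARD('n))) \<le> norm (\<Prod>i\<in>(UNIV::'n set). 1 / (1 + (x $ i)\<^sup>2))"
  proof (rule AE_I2)
    fix x :: "real^'n"
    have "(x $ i)\<^sup>2 \<le> (norm x)\<^sup>2" for i
      using component_le_norm_cart[of x i] by (metis abs_ge_zero power2_abs power_mono)
    then have le: "1 + (x $ i)\<^sup>2 \<le> (1 + norm x)\<^sup>2" for i
      by (simp add: power2_sum add_increasing2)
    have pos: "0 < 1 + (x $ i)\<^sup>2" for i by (smt (verit) zero_le_power2)
    have "1 / (1 + norm x) ^ (2 * CARD('n)) = (\<Prod>i\<in>(UNIV::'n set). 1 / (1 + norm x)\<^sup>2)"
      by (simp add: power_mult power_divide power_one_over)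
    also have "\<dots> \<le> (\<Prod>i\<in>(UNIV::'n set). 1 / (1 + (x $ i)\<^sup>2))"
      by (intro prod_mono conjI divide_left_mono le mult_pos_pos pos zero_less_power add_pos_nonneg) auto
    finally show "norm (1 / (1 + norm x) ^ (2 * CARD('n))) \<le> norm (\<Prod>i\<in>(UNIV::'n set). 1 / (1 + (x $ i)\<^sup>2))"
      by (simp add: prod_nonneg less_imp_le[OF pos] abs_of_nonneg)
  qed
qed measurable

lemma norm_vec_sq: "(norm (x::real^'n::finite))\<^sup>2 = (\<Sum>i\<in>UNIV. (x $ i)\<^sup>2)"
  by (simp add: norm_vec_def L2_set_def sum_nonneg)

lemma gaussian_vec_prod:
  "exp (- (norm (x::real^'n::finite))\<^sup>2 / 2) = (\<Prod>i\<in>UNIV. exp (- (x $ i)\<^sup>2 / 2))"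
  by (simp add: norm_vec_sq exp_sum[symmetric] sum_negf sum_divide_distrib)

lemma integrable_gaussian_vec: "integrable lborel (\<lambda>x::real^'n::finite. exp (- (norm x)\<^sup>2 / 2))"
  unfolding gaussian_vec_prod using integrable_poly_gaussian[of 0]
  by (intro integrable_prod_vec) simp

lemma integrable_wide_gaussian_vec: "integrable lborel (\<lambda>x::real^'n::finite. exp (- (norm x)\<^sup>2 / 4))"
proof -
  have "integrable lborel (\<lambda>x. sqrt (4 * pi) * normal_density 0 (sqrt 2) x)"
    by (intro integrable_mult_right integrable_normal_density) simp
  then have "integrable lborel (\<lambda>t::real. exp (- t\<^sup>2 / 4))"
    by (simp add: normal_density_def field_simps)
  then have "integrable lborel (\<lambda>x::real^'n. \<Prod>i\<in>UNIV. exp (- (x $ i)\<^sup>2 / 4))"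
    by (rule integrable_prod_vec)
  then show ?thesis
    by (simp add: norm_vec_sq exp_sum[symmetric] sum_negf sum_divide_distrib)
qed

lemma fourier_gaussian_vec:
  fixes v :: "real^'n::finite"
  shows "(\<integral>\<xi>. of_real (exp (- (norm \<xi>)\<^sup>2 / 2)) * cis (v \<bullet> \<xi>) \<partial>lborel)
       = of_real (sqrt (2 * pi) ^ CARD('n) * exp (- (norm v)\<^sup>2 / 2))"
proof -
  have cis: "cis (v \<bullet> \<xi>) = (\<Prod>i\<in>UNIV. cis (v $ i * \<xi> $ i))" for \<xi> :: "real^'n"
    by (simp add: inner_vec_def cis_conv_exp sum_distrib_left exp_sum)
  have int: "integrable lborel (\<lambda>t. complex_of_real (exp (- t\<^sup>2 / 2)) * cis (v $ i * t))" for i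
  proof (rule Bochner_Integration.integrable_bound)
    show "integrable lborel (\<lambda>t::real. exp (- t\<^sup>2 / 2))"
      using integrable_poly_gaussian[of 0] by simp
    have "(\<lambda>t. complex_of_real (exp (- t\<^sup>2 / 2)) * cis (v $ i * t)) \<in> borel_measurable borel"
      by (intro borel_measurable_continuous_onI continuous_intros) auto
    then show "(\<lambda>t. complex_of_real (exp (- t\<^sup>2 / 2)) * cis (v $ i * t)) \<in> borel_measurable lborel"
      by simp
  qed (simp add: norm_mult)
  have "(\<integral>\<xi>. of_real (exp (- (norm \<xi>)\<^sup>2 / 2)) * cis (v \<bullet> \<xi>) \<partial>lborel) =
     (\<integral>\<xi>. (\<Prod>i\<in>UNIV. of_real (exp (- (\<xi> $ i)\<^sup>2 / 2)) * cis (v $ i * \<xi> $ i)) \<partial>lborel)"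
    unfolding gaussian_vec_prod cis by (simp add: prod.distrib)
  also have "\<dots> = (\<Prod>i\<in>UNIV. of_real (sqrt (2 * pi) * exp (- (v $ i)\<^sup>2 / 2)))"
    by (subst integral_prod_vec[OF int]) (simp only: fourier_gaussian_1)
  finally show ?thesis
    unfolding gaussian_vec_prod by (simp add: prod.distrib)
qed

section \<open>Gaussians in classical Triebel--Lizorkin spaces\<close>

definition gauss :: "real ^ 'n::finite \<Rightarrow> real" where
  "gauss x = exp (- (norm x)\<^sup>2 / 2)"

lemma gauss_pos: "0 < gauss x" and gauss_le_1: "gauss x \<le> 1"
  by (simp_all add: gauss_def)

lemma gauss_measurable [measurable]: "gauss \<in> borel_measurable borel"
  unfolding gauss_def by measurable

text \<open>With r the norm of x, (1 + r)^k is at most exp (k r), and completing the square bounds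
  the remaining exponent k r - r^2 / 2 by k^2.\<close>

lemma gauss_pow_bound: "(1 + norm x) ^ k * gauss x \<le> exp (real k ^ 2)"
proof -
  have "(1 + norm x) ^ k \<le> exp (norm x) ^ k"
    by (intro power_mono) auto
  also have "\<dots> = exp (real k * norm x)" by (simp add: exp_of_nat_mult)
  finally have "(1 + norm x) ^ k * gauss x \<le> exp (real k * norm x) * gauss x"
    by (intro mult_right_mono less_imp_le[OF gauss_pos])
  also have "\<dots> = exp (real k * norm x - (norm x)\<^sup>2 / 2)"
    by (simp add: gauss_def exp_add[symmetric])
  also have "\<dots> \<le> exp (real k ^ 2)"
  proof -
    have "real k * norm x = real k ^ 2 + (norm x)\<^sup>2 / 4 - (real k - norm x / 2)\<^sup>2"
      by (simp add: power2_eq_square field_simps)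
    then have "real k * norm x - (norm x)\<^sup>2 / 2 \<le> real k ^ 2"
      using zero_le_power2[of "norm x"] zero_le_power2[of "real k - norm x / 2"] by linarith
    then show ?thesis by simp
  qed
  finally show ?thesis .
qed

lemma schwartz_continuous: "\<phi> \<in> schwartz \<Longrightarrow> continuous_on UNIV \<phi>"
proof -
  assume "\<phi> \<in> schwartz"
  then have "\<forall>x. partial_derivs [] \<phi> differentiable (at x)" unfolding schwartz_def by blast
  then show ?thesis
    by (simp add: continuous_at_imp_continuous_on differentiable_imp_continuous_within)
qed

lemma schwartz_measurable: "\<phi> \<in> schwartz \<Longrightarrow> \<phi> \<in> borel_measurable borel"
  by (rule borel_measurable_continuous_onI[OF schwartz_continuous])

lemma schwartz_bounded:
  assumes "\<phi> \<in> schwartz"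
  shows "bounded (range (\<lambda>x. of_real ((1 + norm x) ^ k) * \<phi> x))"
proof -
  have "bounded (range (\<lambda>x. of_real ((1 + norm x) ^ k) * partial_derivs [] \<phi> x))"
    using assms unfolding schwartz_def by blast
  then show ?thesis by simp
qed

lemma schwartz_decay:
  assumes "\<phi> \<in> schwartz"
  obtains C where "0 \<le> C" "\<And>x. (1 + norm x) ^ k * norm (\<phi> x) \<le> C"
proof -
  obtain C where C: "\<And>x. norm (of_real ((1 + norm x) ^ k) * \<phi> x) \<le> C"
    using schwartz_bounded[OF assms, of k] by (auto simp: bounded_iff)
  have "(1 + norm x) ^ k * norm (\<phi> x) \<le> C" for x
  proof -
    have "(1 + norm x) ^ k * norm (\<phi> x) = norm (of_real ((1 + norm x) ^ k) * \<phi> x)"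
      by (simp only: norm_mult norm_of_real) (simp add: power_abs[symmetric])
    then show ?thesis using C[of x] by simp
  qed
  moreover have "0 \<le> C" using C[of 0] norm_ge_zero order_trans by blast
  ultimately show thesis using that by blast
qed

lemma integrable_of_decay:
  fixes \<phi> :: "real ^ 'n::finite \<Rightarrow> 'b::{banach,second_countable_topology}"
  assumes m: "\<phi> \<in> borel_measurable borel"
    and d: "\<And>x. (1 + norm x) ^ (2 * CARD('n)) * norm (\<phi> x) \<le> C"
  shows "integrable lborel \<phi>"
proof (rule Bochner_Integration.integrable_bound)
  show "integrable lborel (\<lambda>x::real^'n. C * (1 / (1 + norm x) ^ (2 * CARD('n))))"
    by (intro integrable_mult_right integrable_pow_decay)
  show "AE x in lborel. norm (\<phi> x) \<le> norm (C * (1 / (1 + norm x) ^ (2 * CARD('n))))"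
  proof (rule AE_I2)
    fix x :: "real^'n"
    have pos: "0 < (1 + norm x) ^ (2 * CARD('n))" by (intro zero_less_power add_pos_nonneg) auto
    have "norm (\<phi> x) \<le> C * (1 / (1 + norm x) ^ (2 * CARD('n)))"
      using d[of x] pos by (simp add: field_simps)
    then show "norm (\<phi> x) \<le> norm (C * (1 / (1 + norm x) ^ (2 * CARD('n))))"
      unfolding real_norm_def by linarith
  qed
qed (use m in simp)

lemma schwartz_weighted_integrable:
  fixes \<phi> :: "real ^ 'n::finite \<Rightarrow> complex"
  assumes "\<phi> \<in> schwartz"
  shows "integrable lborel (\<lambda>x. (1 + norm x) ^ k * norm (\<phi> x))"
proof -
  obtain C where "0 \<le> C" and C: "\<And>x. (1 + norm x) ^ (2 * CARD('n) + k) * norm (\<phi> x) \<le> C"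
    using schwartz_decay[OF assms] by blast
  note schwartz_measurable[OF assms, measurable]
  show ?thesis
    by (rule integrable_of_decay[where C=C]) (use C in \<open>auto simp: power_add abs_mult mult_ac\<close>)
qed

lemma schwartz_integrable:
  fixes \<phi> :: "real ^ 'n::finite \<Rightarrow> complex"
  assumes "\<phi> \<in> schwartz"
  shows "integrable lborel \<phi>"
  using schwartz_weighted_integrable[OF assms, of 0] schwartz_measurable[OF assms]
  by (simp add: integrable_norm_iff)

section \<open>Littlewood--Paley blocks of a single Gaussian\<close>

lemma integral_rescale:
  fixes F :: "real ^ 'n::finite \<Rightarrow> complex"
  assumes c: "0 < c" and [measurable]: "F \<in> borel_measurable borel"
  shows "(\<integral>z. of_real (c ^ CARD('n)) * F (c *\<^sub>R (x - z)) \<partial>lborel) = (\<integral>w. F w \<partial>lborel)"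
proof -
  have "(\<integral>w. F w \<partial>lborel) = (\<integral>w. F w \<partial>density (distr lborel borel (\<lambda>z. c *\<^sub>R x + (- c) *\<^sub>R z)) (\<lambda>_. \<bar>- c\<bar> ^ DIM(real^'n)))"
    using c by (intro arg_cong[where f="\<lambda>M. integral\<^sup>L M F"] lborel_affine) simp
  also have "\<dots> = (\<integral>w. (\<bar>- c\<bar> ^ DIM(real^'n)) *\<^sub>R F w \<partial>distr lborel borel (\<lambda>z. c *\<^sub>R x + (- c) *\<^sub>R z))"
    by (subst integral_density) (auto simp: ennreal_power c)
  also have "\<dots> = (\<integral>z. (c ^ CARD('n)) *\<^sub>R F (c *\<^sub>R x + (- c) *\<^sub>R z) \<partial>lborel)"
    using c by (subst integral_distr) auto
  finally show ?thesis
    by (simp add: scaleR_conv_of_real algebra_simps)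
qed

text \<open>For \<open>c = 2 ^ j\<close> this integral is a block of a Gaussian, the dilation having
  been moved from the kernel to the Gaussian. Peetre's inequality \<open>1 + norm v \<le> (1 + norm
  w) * (1 + norm (v - w /\<^sub>R c))\<close> holds for all \<open>c \<ge> 1\<close>, so the weight
  is shared between \<phi> and the Gaussian with a constant independent of the scale.\<close>

lemma gauss_smear_decay:
  fixes \<phi> :: "real ^ 'n::finite \<Rightarrow> complex"
  assumes "\<phi> \<in> schwartz"
  obtains C where "0 \<le> C"
    "\<And>c v. 1 \<le> c \<Longrightarrow> norm (\<integral>w. \<phi> w * of_real (gauss (v - w /\<^sub>R c)) \<partial>lborel) \<le> C / (1 + norm v) ^ k"
proof -
  define C where "C = exp (real k ^ 2) * (\<integral>w. (1 + norm w) ^ k * norm (\<phi> w) \<partial>lborel)"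
  note schwartz_measurable[OF assms, measurable]
  have "norm (\<integral>w. \<phi> w * of_real (gauss (v - w /\<^sub>R c)) \<partial>lborel) \<le> C / (1 + norm v) ^ k"
    if c: "1 \<le> c" for c v
  proof -
    have pos: "0 < (1 + norm v) ^ k" by (intro zero_less_power add_pos_nonneg) auto
    define G where "G w = exp (real k ^ 2) / (1 + norm v) ^ k * ((1 + norm w) ^ k * norm (\<phi> w))" for w
    have le: "norm (\<phi> w * of_real (gauss (v - w /\<^sub>R c))) \<le> G w" for w
    proof -
      have "norm (w /\<^sub>R c) \<le> norm w"
        using c by (simp add: divide_le_eq mult_left_le_one_le field_simps mult_le_cancel_right1)
      then have "norm v \<le> norm w + norm (v - w /\<^sub>R c)"
        using norm_triangle_ineq[of "w /\<^sub>R c" "v - w /\<^sub>R c"] by simp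
      then have "1 + norm v \<le> (1 + norm w) * (1 + norm (v - w /\<^sub>R c))"
        using mult_nonneg_nonneg[OF norm_ge_zero[of w] norm_ge_zero[of "v - w /\<^sub>R c"]]
        by (simp only: distrib_left distrib_right)
      then have "(1 + norm v) ^ k \<le> (1 + norm w) ^ k * (1 + norm (v - w /\<^sub>R c)) ^ k"
        by (metis add_nonneg_nonneg norm_ge_zero power_mono power_mult_distrib zero_le_one)
      then have "(1 + norm v) ^ k * gauss (v - w /\<^sub>R c)
          \<le> (1 + norm w) ^ k * ((1 + norm (v - w /\<^sub>R c)) ^ k * gauss (v - w /\<^sub>R c))"
        using gauss_pos[of "v - w /\<^sub>R c"] by (simp add: mult.assoc[symmetric] mult_right_mono)
      also have "\<dots> \<le> (1 + norm w) ^ k * exp (real k ^ 2)"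
        by (intro mult_left_mono gauss_pow_bound) auto
      finally have "gauss (v - w /\<^sub>R c) \<le> exp (real k ^ 2) / (1 + norm v) ^ k * (1 + norm w) ^ k"
        using pos by (simp add: field_simps)
      then show ?thesis
        using gauss_pos[of "v - w /\<^sub>R c"] mult_right_mono[OF _ norm_ge_zero[of "\<phi> w"]]
        by (fastforce simp: G_def norm_mult mult_ac)
    qed
    have "norm (\<integral>w. \<phi> w * of_real (gauss (v - w /\<^sub>R c)) \<partial>lborel) \<le> (\<integral>w. G w \<partial>lborel)"
    proof (rule Bochner_Integration.integral_norm_bound_integral)
      show iG: "integrable lborel G"
        unfolding G_def by (intro integrable_mult_right schwartz_weighted_integrable assms)
      show "integrable lborel (\<lambda>w. \<phi> w * of_real (gauss (v - w /\<^sub>R c)))"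
        by (rule Bochner_Integration.integrable_bound[OF iG])
           (measurable, use le in \<open>auto intro!: AE_I2 order_trans[OF le]\<close>)
    qed (use le in auto)
    also have "\<dots> = C / (1 + norm v) ^ k"
      by (simp add: G_def C_def)
    finally show ?thesis .
  qed
  moreover have "0 \<le> C" unfolding C_def by simp
  ultimately show thesis using that by blast
qed

text \<open>Only the Gaussian is written as a Fourier integral. Exchanging the two integrations then
  produces \<open>fourier \<phi>\<close> at the frequency \<xi> / c, where the support condition on
  the Littlewood--Paley function can be applied.\<close>

lemma gauss_smear_fourier:
  fixes \<phi> :: "real ^ 'n::finite \<Rightarrow> complex"
  assumes "\<phi> \<in> schwartz" and c: "0 < c"
  shows "of_real (sqrt (2 * pi) ^ CARD('n)) * (\<integral>w. \<phi> w * of_real (gauss (v - w /\<^sub>R c)) \<partial>lborel)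
    = (\<integral>\<xi>. of_real (gauss \<xi>) * cis (v \<bullet> \<xi>) * fourier \<phi> (\<xi> /\<^sub>R c) \<partial>lborel)"
proof -
  note schwartz_measurable[OF assms(1), measurable]
  have [measurable]: "cis \<in> borel_measurable borel"
    by (intro borel_measurable_continuous_onI continuous_intros)
  define F where "F w \<xi> = \<phi> w * (of_real (gauss \<xi>) * cis ((v - w /\<^sub>R c) \<bullet> \<xi>))" for w \<xi>
  have nF: "norm (F w \<xi>) = norm (\<phi> w) * gauss \<xi>" for w \<xi>
    using gauss_pos[of \<xi>] by (simp add: F_def norm_mult)
  have ig: "integrable lborel (gauss :: real^'n \<Rightarrow> real)"
    unfolding gauss_def by (rule integrable_gaussian_vec)
  have iF: "integrable (lborel \<Otimes>\<^sub>M lborel) (case_prod F)"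
  proof (rule lborel_pair.Fubini_integrable)
    show "case_prod F \<in> borel_measurable (lborel \<Otimes>\<^sub>M lborel)"
      unfolding F_def by measurable
    show "integrable lborel (\<lambda>w. \<integral>\<xi>. norm (case_prod F (w, \<xi>)) \<partial>lborel)"
      by (simp add: nF integrable_norm[OF schwartz_integrable[OF assms(1)]])
    show "AE w in lborel. integrable lborel (\<lambda>\<xi>. case_prod F (w, \<xi>))"
    proof (rule AE_I2)
      fix w
      show "integrable lborel (\<lambda>\<xi>. case_prod F (w, \<xi>))"
      proof (rule Bochner_Integration.integrable_bound)
        show "integrable lborel (\<lambda>\<xi>::real^'n. norm (\<phi> w) * gauss \<xi>)" by (rule integrable_mult_right) (rule ig)
        have "F w \<in> borel_measurable borel" unfolding F_def by measurable
        then show "(\<lambda>\<xi>. case_prod F (w, \<xi>)) \<in> borel_measurable lborel" by simp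
      qed (use gauss_pos[THEN less_imp_le] in \<open>auto simp: nF\<close>)
    qed
  qed
  have "of_real (sqrt (2 * pi) ^ CARD('n)) * (\<integral>w. \<phi> w * of_real (gauss (v - w /\<^sub>R c)) \<partial>lborel)
      = (\<integral>w. \<phi> w * of_real (sqrt (2 * pi) ^ CARD('n) * gauss (v - w /\<^sub>R c)) \<partial>lborel)"
    by (subst integral_mult_right_zero[symmetric]) (simp add: mult_ac)
  also have "\<dots> = (\<integral>w. (\<integral>\<xi>. F w \<xi> \<partial>lborel) \<partial>lborel)"
    unfolding F_def gauss_def by (subst integral_mult_right_zero) (simp only: fourier_gaussian_vec)
  also have "\<dots> = (\<integral>\<xi>. (\<integral>w. F w \<xi> \<partial>lborel) \<partial>lborel)"
    by (rule lborel_pair.Fubini_integral[OF iF, symmetric])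
  also have "\<dots> = (\<integral>\<xi>. of_real (gauss \<xi>) * cis (v \<bullet> \<xi>) * fourier \<phi> (\<xi> /\<^sub>R c) \<partial>lborel)"
  proof (rule Bochner_Integration.integral_cong[OF refl])
    fix \<xi> :: "real^'n"
    have "F w \<xi> = of_real (gauss \<xi>) * cis (v \<bullet> \<xi>) * (\<phi> w * cis (- (w \<bullet> (\<xi> /\<^sub>R c))))" for w
    proof -
      have "cis ((v - w /\<^sub>R c) \<bullet> \<xi>) = cis (v \<bullet> \<xi>) * cis (- (w \<bullet> (\<xi> /\<^sub>R c)))"
        by (simp add: cis_mult inner_diff_left)
      then show ?thesis by (simp add: F_def mult_ac)
    qed
    then show "(\<integral>w. F w \<xi> \<partial>lborel) = of_real (gauss \<xi>) * cis (v \<bullet> \<xi>) * fourier \<phi> (\<xi> /\<^sub>R c)"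
      by (simp add: fourier_def)
  qed
  finally show ?thesis .
qed

lemma norm_fourier_le:
  fixes \<phi> :: "real ^ 'n::finite \<Rightarrow> complex"
  shows "norm (fourier \<phi> \<xi>) \<le> (\<integral>x. norm (\<phi> x) \<partial>lborel)"
proof -
  have "norm (fourier \<phi> \<xi>) \<le> (\<integral>x. norm (\<phi> x * cis (- (x \<bullet> \<xi>))) \<partial>lborel)"
    unfolding fourier_def by (rule integral_norm_bound)
  then show ?thesis by (simp add: norm_mult)
qed

lemma gauss_smear_highpass:
  fixes \<phi> :: "real ^ 'n::finite \<Rightarrow> complex"
  assumes "\<phi> \<in> schwartz" and zero: "\<And>\<xi>. norm \<xi> < 1 / 2 \<Longrightarrow> fourier \<phi> \<xi> = 0"
  obtains C where "0 \<le> C"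
    "\<And>c v. 0 < c \<Longrightarrow> norm (\<integral>w. \<phi> w * of_real (gauss (v - w /\<^sub>R c)) \<partial>lborel) \<le> C * exp (- (c\<^sup>2) / 16)"
proof -
  define A where "A = (\<integral>x. norm (\<phi> x) \<partial>lborel)"
  define B where "B = integral\<^sup>L lborel (\<lambda>\<xi>::real^'n. exp (- (norm \<xi>)\<^sup>2 / 4))"
  define \<kappa> where "\<kappa> = sqrt (2 * pi) ^ CARD('n)"
  have \<kappa>: "0 < \<kappa>" by (simp add: \<kappa>_def)
  have A: "0 \<le> A" unfolding A_def by simp
  have "norm (\<integral>w. \<phi> w * of_real (gauss (v - w /\<^sub>R c)) \<partial>lborel) \<le> A * B / \<kappa> * exp (- (c\<^sup>2) / 16)"
    if c: "0 < c" for c v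
  proof -
    define I where "I = (\<integral>w. \<phi> w * of_real (gauss (v - w /\<^sub>R c)) \<partial>lborel)"
    define G where "G \<xi> = A * exp (- (c\<^sup>2) / 16) * exp (- (norm \<xi>)\<^sup>2 / 4)" for \<xi> :: "real^'n"
    have le: "norm (of_real (gauss \<xi>) * cis (v \<bullet> \<xi>) * fourier \<phi> (\<xi> /\<^sub>R c)) \<le> G \<xi>" for \<xi>
    proof (cases "norm \<xi> < c / 2")
      case True
      then have "norm (\<xi> /\<^sub>R c) < 1 / 2" using c by (simp add: field_simps)
      then show ?thesis using A zero by (simp add: G_def)
    next
      case False
      \<comment> \<open>The exponent is split in half: one half is at least c^2 / 16 in this region,
        the other remains as an integrable Gaussian.\<close>
      then have "(c / 2)\<^sup>2 \<le> (norm \<xi>)\<^sup>2" using c by (intro power_mono) auto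
      then have "exp (- (norm \<xi>)\<^sup>2 / 2) \<le> exp (- (c\<^sup>2) / 16 + - (norm \<xi>)\<^sup>2 / 4)"
        by (simp add: power_divide)
      then have "gauss \<xi> \<le> exp (- (c\<^sup>2) / 16) * exp (- (norm \<xi>)\<^sup>2 / 4)"
        by (simp only: gauss_def exp_add)
      then have "gauss \<xi> * norm (fourier \<phi> (\<xi> /\<^sub>R c)) \<le> exp (- (c\<^sup>2) / 16) * exp (- (norm \<xi>)\<^sup>2 / 4) * A"
        unfolding A_def using gauss_pos[of \<xi>] by (intro mult_mono norm_fourier_le) auto
      then show ?thesis
        using gauss_pos[of \<xi>] by (simp add: G_def norm_mult mult_ac)
    qed
    have "\<kappa> * norm I = norm (of_real \<kappa> * I)"
      using \<kappa> by (simp add: norm_mult)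
    also have "of_real \<kappa> * I = (\<integral>\<xi>. of_real (gauss \<xi>) * cis (v \<bullet> \<xi>) * fourier \<phi> (\<xi> /\<^sub>R c) \<partial>lborel)"
      unfolding \<kappa>_def I_def by (rule gauss_smear_fourier[OF assms(1) c])
    also have "norm \<dots> \<le> (\<integral>\<xi>. G \<xi> \<partial>lborel)"
    proof (cases "integrable lborel (\<lambda>\<xi>. of_real (gauss \<xi>) * cis (v \<bullet> \<xi>) * fourier \<phi> (\<xi> /\<^sub>R c))")
      case True
      have "integrable lborel G"
        unfolding G_def by (rule integrable_mult_right) (rule integrable_wide_gaussian_vec)
      then show ?thesis
        by (rule Bochner_Integration.integral_norm_bound_integral[OF True _ le])
    next
      \<comment> \<open>The Bochner integral of a non-integrable function is 0, so the bound holds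
        here as well.\<close>
      case False
      then show ?thesis using A by (simp add: not_integrable_integral_eq G_def integral_nonneg_AE)
    qed
    also have "\<dots> = A * exp (- (c\<^sup>2) / 16) * B"
      by (simp add: G_def B_def)
    finally show ?thesis using \<kappa> by (simp add: I_def field_simps)
  qed
  moreover have "0 \<le> A * B / \<kappa>" using A \<kappa> by (simp add: B_def)
  ultimately show thesis using that by blast
qed

lemma exp_neg_le_inverse_power:
  fixes t :: real
  assumes "0 < t"
  shows "exp (- t) \<le> fact m / t ^ m"
proof -
  have "t ^ m / fact m = (\<Sum>n\<in>{m}. t ^ n /\<^sub>R fact n)" by (simp add: field_simps)
  also have "\<dots> \<le> (\<Sum>n. t ^ n /\<^sub>R fact n)"
    using assms by (intro sum_le_suminf sums_summable[OF exp_converges]) auto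
  also have "\<dots> = exp t" by (rule sums_unique[OF exp_converges, symmetric])
  finally show ?thesis
    using assms by (simp add: exp_minus field_simps)
qed

text \<open>The substitution w = 2^j (x - z) absorbs the normalising power of 2 in the kernel; at j
  = 0 it is a reflection, so one formula covers both kinds of kernel.\<close>

lemma gauss_LP_kernel:
  fixes \<phi>\<^sub>0 \<phi> :: "real ^ 'n::finite \<Rightarrow> complex"
  assumes "\<phi>\<^sub>0 \<in> schwartz" "\<phi> \<in> schwartz"
  shows "(\<integral>z. of_real (gauss (z - y)) * LP_kernel \<phi>\<^sub>0 \<phi> j x z \<partial>lborel)
    = (\<integral>w. (if j = 0 then \<phi>\<^sub>0 else \<phi>) w * of_real (gauss (x - y - w /\<^sub>R 2 ^ j)) \<partial>lborel)"
proof -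
  define \<psi> where "\<psi> = (if j = 0 then \<phi>\<^sub>0 else \<phi>)"
  have [measurable]: "\<psi> \<in> borel_measurable borel"
    using assms by (simp add: \<psi>_def schwartz_measurable)
  have "(\<integral>w. \<psi> w * of_real (gauss (x - y - w /\<^sub>R 2 ^ j)) \<partial>lborel) =
      (\<integral>z. of_real ((2 ^ j) ^ CARD('n)) * (\<psi> (2 ^ j *\<^sub>R (x - z)) * of_real (gauss (x - y - (2 ^ j *\<^sub>R (x - z)) /\<^sub>R 2 ^ j))) \<partial>lborel)"
    by (rule integral_rescale[symmetric]) measurable
  also have "\<dots> = (\<integral>z. of_real (gauss (z - y)) * LP_kernel \<phi>\<^sub>0 \<phi> j x z \<partial>lborel)"
    by (intro Bochner_Integration.integral_cong) (auto simp: LP_kernel_def \<psi>_def power_mult mult_ac)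
  finally show ?thesis by (simp add: \<psi>_def)
qed

lemma LP_kernel_decay:
  fixes \<phi>\<^sub>0 \<phi> :: "real ^ 'n::finite \<Rightarrow> complex"
  assumes "LP_admissible \<phi>\<^sub>0 \<phi>"
  obtains C where "0 \<le> C"
    "\<And>j x y. norm (\<integral>z. of_real (gauss (z - y)) * LP_kernel \<phi>\<^sub>0 \<phi> j x z \<partial>lborel)
        \<le> C * (1 / 2 ^ (L * j)) * (1 / (1 + norm (x - y)) ^ k)"
proof -
  have S: "\<phi>\<^sub>0 \<in> schwartz" "\<phi> \<in> schwartz" using assms by (auto simp: LP_admissible_def)
  have zero: "fourier \<phi> \<xi> = 0" if "norm \<xi> < 1 / 2" for \<xi>
  proof (rule ccontr)
    assume "fourier \<phi> \<xi> \<noteq> 0"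
    then have "\<xi> \<in> closure {\<xi>. fourier \<phi> \<xi> \<noteq> 0}"
      using closure_subset[of "{\<xi>. fourier \<phi> \<xi> \<noteq> 0}"] by blast
    then show False using assms that unfolding LP_admissible_def by fastforce
  qed
  obtain C0 where C0: "0 \<le> C0" "\<And>c v. 1 \<le> c \<Longrightarrow> norm (\<integral>w. \<phi>\<^sub>0 w * of_real (gauss (v - w /\<^sub>R c)) \<partial>lborel) \<le> C0 / (1 + norm v) ^ k"
    using gauss_smear_decay[OF S(1), of k] by blast
  \<comment> \<open>The spatial exponent is doubled because the square root taken below halves it
    again; the frequency bound is likewise brought to the form of a square, (2^(L j))^2.\<close>
  obtain C1 where C1: "0 \<le> C1" "\<And>c v. 1 \<le> c \<Longrightarrow> norm (\<integral>w. \<phi> w * of_real (gauss (v - w /\<^sub>R c)) \<partial>lborel) \<le> C1 / (1 + norm v) ^ (2 * k)"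
    using gauss_smear_decay[OF S(2), of "2 * k"] by blast
  obtain C2 where C2: "0 \<le> C2" "\<And>c v. 0 < c \<Longrightarrow> norm (\<integral>w. \<phi> w * of_real (gauss (v - w /\<^sub>R c)) \<partial>lborel) \<le> C2 * exp (- (c\<^sup>2) / 16)"
    using gauss_smear_highpass[OF S(2) zero] by blast
  define D where "D = sqrt (C1 * (C2 * (fact L * 16 ^ L)))"
  have D: "0 \<le> D" using C1(1) C2(1) by (simp add: D_def)
  define I where "I \<psi> v j = (\<integral>w. \<psi> w * complex_of_real (gauss (v - w /\<^sub>R 2 ^ j)) \<partial>lborel)"
    for \<psi> :: "real ^ 'n \<Rightarrow> complex" and v :: "real ^ 'n" and j :: nat
  have le0: "norm (I \<phi>\<^sub>0 v 0) \<le> C0 * (1 / 2 ^ (L * 0)) * (1 / (1 + norm v) ^ k)" for v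
    using C0(2)[of 1 v] by (simp add: I_def)
  have le1: "norm (I \<phi> v j) \<le> D * (1 / 2 ^ (L * j)) * (1 / (1 + norm v) ^ k)" for v j
  proof -
    have p: "0 < 1 + norm v" by (simp add: add_pos_nonneg)
    have a: "norm (I \<phi> v j) \<le> C1 / (1 + norm v) ^ (2 * k)"
      using C1(2)[of "2 ^ j" v] by (simp add: I_def)
    have "norm (I \<phi> v j) \<le> C2 * exp (- ((2 ^ j)\<^sup>2 / 16))"
      using C2(2)[of "2 ^ j" v] by (simp add: I_def)
    also have "\<dots> \<le> C2 * (fact L / ((2 ^ j)\<^sup>2 / 16) ^ L)"
      using C2(1) by (intro mult_left_mono exp_neg_le_inverse_power) auto
    also have "\<dots> = C2 * (fact L * 16 ^ L) / (2 ^ (L * j))\<^sup>2"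
      by (simp add: power_divide power_mult[symmetric] mult_ac)
    finally have b: "norm (I \<phi> v j) \<le> C2 * (fact L * 16 ^ L) / (2 ^ (L * j))\<^sup>2" .
    \<comment> \<open>The geometric mean of the spatial decay \<open>a\<close> and the frequency decay \<open>b\<close>.\<close>
    have "(norm (I \<phi> v j))\<^sup>2 \<le> C1 / (1 + norm v) ^ (2 * k) * (C2 * (fact L * 16 ^ L) / (2 ^ (L * j))\<^sup>2)"
      unfolding power2_eq_square[of "norm (I \<phi> v j)"]
      using a b C1(1) p by (intro mult_mono) auto
    also have "\<dots> = (D * (1 / 2 ^ (L * j)) * (1 / (1 + norm v) ^ k))\<^sup>2"
      using C1(1) C2(1) by (simp add: D_def power_mult_distrib power_divide power_mult[symmetric] mult_ac)
    finally show ?thesis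
      using D p by (subst (asm) power_mono_iff) auto
  qed
  have "norm (\<integral>z. of_real (gauss (z - y)) * LP_kernel \<phi>\<^sub>0 \<phi> j x z \<partial>lborel)
        \<le> (C0 + D) * (1 / 2 ^ (L * j)) * (1 / (1 + norm (x - y)) ^ k)" for j x y
  proof -
    define t where "t = (1 / 2 ^ (L * j)) * (1 / (1 + norm (x - y)) ^ k)"
    have t: "0 \<le> t" by (simp add: t_def)
    have "norm (\<integral>z. of_real (gauss (z - y)) * LP_kernel \<phi>\<^sub>0 \<phi> j x z \<partial>lborel) \<le> C0 * t \<or>
      norm (\<integral>z. of_real (gauss (z - y)) * LP_kernel \<phi>\<^sub>0 \<phi> j x z \<partial>lborel) \<le> D * t"
      unfolding gauss_LP_kernel[OF S] t_def
      using le0[of "x - y"] le1[of "x - y" j] by (cases "j = 0") (auto simp: I_def mult.assoc)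
    moreover have "0 \<le> C0 * t" "0 \<le> D * t" using t D C0(1) by auto
    ultimately show ?thesis unfolding t_def[symmetric] mult.assoc distrib_right by linarith
  qed
  then show thesis using that[of "C0 + D"] C0(1) D by simp
qed

section \<open>Weighted sums of translated Gaussians\<close>

definition gauss_comb :: "(nat \<Rightarrow> real ^ 'n::finite) \<Rightarrow> real ^ 'n \<Rightarrow> real" where
  "gauss_comb y z = (\<Sum>k. (1 / 2) ^ k * gauss (z - y k))"

lemma summable_half_powers_bounded:
  fixes b :: "nat \<Rightarrow> real"
  assumes "\<And>k. \<bar>b k\<bar> \<le> B" and "\<bar>r\<bar> < 1"
  shows "summable (\<lambda>k. r ^ k * b k)"
proof (rule summable_comparison_test')
  show "summable (\<lambda>k. \<bar>r\<bar> ^ k * B)" using assms(2) by (intro summable_mult2 summable_geometric) simp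
  show "norm (r ^ k * b k) \<le> \<bar>r\<bar> ^ k * B" for k
    using assms(1) by (simp add: abs_mult power_abs mult_left_mono)
qed

lemma gauss_abs_le: "\<bar>gauss x\<bar> \<le> 1"
  using gauss_pos[of x] gauss_le_1[of x] by simp

lemma gauss_comb_bounds: "0 \<le> gauss_comb y z" "gauss_comb y z \<le> 2"
proof -
  have s: "summable (\<lambda>k. (1 / 2) ^ k * gauss (z - y k))"
    by (rule summable_half_powers_bounded) (auto intro: gauss_abs_le)
  show "0 \<le> gauss_comb y z" unfolding gauss_comb_def
    by (intro suminf_nonneg s) (simp add: less_imp_le[OF gauss_pos])
  have "gauss_comb y z \<le> (\<Sum>k. (1 / 2) ^ k)" unfolding gauss_comb_def
    by (intro suminf_le s summable_geometric) (auto simp: gauss_le_1)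
  then show "gauss_comb y z \<le> 2" by (simp add: suminf_geometric)
qed

lemma gauss_comb_measurable [measurable]: "gauss_comb y \<in> borel_measurable borel"
  unfolding gauss_comb_def by measurable

lemma integrable_gauss_comb:
  fixes K :: "real ^ 'n::finite \<Rightarrow> complex"
  assumes K: "integrable lborel K"
  shows "integrable lborel (\<lambda>z. of_real (gauss_comb y z) * K z)"
proof (rule Bochner_Integration.integrable_bound)
  show "integrable lborel (\<lambda>z. 2 * norm (K z))" using K by simp
  have [measurable]: "K \<in> borel_measurable borel" using K by auto
  show "(\<lambda>z. of_real (gauss_comb y z) * K z) \<in> borel_measurable lborel" by measurable
  show "AE z in lborel. norm (of_real (gauss_comb y z) * K z) \<le> norm (2 * norm (K z))"
    using gauss_comb_bounds[of y] by (auto simp: norm_mult mult_right_mono)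
qed

text \<open>The \<open>k\<close>-th term is dominated by 2^(-k) times the norm of \<open>K\<close>,
  whatever the centres are. Both the classical and the Hermite kernels are reduced to one translate
  in this way.\<close>

lemma integral_gauss_comb:
  fixes K :: "real ^ 'n::finite \<Rightarrow> complex"
  assumes K: "integrable lborel K"
  shows "(\<lambda>k. (1 / 2) ^ k * (\<integral>z. of_real (gauss (z - y k)) * K z \<partial>lborel)) sums
    (\<integral>z. of_real (gauss_comb y z) * K z \<partial>lborel)"
proof -
  have [measurable]: "K \<in> borel_measurable borel" using K by auto
  define F where "F k z = complex_of_real ((1 / 2) ^ k * gauss (z - y k)) * K z" for k z
  have nF: "norm (F k z) \<le> (1 / 2) ^ k * norm (K z)" for k z
    using mult_mono[of "gauss (z - y k)" 1 "norm (K z)" "norm (K z)"] gauss_le_1[of "z - y k"] gauss_pos[of "z - y k"]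
    by (simp add: F_def norm_mult norm_power mult_left_mono)
  have iF: "integrable lborel (F k)" for k
  proof (rule Bochner_Integration.integrable_bound)
    show "integrable lborel (\<lambda>z. (1 / 2) ^ k * norm (K z))" using K by simp
    show "F k \<in> borel_measurable lborel" unfolding F_def by measurable
  qed (use nF in auto)
  have s1: "AE z in lborel. summable (\<lambda>k. norm (F k z))"
    by (intro AE_I2 summable_comparison_test'[of "\<lambda>k. (1 / 2) ^ k * norm (K _)", OF summable_mult2[OF summable_geometric]])
       (auto intro: nF)
  have s2: "summable (\<lambda>k. \<integral>z. norm (F k z) \<partial>lborel)"
  proof (rule summable_comparison_test')
    show "summable (\<lambda>k. (1 / 2) ^ k * (\<integral>z. norm (K z) \<partial>lborel))"
      by (intro summable_mult2 summable_geometric) simp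
    fix k
    have "(\<integral>z. norm (F k z) \<partial>lborel) \<le> (\<integral>z. (1 / 2) ^ k * norm (K z) \<partial>lborel)"
      using K by (intro integral_mono integrable_norm iF nF integrable_mult_right) auto
    then show "norm (\<integral>z. norm (F k z) \<partial>lborel) \<le> (1 / 2) ^ k * (\<integral>z. norm (K z) \<partial>lborel)"
      by simp
  qed
  have "(\<lambda>k. integral\<^sup>L lborel (F k)) sums (\<integral>z. (\<Sum>k. F k z) \<partial>lborel)"
    by (rule sums_integral[OF iF s1 s2])
  moreover have "integral\<^sup>L lborel (F k) = (1 / 2) ^ k * (\<integral>z. of_real (gauss (z - y k)) * K z \<partial>lborel)" for k
    unfolding F_def by (simp add: mult.assoc del: times_divide_eq_left)
  moreover have "(\<Sum>k. F k z) = of_real (gauss_comb y z) * K z" for z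
  proof -
    have "summable (\<lambda>k. (1 / 2) ^ k * gauss (z - y k))"
      by (rule summable_half_powers_bounded) (auto intro: gauss_abs_le)
    then have "(\<lambda>k. (1 / 2) ^ k * gauss (z - y k)) sums gauss_comb y z"
      unfolding gauss_comb_def by (rule summable_sums)
    then have "(\<lambda>k. F k z) sums (of_real (gauss_comb y z) * K z)"
      unfolding F_def by (intro sums_mult2) (simp only: sums_of_real_iff)
    then show ?thesis by (rule sums_unique[symmetric])
  qed
  ultimately show ?thesis by simp
qed

section \<open>Membership in the classical space\<close>

lemma ennreal_powr_mono: "x \<le> y \<Longrightarrow> 0 \<le> r \<Longrightarrow> ennreal_powr x r \<le> ennreal_powr y r"
  unfolding ennreal_powr_def
  by (auto simp: top_unique less_top intro!: ennreal_leI powr_mono2 enn2real_mono)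

lemma ennreal_powr_ennreal: "0 \<le> v \<Longrightarrow> ennreal_powr (ennreal v) r = ennreal (v powr r)"
  by (simp add: ennreal_powr_def)

text \<open>The constant depends on \<open>q\<close> alone and is chosen before \<open>V\<close>,
  which allows \<open>V\<close> to vary with the point at which the sequence norm is taken.\<close>

lemma lq_norm_geometric:
  assumes q: "0 < q"
  obtains K where "0 \<le> K"
    "\<And>V s. 0 \<le> V \<Longrightarrow> (\<And>j. s j \<le> ennreal (V * (1 / 2) ^ j)) \<Longrightarrow> lq_norm q s \<le> ennreal (V * K)"
proof (cases "q = \<infinity>")
  case True
  have "lq_norm q s \<le> ennreal (V * 1)" if V: "0 \<le> V" and s: "\<And>j. s j \<le> ennreal (V * (1 / 2) ^ j)" for V s
  proof -
    have "s j \<le> ennreal V" for j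
    proof -
      have "V * (1 / 2) ^ j \<le> V" using V by (simp add: mult_left_le power_le_one)
      then show ?thesis using s[of j] ennreal_leI order_trans by blast
    qed
    then show ?thesis using True by (auto simp: lq_norm_def intro: SUP_least)
  qed
  then show ?thesis using that[of 1] by simp
next
  case False
  define r where "r = enn2real q"
  have r: "0 < r" using q False by (simp add: r_def enn2real_positive_iff less_top)
  define \<rho> where "\<rho> = (1 / 2 :: real) powr r"
  have \<rho>: "0 < \<rho>" "\<rho> < 1" using r powr_less_mono2[of r "1/2" 1] by (auto simp: \<rho>_def)
  have "lq_norm q s \<le> ennreal (V * (1 / (1 - \<rho>)) powr (1 / r))"
    if V: "0 \<le> V" and s: "\<And>j. s j \<le> ennreal (V * (1 / 2) ^ j)" for V s
  proof -
    have t: "ennreal_powr (s j) r \<le> ennreal (V powr r * \<rho> ^ j)" for j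
    proof -
      have "ennreal_powr (s j) r \<le> ennreal_powr (ennreal (V * (1 / 2) ^ j)) r"
        using r by (intro ennreal_powr_mono s) auto
      also have "\<dots> = ennreal ((V * (1 / 2) ^ j) powr r)" using V by (intro ennreal_powr_ennreal) auto
      also have "(V * (1 / 2) ^ j) powr r = V powr r * \<rho> ^ j"
        using V by (simp add: powr_mult \<rho>_def powr_power mult.commute powr_powr flip: powr_realpow)
      finally show ?thesis .
    qed
    have "(\<Sum>j. ennreal_powr (s j) r) \<le> (\<Sum>j. ennreal (V powr r * \<rho> ^ j))"
      by (intro suminf_le t) auto
    also have "\<dots> = ennreal (\<Sum>j. V powr r * \<rho> ^ j)"
      using \<rho> by (intro suminf_ennreal2) (auto intro!: summable_mult summable_geometric)
    also have "(\<Sum>j. V powr r * \<rho> ^ j) = V powr r * (1 / (1 - \<rho>))"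
      using \<rho> by (subst suminf_mult) (auto simp: suminf_geometric)
    finally have "lq_norm q s \<le> ennreal_powr (ennreal (V powr r * (1 / (1 - \<rho>)))) (1 / r)"
      using False r by (simp add: lq_norm_def r_def[symmetric] ennreal_powr_mono)
    also have "\<dots> = ennreal ((V powr r * (1 / (1 - \<rho>))) powr (1 / r))"
      using \<rho> by (intro ennreal_powr_ennreal) auto
    also have "(V powr r * (1 / (1 - \<rho>))) powr (1 / r) = V * (1 / (1 - \<rho>)) powr (1 / r)"
      using \<rho> r V by (simp only: powr_mult) (simp add: powr_powr)
    finally show ?thesis .
  qed
  then show ?thesis using that[of "(1 / (1 - \<rho>)) powr (1 / r)"] by simp
qed

lemma integrable_LP_kernel:
  fixes \<phi>\<^sub>0 \<phi> :: "real ^ 'n::finite \<Rightarrow> complex"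
  assumes "\<phi>\<^sub>0 \<in> schwartz" "\<phi> \<in> schwartz"
  shows "integrable lborel (LP_kernel \<phi>\<^sub>0 \<phi> j x)"
proof -
  define \<psi> where "\<psi> = (if j = 0 then \<phi>\<^sub>0 else \<phi>)"
  have S: "\<psi> \<in> schwartz" using assms by (simp add: \<psi>_def)
  note schwartz_measurable[OF S, measurable]
  obtain C where "0 \<le> C" and C: "\<And>x. (1 + norm x) ^ (2 * CARD('n)) * norm (\<psi> x) \<le> C"
    using schwartz_decay[OF S] by blast
  have "integrable lborel (\<lambda>z. \<psi> (2 ^ j *\<^sub>R (x - z)))"
  proof (rule integrable_of_decay)
    fix z
    have "norm (x - z) \<le> norm ((2::real) ^ j *\<^sub>R (x - z))"
      by (simp add: mult_le_cancel_right1)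
    then have "norm z \<le> norm x + norm ((2::real) ^ j *\<^sub>R (x - z))"
      using norm_triangle_ineq4[of x "x - z"] by simp
    then have "1 + norm z \<le> (1 + norm x) * (1 + norm ((2::real) ^ j *\<^sub>R (x - z)))"
      using mult_nonneg_nonneg[OF norm_ge_zero[of x] norm_ge_zero[of "(2::real) ^ j *\<^sub>R (x - z)"]]
      by (simp only: distrib_left distrib_right)
    then have "(1 + norm z) ^ (2 * CARD('n)) \<le> (1 + norm x) ^ (2 * CARD('n)) * (1 + norm ((2::real) ^ j *\<^sub>R (x - z))) ^ (2 * CARD('n))"
      unfolding power_mult_distrib[symmetric] by (intro power_mono) auto
    then have "(1 + norm z) ^ (2 * CARD('n)) * norm (\<psi> (2 ^ j *\<^sub>R (x - z)))
      \<le> (1 + norm x) ^ (2 * CARD('n)) * (1 + norm ((2::real) ^ j *\<^sub>R (x - z))) ^ (2 * CARD('n)) * norm (\<psi> (2 ^ j *\<^sub>R (x - z)))"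
      by (intro mult_right_mono) auto
    also have "\<dots> \<le> (1 + norm x) ^ (2 * CARD('n)) * C"
      unfolding mult.assoc by (intro mult_left_mono C) auto
    finally show "(1 + norm z) ^ (2 * CARD('n)) * norm (\<psi> (2 ^ j *\<^sub>R (x - z))) \<le> (1 + norm x) ^ (2 * CARD('n)) * C" .
  qed measurable
  then have "integrable lborel (\<lambda>z. 2 ^ (j * CARD('n)) * \<psi> (2 ^ j *\<^sub>R (x - z)))"
    by (rule integrable_mult_right)
  moreover have "LP_kernel \<phi>\<^sub>0 \<phi> j x = (\<lambda>z. 2 ^ (j * CARD('n)) * \<psi> (2 ^ j *\<^sub>R (x - z)))"
    by (auto simp: LP_kernel_def \<psi>_def)
  ultimately show ?thesis by simp
qed

lemma kernel_conv_distribution_of: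
  "kernel_conv \<Phi> (distribution_of f) x = (\<integral>z. f z * \<Phi> x z \<partial>lborel)"
  by (simp add: kernel_conv_def pairing_def distribution_of_def)

text \<open>A function bounded by 2 is controlled by the seminorm of order twice the dimension: its
  summand for the empty list of derivatives dominates \<phi> by an integrable power.\<close>

lemma tempered_gauss_comb:
  fixes y :: "nat \<Rightarrow> real ^ 'n::finite"
  shows "tempered_distribution (distribution_of (\<lambda>z. of_real (gauss_comb y z)))"
  unfolding tempered_distribution_def
proof (intro conjI ballI allI)
  fix \<phi> \<psi> :: "real^'n \<Rightarrow> complex" assume S: "\<phi> \<in> schwartz" "\<psi> \<in> schwartz"
  show "distribution_of (\<lambda>z. of_real (gauss_comb y z)) (\<lambda>x. \<phi> x + \<psi> x) =
        distribution_of (\<lambda>z. of_real (gauss_comb y z)) \<phi> + distribution_of (\<lambda>z. of_real (gauss_comb y z)) \<psi>"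
    unfolding distribution_of_def distrib_left
    by (intro Bochner_Integration.integral_add integrable_gauss_comb schwartz_integrable S)
next
  fix c and \<phi> :: "real^'n \<Rightarrow> complex"
  show "distribution_of (\<lambda>z. of_real (gauss_comb y z)) (\<lambda>x. c * \<phi> x) = c * distribution_of (\<lambda>z. of_real (gauss_comb y z)) \<phi>"
    by (simp add: distribution_of_def mult.left_commute)
next
  define N where "N = 2 * CARD('n)"
  define B where "B = integral\<^sup>L lborel (\<lambda>x::real^'n. 1 / (1 + norm x) ^ N)"
  have "norm (distribution_of (\<lambda>z. of_real (gauss_comb y z)) \<phi>) \<le> 2 * B * schwartz_norm N \<phi>"
    if S: "\<phi> \<in> schwartz" for \<phi> :: "real^'n \<Rightarrow> complex"
  proof -
    have bdd: "bdd_above (range (\<lambda>x. (1 + norm x) ^ N * norm (partial_derivs is \<phi> x)))" for "is"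
    proof -
      have "bounded (range (\<lambda>x. of_real ((1 + norm x) ^ N) * partial_derivs is \<phi> x))"
        using S unfolding schwartz_def by blast
      then obtain C where C: "\<And>x. norm (of_real ((1 + norm x) ^ N) * partial_derivs is \<phi> x) \<le> C"
        by (auto simp: bounded_iff)
      have "(1 + norm x) ^ N * norm (partial_derivs is \<phi> x) \<le> C" for x
        using C[of x] by (simp only: norm_mult norm_of_real) (simp add: power_abs[symmetric])
      then show ?thesis by (intro bdd_aboveI2)
    qed
    have nonneg: "0 \<le> (SUP x. (1 + norm x) ^ N * norm (partial_derivs is \<phi> x))" for "is"
      by (rule cSUP_upper2[OF bdd, of 0]) auto
    have fin: "finite {is :: 'n list. length is \<le> N}"
      using finite_lists_length_le[of "UNIV :: 'n set" N] by simp
    have "(SUP x. (1 + norm x) ^ N * norm (partial_derivs [] \<phi> x)) \<le> schwartz_norm N \<phi>"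
      unfolding schwartz_norm_def
      by (rule member_le_sum[OF _ _ fin]) (auto intro: nonneg)
    then have le: "(1 + norm x) ^ N * norm (\<phi> x) \<le> schwartz_norm N \<phi>" for x
      using cSUP_upper[OF UNIV_I bdd[of "[]"], of x] by simp
    have "norm (distribution_of (\<lambda>z. of_real (gauss_comb y z)) \<phi>) \<le> integral\<^sup>L lborel (\<lambda>x::real^'n. 2 * schwartz_norm N \<phi> * (1 / (1 + norm x) ^ N))"
      unfolding distribution_of_def
    proof (rule Bochner_Integration.integral_norm_bound_integral)
      show "integrable lborel (\<lambda>x. of_real (gauss_comb y x) * \<phi> x)"
        by (intro integrable_gauss_comb schwartz_integrable S)
      show "integrable lborel (\<lambda>x::real^'n. 2 * schwartz_norm N \<phi> * (1 / (1 + norm x) ^ N))"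
        unfolding N_def by (rule integrable_mult_right) (rule integrable_pow_decay)
      fix x :: "real^'n"
      have pos: "0 < (1 + norm x) ^ N" by (intro zero_less_power add_pos_nonneg) auto
      have "norm (of_real (gauss_comb y x) * \<phi> x) \<le> 2 * norm (\<phi> x)"
        using gauss_comb_bounds[of y x] by (auto simp: norm_mult mult_right_mono)
      also have "norm (\<phi> x) \<le> schwartz_norm N \<phi> * (1 / (1 + norm x) ^ N)"
        using le[of x] pos by (simp add: field_simps)
      finally show "norm (of_real (gauss_comb y x) * \<phi> x) \<le> 2 * schwartz_norm N \<phi> * (1 / (1 + norm x) ^ N)"
        by simp
    qed
    also have "\<dots> = 2 * schwartz_norm N \<phi> * B"
      unfolding B_def by (rule integral_mult_right_zero)
    finally show ?thesis by (simp add: mult_ac)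
  qed
  then show "\<exists>C k. \<forall>\<phi>\<in>schwartz. norm (distribution_of (\<lambda>z. of_real (gauss_comb y z)) \<phi>) \<le> C * schwartz_norm k \<phi>"
    by blast
qed

text \<open>The centres are arbitrary: every translate is bounded by a shift of one profile, whose
  contribution to the \<open>p\<close>-th power integral is the same for all shifts, and the
  geometric weights alone make the sum converge.\<close>

lemma TL_norm_gauss_comb:
  fixes \<phi>\<^sub>0 \<phi> :: "real ^ 'n::finite \<Rightarrow> complex"
  assumes adm: "LP_admissible \<phi>\<^sub>0 \<phi>" and p: "0 < p" and q: "0 < q"
  shows "TL_norm \<phi>\<^sub>0 \<phi> \<alpha> p q (distribution_of (\<lambda>z. of_real (gauss_comb y z))) < \<infinity>"
proof -
  have S: "\<phi>\<^sub>0 \<in> schwartz" "\<phi> \<in> schwartz" using adm by (auto simp: LP_admissible_def)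
  \<comment> \<open>\<open>L\<close> exceeds \<alpha> by 1, so a factor 2^(-j) is left after the
    smoothness weight and the sum over scales converges for every \<open>q\<close>. \<open>m\<close>
    is large enough for the \<open>p\<close>-th power of the profile \<open>w\<close> below to be
    integrable.\<close>
  obtain L :: nat where L: "\<alpha> + 1 \<le> real L" using real_arch_simple by blast
  obtain m :: nat where m: "2 * real CARD('n) / p \<le> real m" using real_arch_simple by blast
  obtain C where C: "0 \<le> C" "\<And>j x y. norm (\<integral>z. of_real (gauss (z - y)) * LP_kernel \<phi>\<^sub>0 \<phi> j x z \<partial>lborel)
        \<le> C * (1 / 2 ^ (L * j)) * (1 / (1 + norm (x - y)) ^ m)"
    using LP_kernel_decay[OF adm, of L m] by blast
  obtain K where K: "0 \<le> K" "\<And>V s. 0 \<le> V \<Longrightarrow> (\<And>j. s j \<le> ennreal (V * (1 / 2) ^ j)) \<Longrightarrow> lq_norm q s \<le> ennreal (V * K)"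
    using lq_norm_geometric[OF q] by blast
  define w where "w v = 1 / (1 + norm v) ^ m" for v :: "real^'n"
  have w: "0 < w v" "w v \<le> 1" for v
    unfolding w_def by (auto intro!: divide_pos_pos zero_less_power add_pos_nonneg simp: divide_le_eq_1 add_pos_nonneg)
  have wabs: "\<bar>w v\<bar> \<le> 1" for v using w[of v] by simp
  define W where "W x = (\<Sum>k. (1 / 2) ^ k * w (x - y k))" for x
  have sW: "summable (\<lambda>k. (1 / 2) ^ k * w (x - y k))" for x
    by (rule summable_half_powers_bounded) (auto intro: wabs)
  have W0: "0 \<le> W x" for x
    unfolding W_def using w by (intro suminf_nonneg sW) (simp add: less_imp_le)
  define u where "u = distribution_of (\<lambda>z. complex_of_real (gauss_comb y z))"
  have kc: "norm (kernel_conv (LP_kernel \<phi>\<^sub>0 \<phi> j) u x) \<le> C * (1 / 2 ^ (L * j)) * W x" for j x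
  proof -
    have "(\<lambda>k. (1 / 2) ^ k * (\<integral>z. of_real (gauss (z - y k)) * LP_kernel \<phi>\<^sub>0 \<phi> j x z \<partial>lborel)) sums kernel_conv (LP_kernel \<phi>\<^sub>0 \<phi> j) u x"
      unfolding u_def kernel_conv_distribution_of
      by (rule integral_gauss_comb[OF integrable_LP_kernel[OF S]])
    then have "norm (kernel_conv (LP_kernel \<phi>\<^sub>0 \<phi> j) u x) = norm (\<Sum>k. (1 / 2) ^ k * (\<integral>z. of_real (gauss (z - y k)) * LP_kernel \<phi>\<^sub>0 \<phi> j x z \<partial>lborel))"
      by (intro arg_cong[where f=norm] sums_unique)
    also have "\<dots> \<le> (\<Sum>k. C * (1 / 2 ^ (L * j)) * ((1 / 2) ^ k * w (x - y k)))"
    proof (rule norm_suminf_le)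
      show "summable (\<lambda>k. C * (1 / 2 ^ (L * j)) * ((1 / 2) ^ k * w (x - y k)))"
        by (intro summable_mult sW)
      fix k
      have "norm ((1 / 2) ^ k * (\<integral>z. of_real (gauss (z - y k)) * LP_kernel \<phi>\<^sub>0 \<phi> j x z \<partial>lborel))
         = (1 / 2) ^ k * norm (\<integral>z. of_real (gauss (z - y k)) * LP_kernel \<phi>\<^sub>0 \<phi> j x z \<partial>lborel)"
        by (simp add: norm_mult norm_power norm_divide)
      also have "\<dots> \<le> (1 / 2) ^ k * (C * (1 / 2 ^ (L * j)) * w (x - y k))"
        unfolding w_def by (intro mult_left_mono C(2)) auto
      finally show "norm ((1 / 2) ^ k * (\<integral>z. of_real (gauss (z - y k)) * LP_kernel \<phi>\<^sub>0 \<phi> j x z \<partial>lborel)) \<le> C * (1 / 2 ^ (L * j)) * ((1 / 2) ^ k * w (x - y k))"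
        by (simp add: mult_ac)
    qed
    also have "\<dots> = C * (1 / 2 ^ (L * j)) * W x"
      unfolding W_def by (rule suminf_mult[OF sW])
    finally show ?thesis .
  qed
  have pow: "2 powr (\<alpha> * real j) * (1 / 2 ^ (L * j)) \<le> (1 / 2) ^ j" for j
  proof -
    have "2 powr (\<alpha> * real j) \<le> 2 powr (real (L * j) - real j)"
      using mult_right_mono[OF L, of "real j"] by (intro powr_mono) (auto simp: algebra_simps)
    also have "\<dots> = 2 ^ (L * j) / 2 ^ j" by (simp only: powr_diff powr_realpow zero_less_numeral)
    finally have "2 powr (\<alpha> * real j) * (1 / 2 ^ (L * j)) \<le> (2 ^ (L * j) / 2 ^ j) * (1 / 2 ^ (L * j))"
      by (intro mult_right_mono) auto
    also have "\<dots> = (1 / 2) ^ j" by (simp add: power_one_over)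
    finally show ?thesis .
  qed
  have lq: "lq_norm q (\<lambda>j. ennreal (2 powr (\<alpha> * real j) * norm (kernel_conv (LP_kernel \<phi>\<^sub>0 \<phi> j) u x))) \<le> ennreal (C * W x * K)" for x
  proof (rule K(2))
    show "0 \<le> C * W x" using C(1) W0 by simp
    fix j
    have "2 powr (\<alpha> * real j) * norm (kernel_conv (LP_kernel \<phi>\<^sub>0 \<phi> j) u x) \<le> 2 powr (\<alpha> * real j) * (C * (1 / 2 ^ (L * j)) * W x)"
      by (intro mult_left_mono kc) auto
    also have "\<dots> = C * W x * (2 powr (\<alpha> * real j) * (1 / 2 ^ (L * j)))" by (simp add: mult_ac)
    also have "\<dots> \<le> C * W x * (1 / 2) ^ j" using C(1) W0 by (intro mult_left_mono pow) auto
    finally show "ennreal (2 powr (\<alpha> * real j) * norm (kernel_conv (LP_kernel \<phi>\<^sub>0 \<phi> j) u x)) \<le> ennreal (C * W x * (1 / 2) ^ j)"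
      by (rule ennreal_leI)
  qed
  define \<rho> where "\<rho> = 1 / sqrt 2"
  have \<rho>: "0 < \<rho>" "\<rho> < 1" "\<rho> * \<rho> = 1 / 2" by (auto simp: \<rho>_def)
  define \<sigma> where "\<sigma> = \<rho> powr p"
  have \<sigma>: "0 < \<sigma>" "\<sigma> < 1" using \<rho> p powr_less_mono2[of p \<rho> 1] by (auto simp: \<sigma>_def)
  define T where "T x = (\<Sum>k. \<sigma> ^ k * (w (x - y k) powr p))" for x
  have wp: "0 \<le> w v powr p" "w v powr p \<le> 1" for v
    using w[of v] p powr_mono2[of p "w v" 1] by auto
  have sT: "summable (\<lambda>k. \<sigma> ^ k * (w (x - y k) powr p))" for x
    using wp \<sigma> by (intro summable_half_powers_bounded) (auto simp: abs_le_iff)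
  have T0: "0 \<le> T x" for x
    unfolding T_def using wp \<sigma> by (intro suminf_nonneg sT) simp
  \<comment> \<open>Splitting off half of the geometric weights turns the sum into a supremum, which commutes
    with \<open>p\<close>-th powers; hence \<open>p < 1\<close> and \<open>p \<ge> 1\<close> need no separate treatment.\<close>
  define R where "R = 1 / (1 - \<rho>)"
  have R: "0 \<le> R" using \<rho> by (simp add: R_def)
  have WT: "W x \<le> R * T x powr (1 / p)" for x
  proof -
    have term_le: "\<rho> ^ k * w (x - y k) \<le> T x powr (1 / p)" for k
    proof -
      have "\<sigma> ^ k * (w (x - y k) powr p) = (\<Sum>k\<in>{k}. \<sigma> ^ k * (w (x - y k) powr p))" by simp
      also have "\<dots> \<le> T x" unfolding T_def using wp \<sigma> by (intro sum_le_suminf sT) auto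
      finally have "(\<sigma> ^ k * (w (x - y k) powr p)) powr (1 / p) \<le> T x powr (1 / p)"
        using p wp \<sigma> by (intro powr_mono2) auto
      moreover have "\<sigma> ^ k * (w (x - y k) powr p) = (\<rho> ^ k * w (x - y k)) powr p"
        using \<rho> w[of "x - y k"] by (simp add: \<sigma>_def powr_mult powr_power mult.commute powr_powr flip: powr_realpow)
      ultimately show ?thesis using \<rho> w[of "x - y k"] p by (simp add: powr_powr)
    qed
    have "W x \<le> (\<Sum>k. \<rho> ^ k * T x powr (1 / p))"
      unfolding W_def
    proof (rule suminf_le[OF _ sW])
      show "summable (\<lambda>k. \<rho> ^ k * T x powr (1 / p))"
        using \<rho> by (intro summable_mult2 summable_geometric) auto
      fix k
      have "(1 / 2) ^ k * w (x - y k) = \<rho> ^ k * (\<rho> ^ k * w (x - y k))"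
        using \<rho>(3) by (metis mult.assoc power_mult_distrib)
      also have "\<dots> \<le> \<rho> ^ k * T x powr (1 / p)" using \<rho> by (intro mult_left_mono term_le) auto
      finally show "(1 / 2) ^ k * w (x - y k) \<le> \<rho> ^ k * T x powr (1 / p)" .
    qed
    also have "\<dots> = R * T x powr (1 / p)"
      using \<rho> by (subst suminf_mult2[symmetric]) (auto simp: R_def suminf_geometric)
    finally show ?thesis .
  qed
  define E where "E = (C * K * R) powr p"
  have le: "ennreal_powr (lq_norm q (\<lambda>j. ennreal (2 powr (\<alpha> * real j) * norm (kernel_conv (LP_kernel \<phi>\<^sub>0 \<phi> j) u x)))) p
      \<le> ennreal E * ennreal (T x)" for x
  proof -
    have "C * W x * K \<le> C * (R * T x powr (1 / p)) * K"
      using C(1) K(1) by (intro mult_right_mono mult_left_mono WT) auto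
    then have "(C * W x * K) powr p \<le> (C * (R * T x powr (1 / p)) * K) powr p"
      using C(1) K(1) W0 p by (intro powr_mono2) auto
    also have "\<dots> = ((C * K * R) * T x powr (1 / p)) powr p" by (simp add: mult_ac)
    also have "\<dots> = E * T x"
      using C(1) K(1) R p T0[of x] by (simp add: E_def powr_mult powr_powr)
    finally have "ennreal ((C * W x * K) powr p) \<le> ennreal E * ennreal (T x)"
      using T0[of x] by (simp add: ennreal_mult[symmetric] E_def ennreal_leI)
    moreover have "ennreal_powr (lq_norm q (\<lambda>j. ennreal (2 powr (\<alpha> * real j) * norm (kernel_conv (LP_kernel \<phi>\<^sub>0 \<phi> j) u x)))) p
       \<le> ennreal_powr (ennreal (C * W x * K)) p"
      using p by (intro ennreal_powr_mono lq) auto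
    ultimately show ?thesis using C(1) K(1) W0[of x] by (simp add: ennreal_powr_ennreal)
  qed
  have [measurable]: "w \<in> borel_measurable borel" unfolding w_def by measurable
  have [measurable]: "T \<in> borel_measurable borel" unfolding T_def by measurable
  define I0 where "I0 = (\<integral>\<^sup>+v. ennreal (w v powr p) \<partial>lborel)"
  have I0: "I0 < \<infinity>"
  proof -
    have "w v powr p \<le> 1 / (1 + norm v) ^ (2 * CARD('n))" for v
    proof -
      have p1: "1 \<le> 1 + norm v" by simp
      have "w v powr p = 1 / (1 + norm v) powr (real m * p)"
        using p1 by (simp add: w_def powr_divide powr_realpow[symmetric] powr_powr add_pos_nonneg)
      also have "\<dots> \<le> 1 / (1 + norm v) powr (real (2 * CARD('n)))"
        using m p p1 by (intro divide_left_mono powr_mono mult_pos_pos) (auto simp: field_simps add_nonneg_eq_0_iff)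
      also have "\<dots> = 1 / (1 + norm v) ^ (2 * CARD('n))"
        by (subst powr_realpow) (auto simp: add_pos_nonneg)
      finally show ?thesis .
    qed
    then have "I0 \<le> integral\<^sup>N lborel (\<lambda>v::real^'n. ennreal (1 / (1 + norm v) ^ (2 * CARD('n))))"
      unfolding I0_def by (intro nn_integral_mono ennreal_leI)
    also have "\<dots> < \<infinity>"
      by (subst nn_integral_eq_integral[OF integrable_pow_decay]) auto
    finally show ?thesis .
  qed
  have shift: "(\<integral>\<^sup>+x. ennreal (w (x - a) powr p) \<partial>lborel) = I0" for a
  proof -
    have "I0 = (\<integral>\<^sup>+v. ennreal (w v powr p) \<partial>distr lborel borel ((+) (- a)))"
      unfolding I0_def by (rule arg_cong[where f="\<lambda>M. nn_integral M _"]) (rule lborel_distr_plus[symmetric])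
    also have "\<dots> = (\<integral>\<^sup>+x. ennreal (w (- a + x) powr p) \<partial>lborel)"
      by (subst nn_integral_distr) auto
    finally show ?thesis by simp
  qed
  have "(\<integral>\<^sup>+x. ennreal (T x) \<partial>lborel) = (\<integral>\<^sup>+x. (\<Sum>k. ennreal (\<sigma> ^ k) * ennreal (w (x - y k) powr p)) \<partial>lborel)"
  proof (rule nn_integral_cong)
    fix x
    have "ennreal (T x) = (\<Sum>k. ennreal (\<sigma> ^ k * (w (x - y k) powr p)))"
      unfolding T_def using \<sigma> wp by (intro suminf_ennreal2[symmetric] sT) simp
    also have "\<dots> = (\<Sum>k. ennreal (\<sigma> ^ k) * ennreal (w (x - y k) powr p))"
      using \<sigma> by (simp add: ennreal_mult)
    finally show "ennreal (T x) = (\<Sum>k. ennreal (\<sigma> ^ k) * ennreal (w (x - y k) powr p))" .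
  qed
  also have "\<dots> = (\<Sum>k. \<integral>\<^sup>+x. ennreal (\<sigma> ^ k) * ennreal (w (x - y k) powr p) \<partial>lborel)"
    by (rule nn_integral_suminf) measurable
  also have "\<dots> = (\<Sum>k. ennreal (\<sigma> ^ k) * I0)"
    by (subst nn_integral_cmult) (auto simp: shift)
  also have "\<dots> = (\<Sum>k. ennreal (\<sigma> ^ k)) * I0" by simp
  also have "(\<Sum>k. ennreal (\<sigma> ^ k)) = ennreal (1 / (1 - \<sigma>))"
    using \<sigma> by (subst suminf_ennreal2) (auto simp: suminf_geometric summable_geometric)
  finally have intT: "(\<integral>\<^sup>+x. ennreal (T x) \<partial>lborel) < \<infinity>"
    using I0 by (simp add: ennreal_mult_less_top)
  have "(\<integral>\<^sup>+x. ennreal_powr (lq_norm q (\<lambda>j. ennreal (2 powr (\<alpha> * real j) * norm (kernel_conv (LP_kernel \<phi>\<^sub>0 \<phi> j) u x)))) p \<partial>lborel)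
    \<le> (\<integral>\<^sup>+x. ennreal E * ennreal (T x) \<partial>lborel)"
    by (intro nn_integral_mono le)
  also have "\<dots> = ennreal E * (\<integral>\<^sup>+x. ennreal (T x) \<partial>lborel)"
    by (rule nn_integral_cmult) measurable
  also have "\<dots> < \<infinity>" using intT by (simp add: ennreal_mult_less_top)
  finally show ?thesis
    by (simp add: TL_norm_def kernel_TL_norm_def Lp_norm_def ennreal_powr_def u_def)
qed

section \<open>Hermite functions and coherent states\<close>

definition rapid :: "(real \<Rightarrow> real) \<Rightarrow> bool" where
  "rapid f \<longleftrightarrow> (\<forall>k::nat. \<exists>C. \<forall>t. \<bar>t ^ k * f t\<bar> \<le> C)"

lemma rapidD: "rapid f \<Longrightarrow> \<exists>C. \<forall>t. \<bar>t ^ k * f t\<bar> \<le> C"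
  unfolding rapid_def by blast

lemma rapid_gaussian: "rapid (\<lambda>t. exp (- t\<^sup>2 / 2))"
  unfolding rapid_def
proof (intro allI exI)
  fix k :: nat and t :: real
  have "\<bar>t\<bar> \<le> exp \<bar>t\<bar>" using exp_ge_add_one_self[of "\<bar>t\<bar>"] by linarith
  then have "\<bar>t\<bar> ^ k \<le> exp \<bar>t\<bar> ^ k" by (rule power_mono) simp
  then have "\<bar>t\<bar> ^ k \<le> exp (real k * \<bar>t\<bar>)" by (simp add: exp_of_nat_mult)
  then have "\<bar>t ^ k * exp (- t\<^sup>2 / 2)\<bar> \<le> exp (real k * \<bar>t\<bar>) * exp (- t\<^sup>2 / 2)"
    by (simp add: abs_mult power_abs)
  also have "\<dots> = exp (real k * \<bar>t\<bar> - t\<^sup>2 / 2)" by (simp add: exp_add[symmetric])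
  also have "\<dots> \<le> exp (real k ^ 2)"
  proof -
    have "real k * \<bar>t\<bar> = real k ^ 2 + t\<^sup>2 / 4 - (real k - \<bar>t\<bar> / 2)\<^sup>2"
      by (simp add: power2_diff power_divide)
    then have "real k * \<bar>t\<bar> - t\<^sup>2 / 2 \<le> real k ^ 2"
      using zero_le_power2[of t] zero_le_power2[of "real k - \<bar>t\<bar> / 2"] by linarith
    then show ?thesis by simp
  qed
  finally show "\<bar>t ^ k * exp (- t\<^sup>2 / 2)\<bar> \<le> exp (real k ^ 2)" .
qed

lemma rapid_add: "rapid f \<Longrightarrow> rapid g \<Longrightarrow> rapid (\<lambda>t. f t + g t)"
  unfolding rapid_def
proof
  fix k assume "\<forall>k. \<exists>C. \<forall>t. \<bar>t ^ k * f t\<bar> \<le> C" "\<forall>k. \<exists>C. \<forall>t. \<bar>t ^ k * g t\<bar> \<le> C"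
  then obtain C D where "\<And>t. \<bar>t ^ k * f t\<bar> \<le> C" "\<And>t. \<bar>t ^ k * g t\<bar> \<le> D" by metis
  then have "\<bar>t ^ k * (f t + g t)\<bar> \<le> C + D" for t
    unfolding distrib_left by (meson abs_triangle_ineq add_mono order_trans)
  then show "\<exists>C. \<forall>t. \<bar>t ^ k * (f t + g t)\<bar> \<le> C" by blast
qed

lemma rapid_bounded_mult:
  assumes f: "rapid f" and g: "\<And>t. \<bar>g t\<bar> \<le> B"
  shows "rapid (\<lambda>t. g t * f t)"
  unfolding rapid_def
proof
  fix k
  obtain C where C: "\<And>t. \<bar>t ^ k * f t\<bar> \<le> C" using rapidD[OF f] by blast
  have "\<bar>t ^ k * (g t * f t)\<bar> \<le> B * C" for t
  proof -
    have "\<bar>t ^ k * (g t * f t)\<bar> = \<bar>g t\<bar> * \<bar>t ^ k * f t\<bar>" by (simp add: abs_mult)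
    also have "\<dots> \<le> B * C" using g[of t] C[of t] by (intro mult_mono) auto
    finally show ?thesis .
  qed
  then show "\<exists>C. \<forall>t. \<bar>t ^ k * (g t * f t)\<bar> \<le> C" by blast
qed

lemma rapid_cmult: "rapid f \<Longrightarrow> rapid (\<lambda>t. c * f t)"
  by (rule rapid_bounded_mult[where B="\<bar>c\<bar>"]) auto

lemma rapid_diff: "rapid f \<Longrightarrow> rapid g \<Longrightarrow> rapid (\<lambda>t. f t - g t)"
  using rapid_add[of f "\<lambda>t. (- 1) * g t"] rapid_cmult[of g "- 1"] by simp

lemma rapid_ident_mult:
  assumes "rapid f" shows "rapid (\<lambda>t. t * f t)"
  unfolding rapid_def
proof
  fix k
  show "\<exists>C. \<forall>t. \<bar>t ^ k * (t * f t)\<bar> \<le> C"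
    using rapidD[OF assms, of "Suc k"] by (simp add: mult_ac)
qed

lemma rapid_bounded:
  assumes "rapid f" obtains C where "\<And>t. \<bar>f t\<bar> \<le> C"
  using rapidD[OF assms, of 0] by auto

lemma rapid_mult:
  assumes "rapid f" "rapid g" shows "rapid (\<lambda>t. f t * g t)"
proof -
  obtain B where "\<And>t. \<bar>f t\<bar> \<le> B" using rapid_bounded[OF assms(1)] by blast
  then show ?thesis by (rule rapid_bounded_mult[OF assms(2)])
qed

lemma rapid_integrable:
  assumes "rapid f" and [measurable]: "f \<in> borel_measurable borel"
  shows "integrable lborel f"
proof -
  obtain C where C: "\<And>t. \<bar>f t\<bar> \<le> C" using rapid_bounded[OF assms(1)] by blast
  obtain D where D: "\<And>t. \<bar>t ^ 2 * f t\<bar> \<le> D" using rapidD[OF assms(1)] by blast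
  show ?thesis
  proof (rule Bochner_Integration.integrable_bound)
    show "integrable lborel (\<lambda>t::real. (C + D) * (1 / (1 + t\<^sup>2)))"
      by (rule integrable_mult_right) (rule integrable_inverse_square)
    show "AE t in lborel. norm (f t) \<le> norm ((C + D) * (1 / (1 + t\<^sup>2)))"
    proof (rule AE_I2)
      fix t :: real
      have p: "0 < 1 + t\<^sup>2" by (simp add: add_pos_nonneg)
      have "\<bar>f t\<bar> * (1 + t\<^sup>2) = \<bar>f t\<bar> + \<bar>t ^ 2 * f t\<bar>" by (simp add: abs_mult algebra_simps)
      then have "\<bar>f t\<bar> * (1 + t\<^sup>2) \<le> C + D" using C[of t] D[of t] by linarith
      then have "\<bar>f t\<bar> \<le> (C + D) * (1 / (1 + t\<^sup>2))" using p by (simp add: field_simps)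
      then show "norm (f t) \<le> norm ((C + D) * (1 / (1 + t\<^sup>2)))" unfolding real_norm_def by linarith
    qed
  qed measurable
qed

lemma rapid_tendsto_0:
  assumes "rapid f"
  shows "(f \<longlongrightarrow> 0) at_top" "(f \<longlongrightarrow> 0) at_bot"
proof -
  obtain D where D: "\<And>t. \<bar>t ^ 1 * f t\<bar> \<le> D" using rapidD[OF assms, of 1] by blast
  have le: "norm (f t) \<le> D * inverse \<bar>t\<bar>" if "t \<noteq> 0" for t
    using D[of t] that by (simp add: abs_mult field_simps)
  show "(f \<longlongrightarrow> 0) at_top"
  proof (rule Lim_null_comparison)
    show "eventually (\<lambda>t. norm (f t) \<le> D * inverse \<bar>t\<bar>) at_top"
      using eventually_gt_at_top[of 0] by eventually_elim (rule le, simp)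
    show "((\<lambda>t. D * inverse \<bar>t\<bar>) \<longlongrightarrow> 0) at_top"
      using filterlim_at_infinity_imp_norm_at_top[OF filterlim_at_top_imp_at_infinity[OF filterlim_ident]]
      by (intro tendsto_mult_right_zero tendsto_inverse_0_at_top) simp
  qed
  show "(f \<longlongrightarrow> 0) at_bot"
  proof (rule Lim_null_comparison)
    show "eventually (\<lambda>t. norm (f t) \<le> D * inverse \<bar>t\<bar>) at_bot"
      using eventually_gt_at_bot[of 0] by eventually_elim (rule le, simp)
    show "((\<lambda>t. D * inverse \<bar>t\<bar>) \<longlongrightarrow> 0) at_bot"
      using filterlim_at_infinity_imp_norm_at_top[OF filterlim_at_bot_imp_at_infinity[OF filterlim_ident]]
      by (intro tendsto_mult_right_zero tendsto_inverse_0_at_top) simp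
  qed
qed

text \<open>The boundary terms vanish by decay. This is the integration by parts behind both the
  normalisation of the Hermite functions and the recursion for the coefficients of a translated
  Gaussian.\<close>

lemma integral_deriv_rapid:
  fixes F F' :: "real \<Rightarrow> real"
  assumes der: "\<And>t. (F has_real_derivative F' t) (at t)"
    and F: "rapid F" and F': "rapid F'" and cont: "continuous_on UNIV F'"
  shows "integral\<^sup>L lborel F' = 0"
proof -
  have int: "integrable lborel F'"
    by (rule rapid_integrable[OF F' borel_measurable_continuous_onI[OF cont]])
  have "(LBINT x=-\<infinity>..\<infinity>. F' x) = 0 - 0"
  proof (rule interval_integral_FTC_integrable)
    show "(F has_vector_derivative F' x) (at x)" for x
      using der by (simp add: has_real_derivative_iff_has_vector_derivative)
    show "isCont F' x" for x using cont by (simp add: continuous_on_eq_continuous_at)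
    show "set_integrable lborel (einterval (- \<infinity>) \<infinity>) F'"
      using int by (simp add: set_integrable_def)
    show "((F \<circ> real_of_ereal) \<longlongrightarrow> 0) (at_right (- \<infinity>))" "((F \<circ> real_of_ereal) \<longlongrightarrow> 0) (at_left \<infinity>)"
      unfolding ereal_tendsto_simps using rapid_tendsto_0[OF F] by auto
  qed simp
  then show ?thesis by (simp add: interval_lebesgue_integral_def set_lebesgue_integral_def)
qed

text \<open>One-dimensional Sobolev embedding: integrate from a to t and let a tend to minus
  infinity. It turns the norms of Hermite functions into a pointwise estimate.\<close>

lemma le_integral_abs_deriv:
  fixes F F' :: "real \<Rightarrow> real"
  assumes der: "\<And>t. (F has_real_derivative F' t) (at t)"
    and F: "rapid F" and F': "rapid F'" and cont: "continuous_on UNIV F'"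
  shows "F t \<le> (\<integral>x. \<bar>F' x\<bar> \<partial>lborel)"
proof -
  have int: "integrable lborel F'"
    by (rule rapid_integrable[OF F' borel_measurable_continuous_onI[OF cont]])
  have "F t - F a \<le> (\<integral>x. \<bar>F' x\<bar> \<partial>lborel)" if "a < t" for a
  proof -
    have "(\<integral>x. F' x * indicator {a..t} x \<partial>lborel) = F t - F a"
      using that der by (intro integral_FTC_Icc_real) (use cont in \<open>auto simp: continuous_on_eq_continuous_at has_field_derivative_at_within\<close>)
    moreover have "(\<integral>x. F' x * indicator {a..t} x \<partial>lborel) \<le> (\<integral>x. \<bar>F' x\<bar> \<partial>lborel)"
      using int by (intro integral_mono integrable_mult_indicator[where A="{a..t}" and f=F', simplified mult.commute real_scaleR_def])
        (auto split: split_indicator intro: integrable_abs)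
    ultimately show ?thesis by simp
  qed
  then have "eventually (\<lambda>a. F t - F a \<le> (\<integral>x. \<bar>F' x\<bar> \<partial>lborel)) at_bot"
    using eventually_gt_at_bot[of t] by (auto elim: eventually_mono simp: eventually_at_bot_dense)
  moreover have "((\<lambda>a. F t - F a) \<longlongrightarrow> F t - 0) at_bot"
    by (intro tendsto_intros rapid_tendsto_0[OF F])
  ultimately have "F t - 0 \<le> (\<integral>x. \<bar>F' x\<bar> \<partial>lborel)"
    by (intro tendsto_upperbound) auto
  then show ?thesis by simp
qed

section \<open>Hermite functions: ladder relations, norms and growth\<close>

lemma deriv_gaussian_recurrence:
  fixes D :: "nat \<Rightarrow> real \<Rightarrow> real"
  assumes D: "\<And>n. D n = (deriv ^^ n) (\<lambda>s. exp (- s\<^sup>2))"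
  shows "D (Suc (Suc n)) t = - 2 * t * D (Suc n) t - 2 * real (Suc n) * D n t"
    and "(D n has_real_derivative D (Suc n) t) (at t)"
proof -
  have step: "D (Suc n) = deriv (D n)" for n by (simp add: D)
  have D0: "D 0 = (\<lambda>s. exp (- s\<^sup>2))" by (simp add: D)
  have d0: "(D 0 has_real_derivative (- 2 * t * D 0 t)) (at t)" for t
    unfolding D0 by (auto intro!: derivative_eq_intros)
  have D1: "D 1 = (\<lambda>t. - 2 * t * D 0 t)"
    using step[of 0] DERIV_imp_deriv[OF d0] by auto
  have d1: "(D 1 has_real_derivative (- 2 * t * D 1 t - 2 * D 0 t)) (at t)" for t
    unfolding D1 using d0 by (auto intro!: derivative_eq_intros simp: algebra_simps)
  \<comment> \<open>The three statements are proved together: \<open>deriv\<close> can be evaluated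
    only where a derivative is known, and for \<open>D (Suc (Suc n))\<close> that derivative is
    computed from the recurrence itself.\<close>
  have main: "(\<forall>t. D (Suc (Suc n)) t = - 2 * t * D (Suc n) t - 2 * real (Suc n) * D n t) \<and>
      (\<forall>t. (D n has_real_derivative D (Suc n) t) (at t)) \<and>
      (\<forall>t. (D (Suc n) has_real_derivative D (Suc (Suc n)) t) (at t))" for n
  proof (induction n)
    case 0
    have "D (Suc (Suc 0)) = (\<lambda>t. - 2 * t * D 1 t - 2 * D 0 t)"
      using step[of 1] DERIV_imp_deriv[OF d1] by auto
    then show ?case using d0 d1 D1 by simp
  next
    case (Suc n)
    then have eq: "D (Suc (Suc n)) = (\<lambda>t. - 2 * t * D (Suc n) t - 2 * real (Suc n) * D n t)"
      and da: "\<And>t. (D n has_real_derivative D (Suc n) t) (at t)"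
      and db: "\<And>t. (D (Suc n) has_real_derivative D (Suc (Suc n)) t) (at t)" by auto
    have dc: "(D (Suc (Suc n)) has_real_derivative (- 2 * t * D (Suc (Suc n)) t - 2 * real (Suc (Suc n)) * D (Suc n) t)) (at t)" for t
      by (subst eq) (use da[of t] db[of t] in \<open>auto intro!: derivative_eq_intros simp: algebra_simps\<close>)
    then have "D (Suc (Suc (Suc n))) t = - 2 * t * D (Suc (Suc n)) t - 2 * real (Suc (Suc n)) * D (Suc n) t" for t
      using step[of "Suc (Suc n)"] DERIV_imp_deriv[OF dc] by simp
    then show ?case using db dc by simp
  qed
  show "D (Suc (Suc n)) t = - 2 * t * D (Suc n) t - 2 * real (Suc n) * D n t"
    and "(D n has_real_derivative D (Suc n) t) (at t)" using main[of n] by auto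
qed

lemma hermite_fun_norm_const:
  "(2 ^ n * fact n * sqrt pi) powr (- 1 / 2) = sqrt (2 * real (Suc n)) * (2 ^ Suc n * fact (Suc n) * sqrt pi) powr (- 1 / 2)"
proof -
  have "2 ^ Suc n * fact (Suc n) * sqrt pi = (2 * real (Suc n)) * (2 ^ n * fact n * sqrt pi)" by simp
  also have "\<dots> powr (- 1 / 2) = (2 * real (Suc n)) powr (- 1 / 2) * (2 ^ n * fact n * sqrt pi) powr (- 1 / 2)"
    by (rule powr_mult)
  also have "(2 * real (Suc n)) powr (- 1 / 2) = 1 / sqrt (2 * real (Suc n))"
    by (simp add: powr_minus_divide powr_half_sqrt)
  finally show ?thesis by simp
qed

lemma hermite_fun_0: "hermite_fun 0 t = pi powr (- 1 / 4) * exp (- t\<^sup>2 / 2)"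
proof -
  have "sqrt pi powr (- 1 / 2) = pi powr (- 1 / 4)"
    by (simp add: powr_half_sqrt[symmetric] powr_powr)
  then show ?thesis by (simp add: hermite_fun_def hermite_poly_def exp_minus)
qed

text \<open>The derivative formula is the raising operator; combined with the three-term recurrence
  it yields the lowering operator. At the bottom the recurrence would refer to index -1, hence the
  separate identity for \<open>hermite_fun 1\<close>.\<close>

lemma
  shows hermite_fun_deriv_up:
      "(hermite_fun n has_real_derivative t * hermite_fun n t - sqrt (2 * real (Suc n)) * hermite_fun (Suc n) t) (at t)"
    and hermite_fun_recurrence:
      "sqrt (2 * real (Suc (Suc n))) * hermite_fun (Suc (Suc n)) t
         = 2 * t * hermite_fun (Suc n) t - sqrt (2 * real (Suc n)) * hermite_fun n t"
    and hermite_fun_1: "sqrt 2 * hermite_fun 1 t = 2 * t * hermite_fun 0 t"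
proof -
  define D where "D n = (deriv ^^ n) (\<lambda>s::real. exp (- s\<^sup>2))" for n
  note rec = deriv_gaussian_recurrence[of D, OF D_def]
  define \<kappa> where "\<kappa> n = (2 ^ n * fact n * sqrt pi) powr (- 1 / 2)" for n :: nat
  have \<kappa>: "\<kappa> n = sqrt (2 * real (Suc n)) * \<kappa> (Suc n)" for n
    unfolding \<kappa>_def by (rule hermite_fun_norm_const)
  have h: "hermite_fun n = (\<lambda>t. \<kappa> n * (- 1) ^ n * exp (t\<^sup>2 / 2) * D n t)" for n
  proof
    fix t :: real
    have "exp (t\<^sup>2) * exp (- t\<^sup>2 / 2) = exp (t\<^sup>2 / 2)" by (simp add: exp_add[symmetric])
    then show "hermite_fun n t = \<kappa> n * (- 1) ^ n * exp (t\<^sup>2 / 2) * D n t"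
      by (simp add: hermite_fun_def hermite_poly_def \<kappa>_def D_def mult_ac)
  qed
  show "(hermite_fun n has_real_derivative t * hermite_fun n t - sqrt (2 * real (Suc n)) * hermite_fun (Suc n) t) (at t)"
  proof -
    have "(hermite_fun n has_real_derivative \<kappa> n * (- 1) ^ n * (exp (t\<^sup>2 / 2) * t * D n t + exp (t\<^sup>2 / 2) * D (Suc n) t)) (at t)"
      unfolding h using rec(2)[of n t] by (auto intro!: derivative_eq_intros simp: algebra_simps)
    moreover have "\<kappa> n * (- 1) ^ n * (exp (t\<^sup>2 / 2) * t * D n t + exp (t\<^sup>2 / 2) * D (Suc n) t)
       = t * hermite_fun n t - sqrt (2 * real (Suc n)) * hermite_fun (Suc n) t"
      unfolding h by (simp add: \<kappa>[of n] algebra_simps del: of_nat_Suc)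
    ultimately show ?thesis by simp
  qed
  show "sqrt (2 * real (Suc (Suc n))) * hermite_fun (Suc (Suc n)) t
         = 2 * t * hermite_fun (Suc n) t - sqrt (2 * real (Suc n)) * hermite_fun n t"
  proof -
    define r where "r = sqrt (2 * real (Suc n))"
    have r: "r * r = 2 * real (Suc n)" by (simp add: r_def)
    have "sqrt (2 * real (Suc (Suc n))) * hermite_fun (Suc (Suc n)) t = \<kappa> (Suc n) * (- 1) ^ n * exp (t\<^sup>2 / 2) * D (Suc (Suc n)) t"
      unfolding h \<kappa>[of "Suc n"] by simp
    also have "\<dots> = 2 * t * hermite_fun (Suc n) t - \<kappa> (Suc n) * (- 1) ^ n * exp (t\<^sup>2 / 2) * (r * r) * D n t"
      unfolding rec(1) h r by (simp add: algebra_simps)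
    also have "\<kappa> (Suc n) * (- 1) ^ n * exp (t\<^sup>2 / 2) * (r * r) * D n t = r * hermite_fun n t"
      unfolding h \<kappa>[of n] r_def[symmetric] by (simp add: mult_ac)
    finally show ?thesis by (simp add: r_def)
  qed
  show "sqrt 2 * hermite_fun 1 t = 2 * t * hermite_fun 0 t"
  proof -
    have "(D 0 has_real_derivative - 2 * t * D 0 t) (at t)"
      unfolding D_def by (auto intro!: derivative_eq_intros)
    then have "D 1 t = - 2 * t * D 0 t" using rec(2)[of 0 t] DERIV_unique by fastforce
    then show ?thesis unfolding h using \<kappa>[of 0] by simp
  qed
qed

lemma hermite_fun_deriv_down:
  "(hermite_fun (Suc n) has_real_derivative sqrt (2 * real (Suc n)) * hermite_fun n t - t * hermite_fun (Suc n) t) (at t)"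
  using hermite_fun_deriv_up[of "Suc n" t] hermite_fun_recurrence[of n t] by simp

lemma hermite_fun_continuous: "continuous_on UNIV (hermite_fun n)"
  using hermite_fun_deriv_up by (intro DERIV_continuous_on) (auto intro: has_field_derivative_at_within)

lemma hermite_fun_measurable [measurable]: "hermite_fun n \<in> borel_measurable borel"
  by (rule borel_measurable_continuous_onI[OF hermite_fun_continuous])

lemma rapid_hermite_fun: "rapid (hermite_fun n)"
proof -
  \<comment> \<open>The recurrence has two predecessors, so the induction carries neighbouring
    pairs.\<close>
  have "rapid (hermite_fun n) \<and> rapid (hermite_fun (Suc n))"
  proof (induction n)
    case 0
    have "rapid (\<lambda>t. pi powr (- 1 / 4) * exp (- t\<^sup>2 / 2))" by (rule rapid_cmult[OF rapid_gaussian])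
    then have r0: "rapid (hermite_fun 0)" by (simp add: hermite_fun_0[abs_def])
    have "hermite_fun (Suc 0) = (\<lambda>t. sqrt 2 * (t * hermite_fun 0 t))"
    proof
      fix t
      have "2 * hermite_fun 1 t = sqrt 2 * (sqrt 2 * hermite_fun 1 t)" by simp
      also have "\<dots> = sqrt 2 * (2 * t * hermite_fun 0 t)" by (simp only: hermite_fun_1)
      finally show "hermite_fun (Suc 0) t = sqrt 2 * (t * hermite_fun 0 t)" by simp
    qed
    then show ?case using r0 rapid_cmult[OF rapid_ident_mult[OF r0], of "sqrt 2"] by simp
  next
    case (Suc n)
    define c where "c = sqrt (2 * real (Suc (Suc n)))"
    have c: "c \<noteq> 0" by (simp add: c_def)
    have "hermite_fun (Suc (Suc n)) = (\<lambda>t. 1 / c * (2 * (t * hermite_fun (Suc n) t) - sqrt (2 * real (Suc n)) * hermite_fun n t))"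
    proof
      fix t
      show "hermite_fun (Suc (Suc n)) t = 1 / c * (2 * (t * hermite_fun (Suc n) t) - sqrt (2 * real (Suc n)) * hermite_fun n t)"
        using hermite_fun_recurrence[of n t] c by (simp add: c_def[symmetric] field_simps del: of_nat_Suc)
    qed
    moreover have "rapid (\<lambda>t. 1 / c * (2 * (t * hermite_fun (Suc n) t) - sqrt (2 * real (Suc n)) * hermite_fun n t))"
      using Suc by (intro rapid_cmult rapid_diff rapid_ident_mult) auto
    ultimately show ?case using Suc by simp
  qed
  then show ?thesis ..
qed

lemma shifted_gaussian_integral: "(\<integral>t. exp (- (t - m)\<^sup>2) \<partial>lborel) = sqrt pi"
proof -
  have "(\<integral>t. normal_density m (1 / sqrt 2) t \<partial>lborel) = 1"
    by (rule integral_normal_density) simp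
  then show ?thesis by (simp add: normal_density_def power_divide)
qed

text \<open>Differentiate the product of two neighbours, using the raising formula for the lower one
  and the lowering formula for the upper one. The terms with the factor t cancel and a multiple of
  the difference of the two squares remains, so all norms agree with that of the ground
  state.\<close>

lemma integral_hermite_fun_square: "(\<integral>t. (hermite_fun n t)\<^sup>2 \<partial>lborel) = 1"
proof (induction n)
  case 0
  have "(pi powr (- 1 / 4))\<^sup>2 = 1 / sqrt pi"
    by (simp add: power2_eq_square powr_add[symmetric] powr_minus_divide powr_half_sqrt)
  moreover have "(exp (- t\<^sup>2 / 2))\<^sup>2 = exp (- (t - 0)\<^sup>2)" for t :: real
    by (simp add: power2_eq_square exp_add[symmetric])
  ultimately show ?case
    using shifted_gaussian_integral[of 0] by (simp add: hermite_fun_0 power_mult_distrib)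
next
  case (Suc n)
  define c where "c = sqrt (2 * real (Suc n))"
  have c: "c \<noteq> 0" by (simp add: c_def)
  let ?h = "hermite_fun n" and ?k = "hermite_fun (Suc n)"
  have int: "integrable lborel (\<lambda>t. (hermite_fun m t)\<^sup>2)" for m
    unfolding power2_eq_square by (intro rapid_integrable rapid_mult rapid_hermite_fun) measurable
  have "(\<integral>t. c * (?h t)\<^sup>2 - c * (?k t)\<^sup>2 \<partial>lborel) = 0"
  proof (rule integral_deriv_rapid[where F = "\<lambda>t. ?h t * ?k t"])
    show "((\<lambda>t. ?h t * ?k t) has_real_derivative c * (?h t)\<^sup>2 - c * (?k t)\<^sup>2) (at t)" for t
      unfolding c_def by (rule derivative_eq_intros hermite_fun_deriv_up[of n] hermite_fun_deriv_down[of n] refl)+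
        (simp add: algebra_simps power2_eq_square)
    show "rapid (\<lambda>t. ?h t * ?k t)" by (intro rapid_mult rapid_hermite_fun)
    show "rapid (\<lambda>t. c * (?h t)\<^sup>2 - c * (?k t)\<^sup>2)"
      unfolding power2_eq_square by (intro rapid_diff rapid_cmult rapid_mult rapid_hermite_fun)
    show "continuous_on UNIV (\<lambda>t. c * (?h t)\<^sup>2 - c * (?k t)\<^sup>2)"
      by (intro continuous_intros hermite_fun_continuous)
  qed
  then have "c * (\<integral>t. (?h t)\<^sup>2 \<partial>lborel) - c * (\<integral>t. (?k t)\<^sup>2 \<partial>lborel) = 0"
    using int by simp
  then show ?case using Suc c by simp
qed

text \<open>The derivative of the sum telescopes to a single product, whose absolute value has integral
  at most \<open>sqrt (2 (R + 1))\<close> by Cauchy--Schwarz.\<close>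

lemma hermite_fun_sum_squares: "(\<Sum>n\<le>R. (hermite_fun n t)\<^sup>2) \<le> sqrt (2 * real (Suc R))"
proof -
  define c where "c = sqrt (2 * real (Suc R))"
  let ?h = "hermite_fun R" and ?k = "hermite_fun (Suc R)"
  have der: "((\<lambda>t. \<Sum>n\<le>R. (hermite_fun n t)\<^sup>2) has_real_derivative - (sqrt (2 * real (Suc R)) * (hermite_fun R t * hermite_fun (Suc R) t))) (at t)" for R t
  proof (induction R)
    case 0
    have "((\<lambda>t. (hermite_fun 0 t)\<^sup>2) has_real_derivative 2 * hermite_fun 0 t * (t * hermite_fun 0 t - sqrt 2 * hermite_fun 1 t)) (at t)"
      using hermite_fun_deriv_up[of 0 t] by (auto intro!: derivative_eq_intros)
    moreover have "2 * hermite_fun 0 t * (t * hermite_fun 0 t - sqrt 2 * hermite_fun 1 t) = - (sqrt 2 * (hermite_fun 0 t * hermite_fun 1 t))"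
      using hermite_fun_1[of t] by (simp add: algebra_simps)
    ultimately show ?case by simp
  next
    case (Suc R)
    \<comment> \<open>Adding the raising and the lowering formula removes the term with the factor
      t; what remains is what makes the derivative of the sum telescope.\<close>
    have d: "2 * (t * hermite_fun (Suc R) t - sqrt (2 * real (Suc (Suc R))) * hermite_fun (Suc (Suc R)) t)
      = sqrt (2 * real (Suc R)) * hermite_fun R t - sqrt (2 * real (Suc (Suc R))) * hermite_fun (Suc (Suc R)) t"
    proof -
      have two: "2 * x = z - y" if "x = v - y" "x = z - v" for x y z v :: real
        using that by simp
      show ?thesis
        by (rule two[OF refl DERIV_unique[OF hermite_fun_deriv_up[of "Suc R" t] hermite_fun_deriv_down[of R t]]])
    qed
    have "((\<lambda>t. (hermite_fun (Suc R) t)\<^sup>2) has_real_derivative hermite_fun (Suc R) t * (2 * (t * hermite_fun (Suc R) t - sqrt (2 * real (Suc (Suc R))) * hermite_fun (Suc (Suc R)) t))) (at t)"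
      using hermite_fun_deriv_up[of "Suc R" t] by (auto intro!: derivative_eq_intros)
    then have "((\<lambda>t. (hermite_fun (Suc R) t)\<^sup>2) has_real_derivative hermite_fun (Suc R) t * (sqrt (2 * real (Suc R)) * hermite_fun R t - sqrt (2 * real (Suc (Suc R))) * hermite_fun (Suc (Suc R)) t)) (at t)"
      unfolding d .
    from DERIV_add[OF Suc this] show ?case
      by (simp add: algebra_simps del: of_nat_Suc)
  qed
  have rs: "rapid (\<lambda>t. \<Sum>n\<le>R. (hermite_fun n t)\<^sup>2)" for R
  proof (induction R)
    case 0
    then show ?case unfolding power2_eq_square by (simp add: rapid_mult rapid_hermite_fun)
  next
    case (Suc R)
    have "rapid (\<lambda>t. (hermite_fun (Suc R) t)\<^sup>2)"
      unfolding power2_eq_square by (intro rapid_mult rapid_hermite_fun)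
    from rapid_add[OF Suc this] show ?case by simp
  qed
  have int: "integrable lborel (\<lambda>t. (hermite_fun m t)\<^sup>2)" for m
    unfolding power2_eq_square by (intro rapid_integrable rapid_mult rapid_hermite_fun) measurable
  have "(\<Sum>n\<le>R. (hermite_fun n t)\<^sup>2) \<le> (\<integral>x. \<bar>- c * (?h x * ?k x)\<bar> \<partial>lborel)"
  proof (rule le_integral_abs_deriv[OF _ rs])
    show "((\<lambda>t. \<Sum>n\<le>R. (hermite_fun n t)\<^sup>2) has_real_derivative - c * (?h t * ?k t)) (at t)" for t
      using der[of R t] by (simp add: c_def)
    show "rapid (\<lambda>t. - c * (?h t * ?k t))" by (intro rapid_cmult rapid_mult rapid_hermite_fun)
    show "continuous_on UNIV (\<lambda>t. - c * (?h t * ?k t))"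
      by (intro continuous_intros hermite_fun_continuous)
  qed
  also have "\<dots> \<le> (\<integral>x. c * (1 / 2 * ((?h x)\<^sup>2 + (?k x)\<^sup>2)) \<partial>lborel)"
  proof (rule integral_mono)
    show "integrable lborel (\<lambda>x. \<bar>- c * (?h x * ?k x)\<bar>)"
      by (intro integrable_abs rapid_integrable rapid_cmult rapid_mult rapid_hermite_fun) measurable
    show "integrable lborel (\<lambda>x. c * (1 / 2 * ((?h x)\<^sup>2 + (?k x)\<^sup>2)))"
      by (intro integrable_mult_right Bochner_Integration.integrable_add int)
    show "\<bar>- c * (?h x * ?k x)\<bar> \<le> c * (1 / 2 * ((?h x)\<^sup>2 + (?k x)\<^sup>2))" for x
    proof -
      have "2 * (\<bar>?h x\<bar> * \<bar>?k x\<bar>) \<le> (?h x)\<^sup>2 + (?k x)\<^sup>2"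
        using sum_squares_bound[of "\<bar>?h x\<bar>" "\<bar>?k x\<bar>"] by simp
      then have "c * (\<bar>?h x\<bar> * \<bar>?k x\<bar>) \<le> c * (1 / 2 * ((?h x)\<^sup>2 + (?k x)\<^sup>2))"
        by (intro mult_left_mono) (auto simp: c_def)
      then show ?thesis by (simp add: abs_mult c_def)
    qed
  qed
  also have "\<dots> = c" using int by (simp add: integral_hermite_fun_square)
  finally show ?thesis by (simp add: c_def)
qed

section \<open>Hermite coefficients of a translated Gaussian\<close>

definition coherent_coeff :: "nat \<Rightarrow> real \<Rightarrow> real" where
  "coherent_coeff n s = (\<integral>t. hermite_fun n t * exp (- (t - s)\<^sup>2 / 2) \<partial>lborel)"

lemma rapid_coherent: "rapid (\<lambda>t. hermite_fun n t * exp (- (t - s)\<^sup>2 / 2))"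
  using rapid_bounded_mult[OF rapid_hermite_fun, of "\<lambda>t. exp (- (t - s)\<^sup>2 / 2)" 1 n]
  by (simp add: mult.commute)

lemma integrable_coherent: "integrable lborel (\<lambda>t. hermite_fun n t * exp (- (t - s)\<^sup>2 / 2))"
  by (rule rapid_integrable[OF rapid_coherent]) measurable

lemma coherent_coeff_0: "coherent_coeff 0 s = pi powr (1 / 4) * exp (- s\<^sup>2 / 4)"
proof -
  have "hermite_fun 0 t * exp (- (t - s)\<^sup>2 / 2) = pi powr (- 1 / 4) * exp (- s\<^sup>2 / 4) * exp (- (t - s / 2)\<^sup>2)" for t
    by (simp add: hermite_fun_0 exp_add[symmetric] mult.assoc) (simp add: power2_eq_square field_simps)
  then have "coherent_coeff 0 s = pi powr (- 1 / 4) * exp (- s\<^sup>2 / 4) * sqrt pi"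
    by (simp add: coherent_coeff_def shifted_gaussian_integral)
  moreover have "pi powr (- 1 / 4) * sqrt pi = pi powr (1 / 4)"
    by (simp add: powr_half_sqrt[symmetric] powr_add[symmetric])
  ultimately show ?thesis by simp
qed

text \<open>Coherent states are eigenfunctions of the lowering operator. In the derivative of the
  integrand the term t h_n from the raising formula cancels against the one from the Gaussian, and
  only the shift \<open>s\<close> survives.\<close>

lemma coherent_coeff_Suc: "sqrt (2 * real (Suc n)) * coherent_coeff (Suc n) s = s * coherent_coeff n s"
proof -
  define c where "c = sqrt (2 * real (Suc n))"
  let ?g = "\<lambda>t. exp (- (t - s)\<^sup>2 / 2)"
  have "(\<integral>t. s * (hermite_fun n t * ?g t) - c * (hermite_fun (Suc n) t * ?g t) \<partial>lborel) = 0"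
  proof (rule integral_deriv_rapid[where F = "\<lambda>t. hermite_fun n t * ?g t"])
    show "((\<lambda>t. hermite_fun n t * ?g t) has_real_derivative s * (hermite_fun n t * ?g t) - c * (hermite_fun (Suc n) t * ?g t)) (at t)" for t
    proof -
      have "((\<lambda>t. - (t - s)\<^sup>2 / 2) has_real_derivative - (t - s)) (at t)"
        by (auto intro!: derivative_eq_intros simp: field_simps)
      then have "(?g has_real_derivative ?g t * - (t - s)) (at t)"
        by (rule DERIV_fun_exp)
      from DERIV_mult[OF hermite_fun_deriv_up[of n t] this] show ?thesis
        by (simp add: c_def algebra_simps del: of_nat_Suc)
    qed
    show "continuous_on UNIV (\<lambda>t. s * (hermite_fun n t * ?g t) - c * (hermite_fun (Suc n) t * ?g t))"
      by (intro continuous_intros hermite_fun_continuous) auto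
  qed (intro rapid_coherent rapid_diff rapid_cmult)+
  then show ?thesis using integrable_coherent by (simp add: coherent_coeff_def c_def)
qed

lemma coherent_coeff_zero_right: "coherent_coeff (Suc n) 0 = 0"
  using coherent_coeff_Suc[of n 0] by simp

lemma coherent_coeff_nonneg: "0 \<le> s \<Longrightarrow> 0 \<le> coherent_coeff n s"
proof (induction n)
  case (Suc n)
  have "0 \<le> sqrt (2 * real (Suc n)) * coherent_coeff (Suc n) s"
    unfolding coherent_coeff_Suc using Suc by simp
  then show ?case by (simp add: zero_le_mult_iff)
qed (simp add: coherent_coeff_0)

lemma coherent_coeff_square: "(coherent_coeff n s)\<^sup>2 = sqrt pi * exp (- s\<^sup>2 / 2) * ((s\<^sup>2 / 2) ^ n / fact n)"
proof (induction n)
  case 0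
  have "(pi powr (1 / 4))\<^sup>2 = sqrt pi"
    by (simp add: power2_eq_square powr_add[symmetric] powr_half_sqrt)
  moreover have "(exp (- s\<^sup>2 / 4))\<^sup>2 = exp (- s\<^sup>2 / 2)"
    by (simp add: power2_eq_square exp_add[symmetric])
  ultimately show ?case by (simp add: coherent_coeff_0 power_mult_distrib)
next
  case (Suc n)
  have "(sqrt (2 * real (Suc n)) * coherent_coeff (Suc n) s)\<^sup>2 = (s * coherent_coeff n s)\<^sup>2"
    by (simp only: coherent_coeff_Suc)
  then have "2 * real (Suc n) * (coherent_coeff (Suc n) s)\<^sup>2 = s\<^sup>2 * (coherent_coeff n s)\<^sup>2"
    by (simp add: power_mult_distrib del: of_nat_Suc)
  then have "(coherent_coeff (Suc n) s)\<^sup>2 = s\<^sup>2 / 2 / real (Suc n) * (coherent_coeff n s)\<^sup>2"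
    by (simp add: field_simps del: of_nat_Suc)
  also have "\<dots> = sqrt pi * exp (- s\<^sup>2 / 2) * ((s\<^sup>2 / 2) * (s\<^sup>2 / 2) ^ n / (real (Suc n) * fact n))"
    unfolding Suc by (simp add: field_simps del: of_nat_Suc)
  finally show ?case by (simp del: of_nat_Suc)
qed

text \<open>Everything follows from (n + 1) p(n + 1) = N p(n): reindexing gives mean N and second
  moment N (N + 1), hence variance N.\<close>

lemma poisson_sums:
  fixes N :: real
  shows "(\<lambda>n. exp (- N) * (N ^ n / fact n)) sums 1"
    and "(\<lambda>n. (real n - N)\<^sup>2 * (exp (- N) * (N ^ n / fact n))) sums N"
proof -
  define p where "p n = exp (- N) * (N ^ n / fact n)" for n
  have "(\<lambda>n. exp (- N) * (N ^ n /\<^sub>R fact n)) sums (exp (- N) * exp N)"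
    by (intro sums_mult exp_converges)
  then have s0: "p sums 1"
    by (simp add: p_def[abs_def] exp_minus field_simps)
  then show "(\<lambda>n. exp (- N) * (N ^ n / fact n)) sums 1"
    by (simp add: p_def[abs_def])
  have pS: "real (Suc n) * p (Suc n) = N * p n" for n
    by (simp add: p_def field_simps del: of_nat_Suc)
  have "(\<lambda>n. real (Suc n) * p (Suc n)) sums (N * 1)"
    unfolding pS by (intro sums_mult s0)
  then have s1: "(\<lambda>n. real n * p n) sums N"
    using sums_Suc[of "\<lambda>n. real n * p n"] by simp
  have "(\<lambda>n. (real (Suc n))\<^sup>2 * p (Suc n)) sums (N * (N + 1))"
  proof -
    have "(real (Suc n))\<^sup>2 * p (Suc n) = N * (real n * p n + p n)" for n
    proof -
      have "(real (Suc n))\<^sup>2 * p (Suc n) = real (Suc n) * (real (Suc n) * p (Suc n))"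
        by (simp only: power2_eq_square mult.assoc)
      also have "\<dots> = N * (real n * p n + p n)" unfolding pS by (simp add: algebra_simps)
      finally show ?thesis .
    qed
    then show ?thesis using sums_mult[OF sums_add[OF s1 s0], of N] by simp
  qed
  then have s2: "(\<lambda>n. (real n)\<^sup>2 * p n) sums (N * (N + 1))"
    using sums_Suc[of "\<lambda>n. (real n)\<^sup>2 * p n"] by simp
  have "(\<lambda>n. (real n)\<^sup>2 * p n - 2 * N * (real n * p n) + N\<^sup>2 * p n) sums (N * (N + 1) - 2 * N * N + N\<^sup>2 * 1)"
    by (intro sums_add sums_diff sums_mult s0 s1 s2)
  moreover have "(real n)\<^sup>2 * p n - 2 * N * (real n * p n) + N\<^sup>2 * p n = (real n - N)\<^sup>2 * p n" for n
    by (simp add: power2_eq_square algebra_simps)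
  moreover have "N * (N + 1) - 2 * N * N + N\<^sup>2 * 1 = N" by (simp add: power2_eq_square algebra_simps)
  ultimately show "(\<lambda>n. (real n - N)\<^sup>2 * (exp (- N) * (N ^ n / fact n))) sums N"
    by (simp add: p_def)
qed

text \<open>\<open>sqrt pi\<close> is the squared norm of the Gaussian, so the first statement is
  Parseval's identity for it, obtained from the explicit coefficients; the second is the Poisson
  variance.\<close>

lemma coherent_coeff_square_sums:
  shows "(\<lambda>n. (coherent_coeff n s)\<^sup>2) sums sqrt pi"
    and "(\<lambda>n. (real n - s\<^sup>2 / 2)\<^sup>2 * (coherent_coeff n s)\<^sup>2) sums (sqrt pi * (s\<^sup>2 / 2))"
proof -
  have eq: "(coherent_coeff n s)\<^sup>2 = sqrt pi * (exp (- (s\<^sup>2 / 2)) * ((s\<^sup>2 / 2) ^ n / fact n))" for n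
    using coherent_coeff_square[of n s] by simp
  show "(\<lambda>n. (coherent_coeff n s)\<^sup>2) sums sqrt pi"
    unfolding eq using sums_mult[OF poisson_sums(1), of "sqrt pi"] by simp
  show "(\<lambda>n. (real n - s\<^sup>2 / 2)\<^sup>2 * (coherent_coeff n s)\<^sup>2) sums (sqrt pi * (s\<^sup>2 / 2))"
    unfolding eq mult.left_commute[of _ "sqrt pi"] by (intro sums_mult poisson_sums(2))
qed

lemma coherent_coeff_sum_le:
  "(\<Sum>n\<le>R. (coherent_coeff n s)\<^sup>2) \<le> sqrt pi"
  "(\<Sum>n\<le>R. (real n - s\<^sup>2 / 2)\<^sup>2 * (coherent_coeff n s)\<^sup>2) \<le> sqrt pi * (s\<^sup>2 / 2)"
proof -
  have le: "(\<Sum>n\<le>R. f n) \<le> l" if "f sums l" "\<And>n. 0 \<le> f n" for f :: "nat \<Rightarrow> real" and l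
    using sum_le_suminf[OF sums_summable[OF that(1)], of "{..R}"] sums_unique[OF that(1)] that(2) by simp
  show "(\<Sum>n\<le>R. (coherent_coeff n s)\<^sup>2) \<le> sqrt pi"
    by (rule le[OF coherent_coeff_square_sums(1)]) simp
  show "(\<Sum>n\<le>R. (real n - s\<^sup>2 / 2)\<^sup>2 * (coherent_coeff n s)\<^sup>2) \<le> sqrt pi * (s\<^sup>2 / 2)"
    by (rule le[OF coherent_coeff_square_sums(2)]) simp
qed

text \<open>Chebyshev's inequality: past 4 N the deviation from the mean is at least 3 N, so 1 - (n
  - N)^2 / (9 N^2) lies below the indicator of \<open>n \<le> R\<close>, and at most the fraction 1
  / (9 N) of the mass is lost. The threshold 4 N is the end of the support of the cutoff n \<mapsto>
  a(n / N).\<close>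

lemma coherent_coeff_sum_ge:
  assumes N: "s\<^sup>2 / 2 = N" "1 \<le> N" and R: "4 * N \<le> real R"
  shows "sqrt pi / 2 \<le> (\<Sum>n\<le>R. (coherent_coeff n s)\<^sup>2)"
proof -
  let ?b = "\<lambda>n. (coherent_coeff n s)\<^sup>2"
  have "(\<lambda>n. ?b n - 1 / (9 * N\<^sup>2) * ((real n - N)\<^sup>2 * ?b n)) sums (sqrt pi - 1 / (9 * N\<^sup>2) * (sqrt pi * N))"
    using coherent_coeff_square_sums[of s] N(1) by (intro sums_diff sums_mult) auto
  moreover have "(\<lambda>n. if n \<in> {..R} then ?b n else 0) sums (\<Sum>n\<le>R. ?b n)"
    by (rule sums_If_finite_set) simp
  moreover have "?b n - 1 / (9 * N\<^sup>2) * ((real n - N)\<^sup>2 * ?b n) \<le> (if n \<in> {..R} then ?b n else 0)" for n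
  proof (cases "n \<le> R")
    case True
    then show ?thesis by simp
  next
    case False
    then have "3 * N \<le> real n - N" using R by linarith
    then have "(3 * N)\<^sup>2 \<le> (real n - N)\<^sup>2" using N by (intro power_mono) auto
    then have "1 \<le> 1 / (9 * N\<^sup>2) * (real n - N)\<^sup>2" using N(2) by (simp add: power_mult_distrib field_simps)
    then have "?b n * 1 \<le> ?b n * (1 / (9 * N\<^sup>2) * (real n - N)\<^sup>2)"
      by (intro mult_left_mono) auto
    then show ?thesis using False by (simp add: mult_ac)
  qed
  ultimately have "sqrt pi - 1 / (9 * N\<^sup>2) * (sqrt pi * N) \<le> (\<Sum>n\<le>R. ?b n)"
    by (rule sums_le[rotated 1])
  moreover have "1 / (9 * N\<^sup>2) * (sqrt pi * N) \<le> sqrt pi / 2"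
    using N(2) by (simp add: power2_eq_square field_simps)
  ultimately show ?thesis by linarith
qed

lemma coherent_coeff_abs_le: "\<bar>coherent_coeff n s\<bar> \<le> sqrt pi"
proof -
  have "(coherent_coeff n s)\<^sup>2 = (\<Sum>m\<in>{n}. (coherent_coeff m s)\<^sup>2)" by simp
  also have "\<dots> \<le> (\<Sum>m\<le>n. (coherent_coeff m s)\<^sup>2)" by (intro sum_mono2) auto
  also have "\<dots> \<le> sqrt pi" by (rule coherent_coeff_sum_le)
  also have "sqrt pi \<le> sqrt pi * sqrt pi"
    using real_sqrt_ge_one[of pi] pi_gt3 by (intro mult_le_cancel_left1[THEN iffD2]) auto
  also have "\<dots> = (sqrt pi)\<^sup>2" by (simp only: power2_eq_square)
  finally show ?thesis unfolding abs_le_square_iff[symmetric] by simp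
qed

section \<open>Coefficients of the superposition\<close>

definition comb_coeff :: "(nat \<Rightarrow> real) \<Rightarrow> nat \<Rightarrow> real" where
  "comb_coeff s n = (\<Sum>k. (1 / 2) ^ k * coherent_coeff n (s k))"

lemma comb_coeff_sums: "(\<lambda>k. (1 / 2) ^ k * coherent_coeff n (s k)) sums comb_coeff s n"
  unfolding comb_coeff_def
  by (rule summable_sums, rule summable_half_powers_bounded[where B = "sqrt pi"])
     (auto intro: coherent_coeff_abs_le)

lemma comb_coeff_ge:
  assumes "\<And>k. 0 \<le> s k"
  shows "(1 / 2) ^ k * coherent_coeff n (s k) \<le> comb_coeff s n" and "0 \<le> comb_coeff s n"
proof -
  have "(\<Sum>k\<in>{k}. (1 / 2) ^ k * coherent_coeff n (s k)) \<le> comb_coeff s n"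
    unfolding comb_coeff_def using assms
    by (intro sum_le_suminf sums_summable[OF comb_coeff_sums]) (auto simp: coherent_coeff_nonneg)
  then show le: "(1 / 2) ^ k * coherent_coeff n (s k) \<le> comb_coeff s n" by simp
  have "0 \<le> (1 / 2) ^ k * coherent_coeff n (s k)" using assms by (simp add: coherent_coeff_nonneg)
  then show "0 \<le> comb_coeff s n" using le by linarith
qed

text \<open>Estimates that are linear in the coefficients pass from single translates to the
  superposition; the factor 2 is the total of the geometric weights.\<close>

lemma sum_comb_coeff_le:
  assumes "\<And>k. (\<Sum>n\<le>R. w n * coherent_coeff n (s k)) \<le> M"
  shows "(\<Sum>n\<le>R. w n * comb_coeff s n) \<le> 2 * M"
proof -
  have s1: "(\<lambda>k. \<Sum>n\<le>R. w n * ((1 / 2) ^ k * coherent_coeff n (s k))) sums (\<Sum>n\<le>R. w n * comb_coeff s n)"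
    by (intro sums_sum sums_mult comb_coeff_sums)
  have le: "(\<Sum>n\<le>R. w n * ((1 / 2) ^ k * coherent_coeff n (s k))) \<le> (1 / 2) ^ k * M" for k
  proof -
    have "(\<Sum>n\<le>R. w n * ((1 / 2) ^ k * coherent_coeff n (s k))) = (1 / 2) ^ k * (\<Sum>n\<le>R. w n * coherent_coeff n (s k))"
      by (simp add: sum_distrib_left mult_ac)
    then show ?thesis using assms[of k] by simp
  qed
  have s2: "(\<lambda>k. (1 / 2) ^ k * M) sums (2 * M)"
    using sums_mult2[OF geometric_sums[of "1 / 2 :: real"], of M] by simp
  show ?thesis
    by (rule sums_le[OF le s1 s2])
qed

lemma am_gm_scaled:
  fixes x y l :: real
  assumes "0 < l"
  shows "x * y \<le> (x\<^sup>2 / l + l * y\<^sup>2) / 2"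
proof -
  have "0 \<le> (x - l * y)\<^sup>2" by simp
  then have "2 * l * (x * y) \<le> x\<^sup>2 + l\<^sup>2 * y\<^sup>2"
    by (simp add: power2_diff power_mult_distrib mult_ac)
  then show ?thesis using assms by (simp add: field_simps power2_eq_square)
qed

text \<open>Cauchy--Schwarz in the form of a scaled arithmetic-geometric mean. The scale
  \<open>sqrt N\<close> balances the variance of the \<open>k\<close>-th state, of order N, against
  the mass of the \<open>l\<close>-th one, of order 1. All \<open>l\<close> are treated alike,
  including those far from \<open>k\<close>.\<close>

lemma comb_coeff_variance:
  assumes N: "(s k)\<^sup>2 / 2 = N" "0 < N" and s: "\<And>k. 0 \<le> s k"
  shows "(\<Sum>n\<le>R. \<bar>real n - N\<bar> * coherent_coeff n (s k) * comb_coeff s n) \<le> 2 * sqrt (pi * N)"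
proof (rule sum_comb_coeff_le)
  fix l
  have r: "0 < sqrt N" using N(2) by simp
  have "(\<Sum>n\<le>R. \<bar>real n - N\<bar> * coherent_coeff n (s k) * coherent_coeff n (s l))
     \<le> (\<Sum>n\<le>R. ((real n - N)\<^sup>2 * (coherent_coeff n (s k))\<^sup>2 / sqrt N + sqrt N * (coherent_coeff n (s l))\<^sup>2) / 2)"
    using am_gm_scaled[OF r, of "\<bar>real _ - N\<bar> * coherent_coeff _ (s k)"]
    by (intro sum_mono) (simp add: power_mult_distrib)
  also have "\<dots> = ((\<Sum>n\<le>R. (real n - N)\<^sup>2 * (coherent_coeff n (s k))\<^sup>2) / sqrt N + sqrt N * (\<Sum>n\<le>R. (coherent_coeff n (s l))\<^sup>2)) / 2"
    by (simp add: sum.distrib sum_divide_distrib sum_distrib_left add_divide_distrib)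
  also have "\<dots> \<le> (sqrt pi * N / sqrt N + sqrt N * sqrt pi) / 2"
    using coherent_coeff_sum_le(2)[where s="s k" and R=R] coherent_coeff_sum_le(1)[where s="s l" and R=R] N r
    by (intro divide_right_mono add_mono mult_left_mono) auto
  also have "\<dots> = sqrt (pi * N)"
    using N(2) by (simp add: real_sqrt_mult real_div_sqrt flip: times_divide_eq_right)
  finally show "(\<Sum>n\<le>R. \<bar>real n - N\<bar> * coherent_coeff n (s k) * coherent_coeff n (s l)) \<le> sqrt (pi * N)" .
qed

text \<open>Here the unscaled mean inequality is enough: the diagonal sum of Hermite functions gives
  the order \<open>sqrt R\<close>, and the mass of a coherent state adds only a constant. The result
  controls the sup norm of the Hermite blocks.\<close>

lemma comb_coeff_hermite_bound:
  "(\<Sum>n\<le>R. \<bar>hermite_fun n t\<bar> * comb_coeff s n) \<le> sqrt (2 * real (Suc R)) + 2"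
proof -
  have "(\<Sum>n\<le>R. \<bar>hermite_fun n t\<bar> * comb_coeff s n) \<le> 2 * ((sqrt (2 * real (Suc R)) + 2) / 2)"
  proof (rule sum_comb_coeff_le)
    fix l
    have "(\<Sum>n\<le>R. \<bar>hermite_fun n t\<bar> * coherent_coeff n (s l))
      \<le> (\<Sum>n\<le>R. ((hermite_fun n t)\<^sup>2 + (coherent_coeff n (s l))\<^sup>2) / 2)"
      using am_gm_scaled[of 1 "\<bar>hermite_fun _ t\<bar>"] by (intro sum_mono) simp
    also have "\<dots> = ((\<Sum>n\<le>R. (hermite_fun n t)\<^sup>2) + (\<Sum>n\<le>R. (coherent_coeff n (s l))\<^sup>2)) / 2"
      by (simp add: sum.distrib sum_divide_distrib add_divide_distrib)
    also have "\<dots> \<le> (sqrt (2 * real (Suc R)) + sqrt pi) / 2"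
      by (intro divide_right_mono add_mono hermite_fun_sum_squares coherent_coeff_sum_le) auto
    also have "\<dots> \<le> (sqrt (2 * real (Suc R)) + 2) / 2"
      using real_sqrt_le_mono[of pi 4] pi_less_4 by simp
    finally show "(\<Sum>n\<le>R. \<bar>hermite_fun n t\<bar> * coherent_coeff n (s l)) \<le> (sqrt (2 * real (Suc R)) + 2) / 2" .
  qed
  then show ?thesis by simp
qed

section \<open>The spectral cutoff\<close>

lemma hermite_admissible_zero:
  assumes "hermite_admissible a" "0 \<le> t" "t < 1 / 4 \<or> 4 < t"
  shows "a t = 0"
proof (rule ccontr)
  assume "a t \<noteq> 0"
  then have "t \<in> closure {t. 0 \<le> t \<and> a t \<noteq> 0}"
    using assms(2) by (intro closure_subset[THEN subsetD]) simp
  then have "t \<in> {1 / 4..4}" using assms(1) unfolding hermite_admissible_def by blast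
  then show False using assms(3) by auto
qed

lemma hermite_admissible_continuous:
  assumes "hermite_admissible a"
  shows "continuous_on {0..} a"
proof -
  have "\<forall>t\<ge>0. (halfline_deriv ^^ 0) a differentiable (at t within {0..})"
    using assms unfolding hermite_admissible_def by blast
  then show ?thesis
    by (auto simp: continuous_on_eq_continuous_within intro: differentiable_imp_continuous_within)
qed

lemma hermite_admissible_bounded:
  assumes "hermite_admissible a"
  obtains A where "0 < A" "\<And>t. 0 \<le> t \<Longrightarrow> norm (a t) \<le> A"
proof -
  have "continuous_on {0..4} a"
    by (rule continuous_on_subset[OF hermite_admissible_continuous[OF assms]]) auto
  then have "bounded (a ` {0..4})"
    by (intro compact_imp_bounded compact_continuous_image) auto
  then obtain A where A: "0 < A" "\<And>t. t \<in> {0..4} \<Longrightarrow> norm (a t) \<le> A"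
    by (auto simp: bounded_pos)
  have "norm (a t) \<le> A" if "0 \<le> t" for t
    using A that hermite_admissible_zero[OF assms that] by (cases "t \<le> 4") auto
  then show thesis using A(1) that by blast
qed

text \<open>Continuity settles a neighbourhood of 1, and elsewhere a steep slope beats the bound on
  \<open>a\<close>. The error is linear in the distance to 1 so that a first absolute moment can be
  inserted; the constant part is only half of \<open>norm (a 1)\<close>, so the other half survives
  the comparison.\<close>

lemma hermite_admissible_near_1:
  assumes "hermite_admissible a"
  obtains L where "0 \<le> L" "\<And>t. 0 \<le> t \<Longrightarrow> norm (a t - a 1) \<le> norm (a 1) / 2 + L * \<bar>t - 1\<bar>" "0 < norm (a 1)"
proof -
  obtain c where "c > 0" and c: "\<forall>t\<in>{1 / 3..3}. c < norm (a t)"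
    using assms unfolding hermite_admissible_def by blast
  have "c < norm (a 1)" by (rule bspec[OF c]) simp
  with \<open>c > 0\<close> have a1: "0 < norm (a 1)" by linarith
  obtain A where A: "0 < A" "\<And>t. 0 \<le> t \<Longrightarrow> norm (a t) \<le> A"
    using hermite_admissible_bounded[OF assms] by blast
  have "\<exists>d>0. \<forall>t\<in>{0..}. dist t 1 < d \<longrightarrow> dist (a t) (a 1) < norm (a 1) / 2"
    using bspec[OF hermite_admissible_continuous[OF assms, unfolded continuous_on_iff], of 1]
      half_gt_zero[OF a1] by (simp only: atLeast_iff zero_le_one)
  then obtain d where d: "0 < d" "\<And>t. 0 \<le> t \<Longrightarrow> \<bar>t - 1\<bar> < d \<Longrightarrow> norm (a t - a 1) < norm (a 1) / 2"
    by (auto simp: dist_norm)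
  have "norm (a t - a 1) \<le> norm (a 1) / 2 + (2 * A / d) * \<bar>t - 1\<bar>" if t: "0 \<le> t" for t
  proof (cases "\<bar>t - 1\<bar> < d")
    case True
    moreover have "0 \<le> (2 * A / d) * \<bar>t - 1\<bar>" using A(1) d(1) by simp
    ultimately show ?thesis using d(2)[OF t True] by linarith
  next
    case False
    have "norm (a t - a 1) \<le> A + A"
      using norm_triangle_ineq4[of "a t" "a 1"] A(2)[OF t] A(2)[of 1] by simp
    also have "\<dots> = (2 * A / d) * d" using d(1) by simp
    also have "\<dots> \<le> (2 * A / d) * \<bar>t - 1\<bar>" using False A(1) d(1) by (intro mult_left_mono) auto
    finally show ?thesis using a1 by linarith
  qed
  then show thesis using that[of "2 * A / d"] A(1) d(1) a1 by simp
qed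

text \<open>The multiplier is compared with the constant \<open>a 1\<close>. The linear error is
  paid by the variance estimate, which after division by N = 4^m costs 2^(-m). For the main term
  nonnegativity permits discarding every translate except the \<open>k\<close>-th. The constants
  precede \<open>s\<close>, \<open>k\<close> and \<open>m\<close>, so that \<open>m\<close> may
  later be chosen as a function of \<open>k\<close>.\<close>

lemma multiplier_lower_bound:
  assumes adm: "hermite_admissible a"
  obtains c C where "0 < c" "0 \<le> C"
    "\<And>s k m. (\<And>k. 0 \<le> s k) \<Longrightarrow> (s k)\<^sup>2 / 2 = 4 ^ m \<Longrightarrow>
      c * (1 / 2) ^ k - C * (1 / 2) ^ m
        \<le> norm (\<Sum>n\<le>4 ^ Suc m. a (real n / 4 ^ m) * of_real (comb_coeff s n * coherent_coeff n (s k)))"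
proof -
  obtain L where L: "0 \<le> L" "\<And>t. 0 \<le> t \<Longrightarrow> norm (a t - a 1) \<le> norm (a 1) / 2 + L * \<bar>t - 1\<bar>" and a1: "0 < norm (a 1)"
    using hermite_admissible_near_1[OF adm] by blast
  have "norm (a 1) / 2 * (sqrt pi / 2) * (1 / 2) ^ k - L * (2 * sqrt pi) * (1 / 2) ^ m
        \<le> norm (\<Sum>n\<le>4 ^ Suc m. a (real n / 4 ^ m) * of_real (comb_coeff s n * coherent_coeff n (s k)))"
    if s: "\<And>k. 0 \<le> s k" and sk: "(s k)\<^sup>2 / 2 = 4 ^ m" for s k m
  proof -
    define N :: real where "N = 4 ^ m"
    have N: "1 \<le> N" by (simp add: N_def)
    have sqN: "sqrt N = 2 ^ m"
      by (rule real_sqrt_unique) (simp_all add: N_def power2_eq_square flip: power_mult_distrib)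
    define R :: nat where "R = 4 ^ Suc m"
    define e where "e n = comb_coeff s n * coherent_coeff n (s k)" for n
    have e0: "0 \<le> e n" for n
      unfolding e_def using comb_coeff_ge[OF s] coherent_coeff_nonneg[OF s] by simp
    have le: "norm (a (real n / N) - a 1) \<le> norm (a 1) / 2 + L / N * \<bar>real n - N\<bar>" for n
    proof -
      have "\<bar>real n / N - 1\<bar> = \<bar>real n - N\<bar> / N" using N by (simp add: field_simps abs_if)
      then show ?thesis using L(2)[of "real n / N"] N by simp
    qed
    have "norm (\<Sum>n\<le>R. (a (real n / N) - a 1) * of_real (e n))
       \<le> (\<Sum>n\<le>R. norm ((a (real n / N) - a 1) * of_real (e n)))" by (rule norm_sum)
    also have "\<dots> \<le> (\<Sum>n\<le>R. (norm (a 1) / 2 + L / N * \<bar>real n - N\<bar>) * e n)"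
      using mult_right_mono[OF le e0] by (intro sum_mono) (simp only: norm_mult norm_of_real abs_of_nonneg[OF e0])
    also have "\<dots> = norm (a 1) / 2 * (\<Sum>n\<le>R. e n) + L / N * (\<Sum>n\<le>R. \<bar>real n - N\<bar> * e n)"
      by (simp only: distrib_right sum.distrib sum_distrib_left mult.assoc)
    also have "L / N * (\<Sum>n\<le>R. \<bar>real n - N\<bar> * e n) \<le> L / N * (2 * sqrt (pi * N))"
      using L(1) N comb_coeff_variance[of s k N R] sk s
      by (intro mult_left_mono) (simp_all add: e_def N_def mult_ac)
    also have "\<dots> = L * (2 * sqrt pi) * (1 / 2) ^ m"
    proof -
      have "N = 2 ^ m * 2 ^ m" by (simp add: N_def flip: power_mult_distrib)
      then show ?thesis by (simp add: real_sqrt_mult sqN power_one_over)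
    qed
    finally have diff: "norm (\<Sum>n\<le>R. (a (real n / N) - a 1) * of_real (e n))
       \<le> norm (a 1) / 2 * (\<Sum>n\<le>R. e n) + L * (2 * sqrt pi) * (1 / 2) ^ m" by simp
    have "(\<Sum>n\<le>R. (a (real n / N) - a 1) * of_real (e n))
       = (\<Sum>n\<le>R. a (real n / N) * of_real (e n)) - a 1 * of_real (\<Sum>n\<le>R. e n)"
      by (simp add: left_diff_distrib sum_subtractf sum_distrib_left)
    then have "norm (a 1 * of_real (\<Sum>n\<le>R. e n)) - norm (\<Sum>n\<le>R. a (real n / N) * of_real (e n))
        \<le> norm (\<Sum>n\<le>R. (a (real n / N) - a 1) * of_real (e n))"
      by (simp add: norm_minus_commute norm_triangle_ineq2)
    moreover have "norm (a 1 * of_real (\<Sum>n\<le>R. e n)) = norm (a 1) * (\<Sum>n\<le>R. e n)"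
      using e0 by (simp only: norm_mult norm_of_real abs_of_nonneg[OF sum_nonneg])
    ultimately have "norm (a 1) / 2 * (\<Sum>n\<le>R. e n) - L * (2 * sqrt pi) * (1 / 2) ^ m
       \<le> norm (\<Sum>n\<le>R. a (real n / N) * of_real (e n))" using diff by linarith
    moreover have "(1 / 2) ^ k * (sqrt pi / 2) \<le> (\<Sum>n\<le>R. e n)"
    proof -
      have "(1 / 2) ^ k * (sqrt pi / 2) \<le> (1 / 2) ^ k * (\<Sum>n\<le>R. (coherent_coeff n (s k))\<^sup>2)"
        using sk N by (intro mult_left_mono coherent_coeff_sum_ge[of _ N]) (auto simp: N_def R_def)
      also have "\<dots> = (\<Sum>n\<le>R. (1 / 2) ^ k * coherent_coeff n (s k) * coherent_coeff n (s k))"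
        by (simp add: sum_distrib_left power2_eq_square mult.assoc)
      also have "\<dots> \<le> (\<Sum>n\<le>R. e n)"
        unfolding e_def using s by (intro sum_mono mult_right_mono comb_coeff_ge coherent_coeff_nonneg)
      finally show ?thesis .
    qed
    then have "norm (a 1) / 2 * ((1 / 2) ^ k * (sqrt pi / 2)) \<le> norm (a 1) / 2 * (\<Sum>n\<le>R. e n)"
      by (intro mult_left_mono) auto
    ultimately show ?thesis unfolding N_def R_def e_def by (simp only: mult_ac)
  qed
  then show thesis using that[of "norm (a 1) / 2 * (sqrt pi / 2)" "L * (2 * sqrt pi)"] a1 L(1) by simp
qed

section \<open>The Hermite--Triebel--Lizorkin quasi-norm\<close>

lemma finite_multi_indices: "finite {\<beta> :: 'n::finite \<Rightarrow> nat. (\<Sum>i\<in>UNIV. \<beta> i) = \<nu>}"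
proof (rule finite_subset)
  show "{\<beta> :: 'n \<Rightarrow> nat. (\<Sum>i\<in>UNIV. \<beta> i) = \<nu>} \<subseteq> PiE UNIV (\<lambda>_. {..\<nu>})"
    by (auto intro: member_le_sum)
  show "finite (PiE (UNIV :: 'n set) (\<lambda>_. {..\<nu>}))" by (intro finite_PiE) auto
qed

lemma
  fixes y :: "real ^ 'n::finite"
  shows integrable_gauss_hermite_multi: "integrable lborel (\<lambda>z. gauss (z - y) * hermite_multi \<beta> z)"
    and integral_gauss_hermite_multi:
      "(\<integral>z. gauss (z - y) * hermite_multi \<beta> z \<partial>lborel) = (\<Prod>i\<in>UNIV. coherent_coeff (\<beta> i) (y $ i))"
proof -
  have eq: "gauss (z - y) * hermite_multi \<beta> z = (\<Prod>i\<in>UNIV. hermite_fun (\<beta> i) (z $ i) * exp (- (z $ i - y $ i)\<^sup>2 / 2))" for z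
    unfolding gauss_def gaussian_vec_prod hermite_multi_def by (simp add: prod.distrib mult.commute)
  show "integrable lborel (\<lambda>z. gauss (z - y) * hermite_multi \<beta> z)"
    unfolding eq by (intro integrable_prod_vec integrable_coherent)
  show "(\<integral>z. gauss (z - y) * hermite_multi \<beta> z \<partial>lborel) = (\<Prod>i\<in>UNIV. coherent_coeff (\<beta> i) (y $ i))"
    unfolding eq integral_prod_vec[OF integrable_coherent] by (simp only: coherent_coeff_def)
qed

lemma integrable_hermite_multi: "integrable lborel (hermite_multi \<beta> :: real ^ 'n::finite \<Rightarrow> real)"
  unfolding hermite_multi_def
  by (intro integrable_prod_vec rapid_integrable rapid_hermite_fun hermite_fun_measurable)

text \<open>This is the ground state in the variables other than \<open>i0\<close>, each factor
  multiplied by the lowest coefficient of a centred Gaussian; the normalising powers of pi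
  cancel.\<close>

definition gauss_tail :: "'n \<Rightarrow> real ^ 'n::finite \<Rightarrow> real" where
  "gauss_tail i0 x = (\<Prod>i\<in>UNIV - {i0}. exp (- (x $ i)\<^sup>2 / 2))"

lemma gauss_tail_bounds: "0 \<le> gauss_tail i0 x" "gauss_tail i0 x \<le> 1"
  unfolding gauss_tail_def by (auto intro!: prod_nonneg prod_le_1)

text \<open>A Gaussian centred on a coordinate axis is in its ground state in the remaining variables,
  so only one multi-index of each degree contributes.\<close>

lemma integral_gauss_hermite_kernel:
  fixes x :: "real ^ 'n::finite"
  shows "(\<integral>z. gauss (z - axis i0 s) * hermite_kernel \<nu> x z \<partial>lborel)
    = hermite_fun \<nu> (x $ i0) * coherent_coeff \<nu> s * gauss_tail i0 x"
proof -
  define S where "S = {\<beta> :: 'n \<Rightarrow> nat. (\<Sum>i\<in>UNIV. \<beta> i) = \<nu>}"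
  define \<beta>0 where "\<beta>0 = (\<lambda>i::'n. if i = i0 then \<nu> else 0)"
  have fin: "finite S" unfolding S_def by (rule finite_multi_indices)
  have mem: "\<beta>0 \<in> S" by (simp add: S_def \<beta>0_def)
  have "(\<integral>z. gauss (z - axis i0 s) * hermite_kernel \<nu> x z \<partial>lborel)
      = (\<integral>z. (\<Sum>\<beta>\<in>S. hermite_multi \<beta> x * (gauss (z - axis i0 s) * hermite_multi \<beta> z)) \<partial>lborel)"
    by (simp add: hermite_kernel_def S_def sum_distrib_left mult_ac)
  also have "\<dots> = (\<Sum>\<beta>\<in>S. hermite_multi \<beta> x * (\<Prod>i\<in>UNIV. coherent_coeff (\<beta> i) (axis i0 s $ i)))"
    by (subst Bochner_Integration.integral_sum)
       (auto intro: integrable_gauss_hermite_multi simp: integral_gauss_hermite_multi)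
  also have "\<dots> = (\<Sum>\<beta>\<in>{\<beta>0}. hermite_multi \<beta> x * (\<Prod>i\<in>UNIV. coherent_coeff (\<beta> i) (axis i0 s $ i)))"
  proof (rule sum.mono_neutral_right[OF fin])
    show "\<forall>\<beta>\<in>S - {\<beta>0}. hermite_multi \<beta> x * (\<Prod>i\<in>UNIV. coherent_coeff (\<beta> i) (axis i0 s $ i)) = 0"
    proof
      fix \<beta> assume \<beta>: "\<beta> \<in> S - {\<beta>0}"
      have "\<exists>i. i \<noteq> i0 \<and> \<beta> i \<noteq> 0"
      proof (rule ccontr)
        assume "\<not> (\<exists>i. i \<noteq> i0 \<and> \<beta> i \<noteq> 0)"
        then have z: "\<beta> i = 0" if "i \<noteq> i0" for i using that by blast
        have "(\<Sum>i\<in>UNIV. \<beta> i) = \<beta> i0 + (\<Sum>i\<in>UNIV - {i0}. \<beta> i)" by (rule sum.remove) auto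
        also have "(\<Sum>i\<in>UNIV - {i0}. \<beta> i) = 0" using z by (intro sum.neutral) auto
        finally have "\<beta> = \<beta>0" using \<beta> z by (auto simp: S_def \<beta>0_def)
        then show False using \<beta> by simp
      qed
      then obtain i m where i: "i \<noteq> i0" "\<beta> i = Suc m" using not0_implies_Suc by blast
      then have "coherent_coeff (\<beta> i) (axis i0 s $ i) = 0"
        by (simp add: axis_def coherent_coeff_zero_right)
      then have "(\<Prod>i\<in>UNIV. coherent_coeff (\<beta> i) (axis i0 s $ i)) = 0"
        by (intro prod_zero) auto
      then show "hermite_multi \<beta> x * (\<Prod>i\<in>UNIV. coherent_coeff (\<beta> i) (axis i0 s $ i)) = 0" by simp
    qed
  qed (use mem in auto)
  also have "\<dots> = (\<Prod>i\<in>UNIV. hermite_fun (\<beta>0 i) (x $ i) * coherent_coeff (\<beta>0 i) (axis i0 s $ i))"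
    by (simp add: hermite_multi_def prod.distrib)
  also have "\<dots> = hermite_fun \<nu> (x $ i0) * coherent_coeff \<nu> s
      * (\<Prod>i\<in>UNIV - {i0}. hermite_fun (\<beta>0 i) (x $ i) * coherent_coeff (\<beta>0 i) (axis i0 s $ i))"
    by (subst prod.remove[of _ i0]) (auto simp: \<beta>0_def axis_def)
  also have "(\<Prod>i\<in>UNIV - {i0}. hermite_fun (\<beta>0 i) (x $ i) * coherent_coeff (\<beta>0 i) (axis i0 s $ i)) = gauss_tail i0 x"
    unfolding gauss_tail_def
  proof (rule prod.cong[OF refl])
    fix i assume "i \<in> UNIV - {i0}"
    moreover have "pi powr (- 1 / 4) * pi powr (1 / 4) = 1" by (simp add: powr_add[symmetric])
    ultimately show "hermite_fun (\<beta>0 i) (x $ i) * coherent_coeff (\<beta>0 i) (axis i0 s $ i) = exp (- (x $ i)\<^sup>2 / 2)"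
      by (simp add: \<beta>0_def axis_def hermite_fun_0 coherent_coeff_0 mult_ac)
  qed
  finally show ?thesis .
qed

lemma integrable_gauss_hermite_kernel:
  fixes x :: "real ^ 'n::finite"
  shows "integrable lborel (\<lambda>z. gauss (z - y) * hermite_kernel \<nu> x z)"
proof -
  have "integrable lborel (\<lambda>z. \<Sum>\<beta> | (\<Sum>i\<in>UNIV. \<beta> i) = \<nu>. hermite_multi \<beta> x * (gauss (z - y) * hermite_multi \<beta> z))"
    by (intro Bochner_Integration.integrable_sum integrable_mult_right integrable_gauss_hermite_multi)
  then show ?thesis by (simp add: hermite_kernel_def sum_distrib_left mult_ac)
qed

lemma integrable_hermite_kernel:
  "integrable lborel (hermite_kernel \<nu> (x :: real ^ 'n::finite))"
proof -
  have "integrable lborel (\<lambda>z. \<Sum>\<beta> | (\<Sum>i\<in>UNIV. \<beta> i) = \<nu>. hermite_multi \<beta> x * hermite_multi \<beta> z)"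
    by (intro Bochner_Integration.integrable_sum integrable_mult_right integrable_hermite_multi)
  then show ?thesis by (simp add: hermite_kernel_def[abs_def])
qed

text \<open>Block \<open>Suc m\<close> rescales degrees by 4^m and the cutoff vanishes past 4, which
  is why degrees stop at \<open>4 ^ Suc m\<close>.\<close>

lemma HTL_kernel_finite:
  assumes adm: "hermite_admissible a"
  shows "HTL_kernel a (Suc m) x z = (\<Sum>\<nu>\<le>4 ^ Suc m. a (real \<nu> / 4 ^ m) * of_real (hermite_kernel \<nu> x z))"
proof -
  have "a (real \<nu> / 4 ^ m) = 0" if "\<nu> \<notin> {..4 ^ Suc m}" for \<nu>
  proof -
    have "real (4 ^ Suc m) < real \<nu>" using that by (simp only: atMost_iff not_le of_nat_less_iff)
    then have "4 < real \<nu> / 4 ^ m" by (simp add: field_simps)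
    then show ?thesis by (intro hermite_admissible_zero[OF adm]) auto
  qed
  then have "(\<Sum>\<nu>. a (real \<nu> / 4 ^ m) * of_real (hermite_kernel \<nu> x z)) = (\<Sum>\<nu>\<le>4 ^ Suc m. a (real \<nu> / 4 ^ m) * of_real (hermite_kernel \<nu> x z))"
    by (intro suminf_finite) auto
  then show ?thesis by (simp add: HTL_kernel_def)
qed

definition comb_dist :: "'n \<Rightarrow> (nat \<Rightarrow> real) \<Rightarrow> (real ^ 'n::finite \<Rightarrow> complex) \<Rightarrow> complex" where
  "comb_dist i0 s = distribution_of (\<lambda>z. of_real (gauss_comb (\<lambda>k. axis i0 (s k)) z))"

lemma kernel_conv_HTL:
  fixes x :: "real ^ 'n::finite"
  assumes adm: "hermite_admissible a"
  shows "kernel_conv (HTL_kernel a (Suc m)) (comb_dist i0 s) x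
    = of_real (gauss_tail i0 x) * (\<Sum>\<nu>\<le>4 ^ Suc m. a (real \<nu> / 4 ^ m) * of_real (hermite_fun \<nu> (x $ i0) * comb_coeff s \<nu>))"
proof -
  define R :: nat where "R = 4 ^ Suc m"
  define A where "A \<nu> = a (real \<nu> / 4 ^ m)" for \<nu> :: nat
  have K: "HTL_kernel a (Suc m) x = (\<lambda>z. \<Sum>\<nu>\<le>R. A \<nu> * of_real (hermite_kernel \<nu> x z))"
    using HTL_kernel_finite[OF adm] by (auto simp: A_def R_def)
  have "integrable lborel (HTL_kernel a (Suc m) x)"
    unfolding K by (intro Bochner_Integration.integrable_sum integrable_mult_right integrable_of_real integrable_hermite_kernel)
  then have sums1: "(\<lambda>k. (1 / 2) ^ k * (\<integral>z. of_real (gauss (z - axis i0 (s k))) * HTL_kernel a (Suc m) x z \<partial>lborel)) sums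
      kernel_conv (HTL_kernel a (Suc m)) (comb_dist i0 s) x"
    unfolding comb_dist_def kernel_conv_distribution_of by (rule integral_gauss_comb)
  have int: "(\<integral>z. of_real (gauss (z - axis i0 t)) * HTL_kernel a (Suc m) x z \<partial>lborel)
      = (\<Sum>\<nu>\<le>R. A \<nu> * of_real (hermite_fun \<nu> (x $ i0) * coherent_coeff \<nu> t * gauss_tail i0 x))" for t
  proof -
    have "(\<integral>z. of_real (gauss (z - axis i0 t)) * HTL_kernel a (Suc m) x z \<partial>lborel)
      = (\<integral>z. (\<Sum>\<nu>\<le>R. A \<nu> * of_real (gauss (z - axis i0 t) * hermite_kernel \<nu> x z)) \<partial>lborel)"
      unfolding K by (simp add: sum_distrib_left mult_ac)
    also have "\<dots> = (\<Sum>\<nu>\<le>R. (\<integral>z. A \<nu> * of_real (gauss (z - axis i0 t) * hermite_kernel \<nu> x z) \<partial>lborel))"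
      by (intro Bochner_Integration.integral_sum integrable_mult_right integrable_of_real integrable_gauss_hermite_kernel)
    also have "\<dots> = (\<Sum>\<nu>\<le>R. A \<nu> * of_real (\<integral>z. gauss (z - axis i0 t) * hermite_kernel \<nu> x z \<partial>lborel))"
      by (simp only: integral_mult_right_zero integral_complex_of_real)
    finally show ?thesis by (simp only: integral_gauss_hermite_kernel)
  qed
  have "(\<lambda>k. \<Sum>\<nu>\<le>R. A \<nu> * of_real (hermite_fun \<nu> (x $ i0) * gauss_tail i0 x * ((1 / 2) ^ k * coherent_coeff \<nu> (s k)))) sums
      (\<Sum>\<nu>\<le>R. A \<nu> * of_real (hermite_fun \<nu> (x $ i0) * gauss_tail i0 x * comb_coeff s \<nu>))"
    by (intro sums_sum sums_mult sums_of_real comb_coeff_sums)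
  moreover have "(1 / 2) ^ k * (\<Sum>\<nu>\<le>R. A \<nu> * of_real (hermite_fun \<nu> (x $ i0) * coherent_coeff \<nu> (s k) * gauss_tail i0 x))
    = (\<Sum>\<nu>\<le>R. A \<nu> * of_real (hermite_fun \<nu> (x $ i0) * gauss_tail i0 x * ((1 / 2) ^ k * coherent_coeff \<nu> (s k))))" for k
    unfolding sum_distrib_left by (intro sum.cong refl) (simp add: mult_ac)
  ultimately have "kernel_conv (HTL_kernel a (Suc m)) (comb_dist i0 s) x
     = (\<Sum>\<nu>\<le>R. A \<nu> * of_real (hermite_fun \<nu> (x $ i0) * gauss_tail i0 x * comb_coeff s \<nu>))"
    using sums1 unfolding int by (simp only: sums_unique2)
  then show ?thesis
    unfolding sum_distrib_left R_def A_def by (simp add: mult_ac)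
qed

text \<open>The growth 2^j, with j = \<open>Suc m\<close>, is that of one variable: the tail factor
  is at most 1, and the remaining sum over degrees up to R = 4^j is of order
  \<open>sqrt R\<close>.\<close>

lemma kernel_conv_HTL_bound:
  fixes x :: "real ^ 'n::finite"
  assumes adm: "hermite_admissible a" and s: "\<And>k. 0 \<le> s k" and A: "\<And>t. 0 \<le> t \<Longrightarrow> norm (a t) \<le> A"
  shows "norm (kernel_conv (HTL_kernel a (Suc m)) (comb_dist i0 s) x) \<le> 4 * A * 2 ^ Suc m"
proof -
  define R :: nat where "R = 4 ^ Suc m"
  have A0: "0 \<le> A" using A[of 0] norm_ge_zero order_trans by blast
  have "norm (\<Sum>\<nu>\<le>R. a (real \<nu> / 4 ^ m) * of_real (hermite_fun \<nu> (x $ i0) * comb_coeff s \<nu>))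
      \<le> (\<Sum>\<nu>\<le>R. norm (a (real \<nu> / 4 ^ m) * of_real (hermite_fun \<nu> (x $ i0) * comb_coeff s \<nu>)))"
    by (rule norm_sum)
  also have "\<dots> \<le> (\<Sum>\<nu>\<le>R. A * (\<bar>hermite_fun \<nu> (x $ i0)\<bar> * comb_coeff s \<nu>))"
    using comb_coeff_ge(2)[of s, OF s] A
    by (intro sum_mono) (simp add: norm_mult abs_mult mult_right_mono)
  also have "\<dots> \<le> A * (sqrt (2 * real (Suc R)) + 2)"
    unfolding sum_distrib_left[symmetric] by (intro mult_left_mono comb_coeff_hermite_bound A0)
  also have "sqrt (2 * real (Suc R)) + 2 \<le> 4 * 2 ^ Suc m"
  proof -
    have "1 \<le> R" by (simp add: R_def)
    then have "2 * real (Suc R) \<le> 4 * real R" by simp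
    also have "\<dots> = (2 * 2 ^ Suc m)\<^sup>2"
      by (simp add: R_def power_mult_distrib power2_eq_square flip: power_mult_distrib)
    finally have "sqrt (2 * real (Suc R)) \<le> 2 * 2 ^ Suc m" by (rule real_le_lsqrt[rotated 1]) simp
    moreover have "(1::real) \<le> 2 ^ Suc m" by (rule one_le_power) simp
    ultimately show ?thesis by linarith
  qed
  finally have le: "norm (\<Sum>\<nu>\<le>R. a (real \<nu> / 4 ^ m) * of_real (hermite_fun \<nu> (x $ i0) * comb_coeff s \<nu>)) \<le> A * (4 * 2 ^ Suc m)"
    using A0 by (simp add: mult_left_mono)
  have "norm (kernel_conv (HTL_kernel a (Suc m)) (comb_dist i0 s) x)
     = gauss_tail i0 x * norm (\<Sum>\<nu>\<le>R. a (real \<nu> / 4 ^ m) * of_real (hermite_fun \<nu> (x $ i0) * comb_coeff s \<nu>))"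
    unfolding kernel_conv_HTL[OF adm] using gauss_tail_bounds[of i0 x] by (simp add: norm_mult R_def)
  also have "\<dots> \<le> 1 * (A * (4 * 2 ^ Suc m))"
    using gauss_tail_bounds[of i0 x] le by (intro mult_mono) auto
  finally show ?thesis by (simp add: mult_ac)
qed

section \<open>Pairing the blocks with coherent states\<close>

lemma
  fixes i0 :: "'n::finite"
  shows integrable_test: "integrable lborel (\<lambda>x::real^'n. gauss (x - axis i0 s) * (gauss_tail i0 x * hermite_fun \<nu> (x $ i0)))"
    and integral_test: "(\<integral>x. gauss (x - axis i0 s) * (gauss_tail i0 x * hermite_fun \<nu> (x $ i0)) \<partial>lborel)
      = sqrt pi ^ card (UNIV - {i0}) * coherent_coeff \<nu> s"
proof -
  define F where "F i t = (if i = i0 then hermite_fun \<nu> t * exp (- (t - s)\<^sup>2 / 2) else exp (- (t - 0)\<^sup>2))" for i t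
  have iF: "integrable lborel (F i)" for i
  proof (cases "i = i0")
    case True
    then show ?thesis using integrable_coherent[of \<nu> s] by (simp add: F_def[abs_def])
  next
    case False
    have "integrable lborel (\<lambda>t::real. exp (- t\<^sup>2 / 2) * exp (- t\<^sup>2 / 2))"
      by (intro rapid_integrable rapid_mult rapid_gaussian) measurable
    moreover have "exp (- t\<^sup>2 / 2) * exp (- t\<^sup>2 / 2) = exp (- (t - 0)\<^sup>2)" for t :: real
      by (simp add: exp_add[symmetric])
    ultimately show ?thesis using False by (simp add: F_def[abs_def])
  qed
  \<comment> \<open>In each variable other than \<open>i0\<close> the Gaussian of the test function
    meets the Gaussian tail of the block; their product exp (-t^2) has integral
    \<open>sqrt pi\<close>.\<close>
  have eq: "gauss (x - axis i0 s) * (gauss_tail i0 x * hermite_fun \<nu> (x $ i0)) = (\<Prod>i\<in>UNIV. F i (x $ i))" for x :: "real^'n"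
  proof -
    have sq: "exp (- t\<^sup>2 / 2) * exp (- t\<^sup>2 / 2) = exp (- t\<^sup>2)" for t :: real
      by (simp add: exp_add[symmetric])
    have "gauss (x - axis i0 s) = exp (- (x $ i0 - s)\<^sup>2 / 2) * (\<Prod>i\<in>UNIV - {i0}. exp (- (x $ i)\<^sup>2 / 2))"
      unfolding gauss_def gaussian_vec_prod by (subst prod.remove[of _ i0]) (auto simp: axis_def intro!: prod.cong)
    then have "gauss (x - axis i0 s) * (gauss_tail i0 x * hermite_fun \<nu> (x $ i0))
       = (hermite_fun \<nu> (x $ i0) * exp (- (x $ i0 - s)\<^sup>2 / 2)) * (\<Prod>i\<in>UNIV - {i0}. exp (- (x $ i)\<^sup>2 / 2) * exp (- (x $ i)\<^sup>2 / 2))"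
      unfolding gauss_tail_def prod.distrib by (simp add: mult_ac)
    also have "\<dots> = (\<Prod>i\<in>UNIV. F i (x $ i))"
      unfolding sq by (subst prod.remove[of UNIV i0]) (auto simp: F_def intro!: prod.cong)
    finally show ?thesis .
  qed
  show "integrable lborel (\<lambda>x::real^'n. gauss (x - axis i0 s) * (gauss_tail i0 x * hermite_fun \<nu> (x $ i0)))"
    unfolding eq by (rule integrable_prod_vec[OF iF])
  have "(\<Prod>i\<in>UNIV. integral\<^sup>L lborel (F i)) = integral\<^sup>L lborel (F i0) * (\<Prod>i\<in>UNIV - {i0}. integral\<^sup>L lborel (F i))"
    by (rule prod.remove) auto
  also have "integral\<^sup>L lborel (F i0) = coherent_coeff \<nu> s" by (simp add: F_def[abs_def] coherent_coeff_def)
  also have "(\<Prod>i\<in>UNIV - {i0}. integral\<^sup>L lborel (F i)) = (\<Prod>i\<in>UNIV - {i0}. sqrt pi)"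
    by (intro prod.cong refl) (simp add: F_def[abs_def] shifted_gaussian_integral[of 0, simplified])
  finally show "(\<integral>x. gauss (x - axis i0 s) * (gauss_tail i0 x * hermite_fun \<nu> (x $ i0)) \<partial>lborel)
      = sqrt pi ^ card (UNIV - {i0}) * coherent_coeff \<nu> s"
    unfolding eq integral_prod_vec[OF iF] by (simp add: mult.commute)
qed

text \<open>Integrating a Hermite function against the test state returns its coefficient, so up to
  a fixed power of \<open>sqrt pi\<close> the pairing is the sum bounded in
  \<open>multiplier_lower_bound\<close> when \<open>t\<close> is one of the shifts.\<close>

lemma kernel_conv_HTL_test:
  fixes i0 :: "'n::finite"
  assumes adm: "hermite_admissible a"
  shows "integrable lborel (\<lambda>x. of_real (gauss (x - axis i0 t)) * kernel_conv (HTL_kernel a (Suc m)) (comb_dist i0 s) x)"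
    and "(\<integral>x. of_real (gauss (x - axis i0 t)) * kernel_conv (HTL_kernel a (Suc m)) (comb_dist i0 s) x \<partial>lborel)
      = of_real (sqrt pi ^ card (UNIV - {i0})) * (\<Sum>\<nu>\<le>4 ^ Suc m. a (real \<nu> / 4 ^ m) * of_real (comb_coeff s \<nu> * coherent_coeff \<nu> t))"
proof -
  define A where "A \<nu> = a (real \<nu> / 4 ^ m) * of_real (comb_coeff s \<nu>)" for \<nu> :: nat
  have eq: "of_real (gauss (x - axis i0 t)) * kernel_conv (HTL_kernel a (Suc m)) (comb_dist i0 s) x
     = (\<Sum>\<nu>\<le>4 ^ Suc m. A \<nu> * of_real (gauss (x - axis i0 t) * (gauss_tail i0 x * hermite_fun \<nu> (x $ i0))))" for x :: "real^'n"
    unfolding kernel_conv_HTL[OF adm] A_def sum_distrib_left by (intro sum.cong refl) (simp add: mult_ac)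
  show "integrable lborel (\<lambda>x. of_real (gauss (x - axis i0 t)) * kernel_conv (HTL_kernel a (Suc m)) (comb_dist i0 s) x)"
    unfolding eq by (intro Bochner_Integration.integrable_sum integrable_mult_right integrable_of_real integrable_test)
  have "(\<integral>x. of_real (gauss (x - axis i0 t)) * kernel_conv (HTL_kernel a (Suc m)) (comb_dist i0 s) x \<partial>lborel)
     = (\<Sum>\<nu>\<le>4 ^ Suc m. \<integral>x. A \<nu> * of_real (gauss (x - axis i0 t) * (gauss_tail i0 x * hermite_fun \<nu> (x $ i0))) \<partial>lborel)"
    unfolding eq by (intro Bochner_Integration.integral_sum integrable_mult_right integrable_of_real integrable_test)
  also have "\<dots> = (\<Sum>\<nu>\<le>4 ^ Suc m. A \<nu> * of_real (sqrt pi ^ card (UNIV - {i0}) * coherent_coeff \<nu> t))"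
    by (simp only: integral_mult_right_zero integral_complex_of_real integral_test)
  also have "\<dots> = of_real (sqrt pi ^ card (UNIV - {i0})) * (\<Sum>\<nu>\<le>4 ^ Suc m. a (real \<nu> / 4 ^ m) * of_real (comb_coeff s \<nu> * coherent_coeff \<nu> t))"
    unfolding sum_distrib_left A_def by (intro sum.cong refl) (simp add: mult_ac)
  finally show "(\<integral>x. of_real (gauss (x - axis i0 t)) * kernel_conv (HTL_kernel a (Suc m)) (comb_dist i0 s) x \<partial>lborel)
      = of_real (sqrt pi ^ card (UNIV - {i0})) * (\<Sum>\<nu>\<le>4 ^ Suc m. a (real \<nu> / 4 ^ m) * of_real (comb_coeff s \<nu> * coherent_coeff \<nu> t))" .
qed

section \<open>Lower bounds for the mixed quasi-norm\<close>

lemma lq_norm_ge: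
  assumes q: "0 < q" and s: "\<And>j. s j < \<infinity>"
  shows "s j \<le> lq_norm q s"
proof (cases "q = \<infinity>")
  case True
  then show ?thesis by (auto simp: lq_norm_def intro: SUP_upper)
next
  case False
  define r where "r = enn2real q"
  have r: "0 < r" using q False by (simp add: r_def enn2real_positive_iff less_top)
  obtain v where v: "0 \<le> v" "s j = ennreal v" using s[of j] by (cases "s j") auto
  have "ennreal_powr (s j) r = (\<Sum>i\<in>{j}. ennreal_powr (s i) r)" by simp
  also have "\<dots> \<le> (\<Sum>i. ennreal_powr (s i) r)" by (intro sum_le_suminf) auto
  finally have "ennreal_powr (ennreal_powr (s j) r) (1 / r) \<le> lq_norm q s"
    using False r by (simp add: lq_norm_def r_def[symmetric] ennreal_powr_mono)
  moreover have "ennreal_powr (ennreal_powr (s j) r) (1 / r) = s j"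
    using v r by (simp add: ennreal_powr_ennreal powr_powr)
  ultimately show ?thesis by simp
qed

text \<open>For \<open>1 \<le> p\<close> the function is cut at a level l: below it g |u| is at most
  l g, above it |u| is at most l^(1-p) |u|^p. The level e / (2 G), with G the integral of
  \<open>g\<close>, lets the first part use up exactly half of \<open>e\<close>. For
  \<open>p < 1\<close> the factorisation |u| = |u|^(1-p) |u|^p transfers the missing power to the
  sup bound.\<close>

lemma
  fixes u :: "'a \<Rightarrow> complex"
  assumes g: "\<And>x. 0 < g x" "\<And>x. g x \<le> 1" "integrable M g"
    and gu: "integrable M (\<lambda>x. of_real (g x) * u x)"
    and up: "integrable M (\<lambda>x. norm (u x) powr p)" "(\<integral>x. norm (u x) powr p \<partial>M) \<le> X"
  shows test_bound_ge_1:
      "1 \<le> p \<Longrightarrow> 0 < e \<Longrightarrow> e \<le> norm (\<integral>x. of_real (g x) * u x \<partial>M) \<Longrightarrow> 0 < (\<integral>x. g x \<partial>M)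
        \<Longrightarrow> (\<integral>x. g x \<partial>M) * (e / (2 * (\<integral>x. g x \<partial>M))) powr p \<le> X"
    and test_bound_less_1:
      "p < 1 \<Longrightarrow> (\<And>x. norm (u x) \<le> V) \<Longrightarrow> norm (\<integral>x. of_real (g x) * u x \<partial>M) \<le> V powr (1 - p) * X"
proof -
  have le: "norm (\<integral>x. of_real (g x) * u x \<partial>M) \<le> (\<integral>x. g x * norm (u x) \<partial>M)"
    using integral_norm_bound[of M "\<lambda>x. of_real (g x) * u x"] g(1) by (simp add: norm_mult less_imp_le abs_of_pos)
  have int: "integrable M (\<lambda>x. g x * norm (u x))"
    using integrable_norm[OF gu] g(1) by (simp add: norm_mult less_imp_le abs_of_pos)
  show "(\<integral>x. g x \<partial>M) * (e / (2 * (\<integral>x. g x \<partial>M))) powr p \<le> X"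
    if p: "1 \<le> p" and e: "0 < e" "e \<le> norm (\<integral>x. of_real (g x) * u x \<partial>M)" and G0: "0 < (\<integral>x. g x \<partial>M)"
  proof -
    define G where "G = (\<integral>x. g x \<partial>M)"
    define l where "l = e / (2 * G)"
    have G: "0 < G" using G0 by (simp add: G_def)
    have l: "0 < l" using e G by (simp add: l_def)
    have "g x * norm (u x) \<le> l * g x + l powr (1 - p) * norm (u x) powr p" for x
    proof (cases "norm (u x) \<le> l")
      case True
      then have "g x * norm (u x) \<le> l * g x" using g(1)[of x] by (simp add: mult.commute mult_left_mono)
      then show ?thesis by (simp add: add_increasing2)
    next
      case False
      have "norm (u x) = norm (u x) powr (1 - p) * norm (u x) powr p"
        using False l by (simp add: powr_add[symmetric])
      also have "\<dots> \<le> l powr (1 - p) * norm (u x) powr p"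
        using False l p by (intro mult_right_mono powr_mono2') auto
      finally have "g x * norm (u x) \<le> 1 * (l powr (1 - p) * norm (u x) powr p)"
        using g(1,2)[of x] by (intro mult_mono) auto
      moreover have "0 \<le> l * g x" using l g(1)[of x] by simp
      ultimately show ?thesis by linarith
    qed
    then have "(\<integral>x. g x * norm (u x) \<partial>M) \<le> (\<integral>x. l * g x + l powr (1 - p) * norm (u x) powr p \<partial>M)"
      by (intro integral_mono int) (auto intro!: g(3) up(1))
    also have "\<dots> = l * G + l powr (1 - p) * (\<integral>x. norm (u x) powr p \<partial>M)"
      using g(3) up(1) by (simp add: G_def)
    also have "\<dots> \<le> l * G + l powr (1 - p) * X" using up(2) by (intro add_left_mono mult_left_mono) auto
    finally have "e \<le> l * G + l powr (1 - p) * X" using e le by linarith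
    moreover have "l * G = e / 2" using G by (simp add: l_def)
    ultimately have "l * G \<le> l powr (1 - p) * X" by linarith
    then have "l powr (p - 1) * (l * G) \<le> l powr (p - 1) * (l powr (1 - p) * X)"
      by (intro mult_left_mono) auto
    also have "\<dots> = X" using l by (simp add: mult.assoc[symmetric] powr_add[symmetric])
    finally have "l powr (p - 1) * l powr 1 * G \<le> X" using l by (simp add: mult.assoc)
    then show ?thesis unfolding powr_add[symmetric] by (simp add: l_def G_def mult.commute)
  qed
  show "norm (\<integral>x. of_real (g x) * u x \<partial>M) \<le> V powr (1 - p) * X" if p: "p < 1" and V: "\<And>x. norm (u x) \<le> V"
  proof -
    have "g x * norm (u x) \<le> V powr (1 - p) * norm (u x) powr p" for x
    proof -
      have "norm (u x) = norm (u x) powr (1 - p) * norm (u x) powr p"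
        by (simp add: powr_add[symmetric])
      also have "\<dots> \<le> V powr (1 - p) * norm (u x) powr p"
        using V p by (intro mult_right_mono powr_mono2) auto
      finally have "g x * norm (u x) \<le> 1 * (V powr (1 - p) * norm (u x) powr p)"
        using g(1,2)[of x] by (intro mult_mono) auto
      then show ?thesis by simp
    qed
    then have "(\<integral>x. g x * norm (u x) \<partial>M) \<le> (\<integral>x. V powr (1 - p) * norm (u x) powr p \<partial>M)"
      by (intro integral_mono int integrable_mult_right up(1))
    also have "\<dots> = V powr (1 - p) * (\<integral>x. norm (u x) powr p \<partial>M)" by simp
    also have "\<dots> \<le> V powr (1 - p) * X" using up(2) by (intro mult_left_mono) auto
    finally show ?thesis using le by linarith
  qed
qed

lemma not_uniformly_below_geometric:
  fixes \<delta> r X :: real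
  assumes "0 < \<delta>" "0 \<le> r" "r < 1"
  shows "\<exists>k. X * r ^ k < \<delta>"
proof -
  have "(\<lambda>k. X * r ^ k) \<longlonglongrightarrow> X * 0"
    using assms by (intro tendsto_mult tendsto_const LIMSEQ_realpow_zero) auto
  then have "eventually (\<lambda>k. X * r ^ k < \<delta>) sequentially"
    using assms by (intro order_tendstoD(2)[where y = "X * 0"]) auto
  then show ?thesis by (auto simp: eventually_sequentially)
qed

text \<open>A finite quasi-norm would bound the \<open>p\<close>-th power integral of the block
  attached to the \<open>k\<close>-th translate by a fixed X times 2^(-\<alpha> p j) with j
  proportional to k. The pairing forces a slower decay, since it loses only the weight 2^(-k) and,
  for \<open>p < 1\<close>, a power of the sup norm.\<close>

lemma HTL_norm_infinite:
  fixes i0 :: "'n::finite"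
  assumes adm: "hermite_admissible a" and p: "0 < p" and q: "0 < q"
    and \<alpha>: "real CARD('n) * max (1 / p - 1) 0 < \<alpha>"
  shows "\<exists>s. HTL_norm a \<alpha> p q (comb_dist i0 s) = \<infinity>"
proof -
  obtain A where A: "0 < A" "\<And>t. 0 \<le> t \<Longrightarrow> norm (a t) \<le> A"
    using hermite_admissible_bounded[OF adm] by blast
  obtain c C where c: "0 < c" "0 \<le> C" and
    lower: "\<And>s k m. (\<And>k. 0 \<le> s k) \<Longrightarrow> (s k)\<^sup>2 / 2 = 4 ^ m \<Longrightarrow>
      c * (1 / 2) ^ k - C * (1 / 2) ^ m
        \<le> norm (\<Sum>n\<le>4 ^ Suc m. a (real n / 4 ^ m) * of_real (comb_coeff s n * coherent_coeff n (s k)))"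
    using multiplier_lower_bound[OF adm] by blast
  \<comment> \<open>The net exponent per scale. For \<open>p < 1\<close> the gain \<alpha> p is
    reduced by 1 - p, the power of the sup bound 2^j that is lost; since the dimension is at least
    1, the hypothesis on \<alpha> keeps the difference positive.\<close>
  define \<kappa> where "\<kappa> = (if 1 \<le> p then \<alpha> else \<alpha> * p - (1 - p))"
  have \<alpha>0: "0 < \<alpha>" using \<alpha> by (smt (verit) max.cobounded2 of_nat_0_le_iff zero_le_mult_iff)
  have \<kappa>: "0 < \<kappa>"
  proof (cases "1 \<le> p")
    case False
    have "1 / p - 1 \<le> real CARD('n) * max (1 / p - 1) 0"
    proof -
      have "1 * max (1 / p - 1) 0 \<le> real CARD('n) * max (1 / p - 1) 0"
        by (intro mult_right_mono) (auto simp: Suc_le_eq)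
      then show ?thesis unfolding mult_1 by (rule order_trans[OF max.cobounded1])
    qed
    then have "1 / p - 1 < \<alpha>" using \<alpha> by linarith
    then have "(1 / p - 1) * p < \<alpha> * p" using p by (rule mult_strict_right_mono)
    then show ?thesis using False p by (simp add: \<kappa>_def left_diff_distrib)
  qed (use \<alpha>0 in \<open>simp add: \<kappa>_def\<close>)
  \<comment> \<open>The slope \<open>M\<close> serves two purposes: \<open>M1\<close> keeps the
    error of the pairing below half of its main term for every \<open>k\<close>, and
    \<open>M2\<close> gives \<open>2 \<le> \<kappa> * real M\<close>. Of the latter, one unit pays
    for the weight 2^(-k) and the other is left as geometric decay.\<close>
  obtain M1 :: nat where M1: "2 * C * (1 / 2) ^ M1 < c / 2"
    using not_uniformly_below_geometric[of "c / 2" "1 / 2" "2 * C"] c by auto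
  obtain M2 :: nat where M2: "2 / \<kappa> \<le> real M2" using real_arch_simple by blast
  define M where "M = Suc (M1 + M2)"
  have M\<kappa>: "2 \<le> \<kappa> * real M"
  proof -
    have "2 \<le> \<kappa> * real M2" using M2 \<kappa> by (simp add: field_simps)
    also have "\<dots> \<le> \<kappa> * real M" using \<kappa> by (intro mult_left_mono) (auto simp: M_def)
    finally show ?thesis .
  qed
  \<comment> \<open>\<open>m k\<close> is the exponent of the Poisson mean, one less than the block
    index \<open>M * Suc k\<close>. As \<open>M\<close> is positive, \<open>Suc k\<close> keeps the
    subtraction exact also at \<open>k = 0\<close>.\<close>
  define m where "m k = M * Suc k - 1" for k
  have Sm: "Suc (m k) = M * Suc k" for k by (simp add: m_def M_def)
  define s where "s k = sqrt (2 * 4 ^ m k)" for k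
  have s: "0 \<le> s k" "(s k)\<^sup>2 / 2 = 4 ^ m k" for k by (simp_all add: s_def)
  define e where "e = sqrt pi ^ card (UNIV - {i0}) * (c / 2)"
  have e: "0 < e" using c(1) by (simp add: e_def)
  define u where "u k = kernel_conv (HTL_kernel a (Suc (m k))) (comb_dist i0 s)" for k
  define g where "g k x = gauss (x - axis i0 (s k) :: real^'n)" for k x
  have g: "0 < g k x" "g k x \<le> 1" for k x by (simp_all add: g_def gauss_pos gauss_le_1)
  have shift: "integrable lborel (g k)" "(\<integral>x. g k x \<partial>lborel) = integral\<^sup>L lborel (gauss :: real^'n \<Rightarrow> real)" for k
  proof -
    have i: "integrable lborel (gauss :: real^'n \<Rightarrow> real)"
      unfolding gauss_def by (rule integrable_gaussian_vec)
    have d: "lborel = distr lborel borel ((+) (- axis i0 (s k) :: real^'n))"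
      by (rule lborel_distr_plus[symmetric])
    have gk: "g k = (\<lambda>x. gauss (- axis i0 (s k) + x))" by (auto simp: g_def)
    have "integrable (distr lborel borel ((+) (- axis i0 (s k)))) (gauss :: real^'n \<Rightarrow> real)"
      using i d by metis
    then show "integrable lborel (g k)"
      unfolding gk by (subst (asm) integrable_distr_eq) auto
    have "integral\<^sup>L (distr lborel borel ((+) (- axis i0 (s k)))) (gauss :: real^'n \<Rightarrow> real) = (\<integral>x. g k x \<partial>lborel)"
      unfolding gk by (subst integral_distr) auto
    then show "(\<integral>x. g k x \<partial>lborel) = integral\<^sup>L lborel (gauss :: real^'n \<Rightarrow> real)"
      using d by metis
  qed
  define G where "G = integral\<^sup>L lborel (gauss :: real^'n \<Rightarrow> real)"
  have G: "0 < G"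
  proof -
    have "G = (\<Prod>i\<in>(UNIV::'n set). integral\<^sup>L lborel (\<lambda>t::real. exp (- t\<^sup>2 / 2)))"
      unfolding G_def gauss_def gaussian_vec_prod
      using integrable_poly_gaussian[of 0] by (intro integral_prod_vec) simp
    then show ?thesis by (simp only: gaussian_integral) simp
  qed
  have gu: "integrable lborel (\<lambda>x. of_real (g k x) * u k x)" for k
    unfolding g_def u_def by (rule kernel_conv_HTL_test(1)[OF adm])
  \<comment> \<open>Measurability of the block is recovered from the integrable product by dividing
    by the positive Gaussian.\<close>
  have um [measurable]: "u k \<in> borel_measurable borel" for k
  proof -
    have "(\<lambda>x. of_real (g k x) * u k x / of_real (g k x)) \<in> borel_measurable borel"
      using borel_measurable_integrable[OF gu[of k]] borel_measurable_integrable[OF shift(1)[of k]]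
      by (intro borel_measurable_divide) auto
    moreover have "of_real (g k x) * u k x / of_real (g k x) = u k x" for x
      using g(1)[of k x] by simp
    ultimately show ?thesis by simp
  qed
  have E: "e * (1 / 2) ^ k \<le> norm (\<integral>x. of_real (g k x) * u k x \<partial>lborel)" for k
  proof -
    have "(1 / 2) ^ m k = 2 * (1 / 2 :: real) ^ Suc (m k)" by simp
    also have "\<dots> = 2 * (1 / 2) ^ (M * Suc k)" by (simp only: Sm)
    also have "\<dots> \<le> 2 * (1 / 2) ^ (M1 + k)"
    proof -
      have "M1 + k \<le> M * Suc k" by (simp add: M_def)
      then show ?thesis by (intro mult_left_mono power_decreasing) auto
    qed
    finally have "C * (1 / 2) ^ m k \<le> C * (2 * (1 / 2) ^ (M1 + k))" by (rule mult_left_mono) (rule c(2))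
    also have "\<dots> = (2 * C * (1 / 2) ^ M1) * (1 / 2) ^ k" by (simp add: power_add)
    also have "\<dots> \<le> c / 2 * (1 / 2) ^ k" using M1 by (intro mult_right_mono) auto
    finally have "c / 2 * (1 / 2) ^ k \<le> c * (1 / 2) ^ k - C * (1 / 2) ^ m k" by simp
    also note lower[OF s]
    finally have "sqrt pi ^ card (UNIV - {i0}) * (c / 2 * (1 / 2) ^ k) \<le> sqrt pi ^ card (UNIV - {i0}) *
        norm (\<Sum>n\<le>4 ^ Suc (m k). a (real n / 4 ^ m k) * of_real (comb_coeff s n * coherent_coeff n (s k)))"
      by (intro mult_left_mono) auto
    then show ?thesis
      unfolding g_def u_def kernel_conv_HTL_test(2)[OF adm] e_def
      by (simp only: norm_mult norm_of_real abs_of_nonneg[OF zero_le_power[OF real_sqrt_ge_zero[OF pi_ge_zero]]] mult.assoc)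
  qed
  have "HTL_norm a \<alpha> p q (comb_dist i0 s) = \<infinity>"
  proof (rule ccontr)
    define v where "v j x = ennreal (2 powr (\<alpha> * real j) * norm (kernel_conv (HTL_kernel a j) (comb_dist i0 s) x))" for j and x :: "real^'n"
    define X0 where "X0 = (\<integral>\<^sup>+x. ennreal_powr (lq_norm q (\<lambda>j. v j x)) p \<partial>lborel)"
    assume "HTL_norm a \<alpha> p q (comb_dist i0 s) \<noteq> \<infinity>"
    then have "X0 \<noteq> \<infinity>"
      by (auto simp: HTL_norm_def kernel_TL_norm_def Lp_norm_def X0_def v_def ennreal_powr_def)
    then obtain X where X: "0 \<le> X" "X0 = ennreal X" by (cases X0) auto
    define j where "j k = M * Suc k" for k
    define D where "D k = 2 powr (\<alpha> * real (j k) * p)" for k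
    have D: "0 < D k" for k by (simp add: D_def)
    have up: "integrable lborel (\<lambda>x. norm (u k x) powr p) \<and> (\<integral>x. norm (u k x) powr p \<partial>lborel) \<le> X / D k" for k
    proof -
      have "(\<integral>\<^sup>+x. ennreal (D k * norm (u k x) powr p) \<partial>lborel) \<le> X0"
        unfolding X0_def
      proof (rule nn_integral_mono)
        fix x
        have "ennreal (D k * norm (u k x) powr p) = ennreal_powr (v (j k) x) p"
          by (simp add: v_def ennreal_powr_ennreal D_def u_def Sm j_def powr_mult powr_powr)
        also have "\<dots> \<le> ennreal_powr (lq_norm q (\<lambda>j. v j x)) p"
          using p by (intro ennreal_powr_mono lq_norm_ge[OF q, of "\<lambda>j. v j x"]) (auto simp: v_def)
        finally show "ennreal (D k * norm (u k x) powr p) \<le> ennreal_powr (lq_norm q (\<lambda>j. v j x)) p" .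
      qed
      then have le: "(\<integral>\<^sup>+x. ennreal (D k * norm (u k x) powr p) \<partial>lborel) \<le> ennreal X" by (simp add: X)
      have i: "integrable lborel (\<lambda>x. D k * norm (u k x) powr p)"
        using le D[of k] by (intro integrableI_nonneg) (auto simp: less_top[symmetric] top_unique)
      then have "ennreal (\<integral>x. D k * norm (u k x) powr p \<partial>lborel) \<le> ennreal X"
        using le D[of k] by (subst nn_integral_eq_integral[symmetric]) auto
      then have "D k * (\<integral>x. norm (u k x) powr p \<partial>lborel) \<le> X" using X by simp
      then show ?thesis using i D[of k] by (auto simp: field_simps)
    qed
    show False
    proof (cases "1 \<le> p")
      case True
      define \<delta> where "\<delta> = G * (e / (2 * G)) powr p"
      have \<delta>: "0 < \<delta>" using G e by (simp add: \<delta>_def)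
      define r where "r = 2 powr (- p)"
      have r: "0 \<le> r" "r < 1" using p powr_less_mono[of "- p" 0 "2::real"] by (auto simp: r_def)
      have "\<delta> \<le> X * r ^ k" for k
      proof -
        have "G * (e * (1 / 2) ^ k / (2 * G)) powr p \<le> X / D k"
          using test_bound_ge_1[OF g shift(1) gu, of k p "X / D k" "e * (1 / 2) ^ k"] up[of k] True e E[of k] G
          by (simp only: shift(2) G_def) auto
        moreover have "(e * (1 / 2) ^ k / (2 * G)) powr p = (e / (2 * G)) powr p * (1 / 2) powr (real k * p)"
        proof -
          have "(e * (1 / 2) ^ k / (2 * G)) = e / (2 * G) * ((1 / 2) powr real k)" by (simp add: powr_realpow)
          then show ?thesis by (simp only: powr_mult powr_powr)
        qed
        ultimately have "\<delta> * (1 / 2) powr (real k * p) \<le> X / D k" by (simp add: \<delta>_def mult.assoc)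
        then have "\<delta> * (1 / 2) powr (real k * p) * 2 powr (real k * p) \<le> X / D k * 2 powr (real k * p)"
          by (intro mult_right_mono) auto
        also have "\<delta> * (1 / 2) powr (real k * p) * 2 powr (real k * p) = \<delta>"
          by (simp add: powr_mult[symmetric] mult.assoc)
        also have "X / D k * 2 powr (real k * p) = X * 2 powr (real k * p - \<alpha> * real (j k) * p)"
          by (simp add: D_def powr_diff)
        also have "\<dots> \<le> X * 2 powr (- p * real k)"
        proof -
          have "2 * real (Suc k) \<le> \<alpha> * real M * real (Suc k)"
            using M\<kappa> True by (intro mult_right_mono) (auto simp: \<kappa>_def)
          then have "2 * real k \<le> \<alpha> * real (j k)" by (simp add: j_def algebra_simps)
          then have "2 * real k * p \<le> \<alpha> * real (j k) * p" using p by (intro mult_right_mono) auto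
          then have "real k * p - \<alpha> * real (j k) * p \<le> - p * real k" by (simp add: algebra_simps)
          then show ?thesis using X(1) by (intro mult_left_mono powr_mono) auto
        qed
        also have "2 powr (- p * real k) = r ^ k"
          unfolding powr_powr[symmetric] r_def by (rule powr_realpow) simp
        finally show ?thesis .
      qed
      then show False using not_uniformly_below_geometric[OF \<delta> r, of X] by (auto simp: not_less[symmetric])
    next
      case False
      define B where "B = (4 * A) powr (1 - p) * X"
      have B: "0 \<le> B" using X by (simp add: B_def)
      have "e \<le> B * (1 / 2) ^ k" for k
      proof -
        have "norm (u k x) \<le> 4 * A * 2 ^ j k" for x
          unfolding u_def j_def Sm[symmetric] by (rule kernel_conv_HTL_bound[OF adm s(1) A(2)])
        then have "e * (1 / 2) ^ k \<le> (4 * A * 2 ^ j k) powr (1 - p) * (X / D k)"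
          using test_bound_less_1[OF g shift(1) gu, of k p "X / D k" "4 * A * 2 ^ j k"] up[of k] False E[of k]
          by force
        also have "(4 * A * 2 ^ j k) powr (1 - p) = (4 * A) powr (1 - p) * 2 powr (real (j k) * (1 - p))"
        proof -
          have "4 * A * 2 ^ j k = 4 * A * 2 powr real (j k)" by (simp add: powr_realpow)
          then show ?thesis by (simp only: powr_mult powr_powr)
        qed
        also have "(4 * A) powr (1 - p) * 2 powr (real (j k) * (1 - p)) * (X / D k) = B * 2 powr (real (j k) * (1 - p) - \<alpha> * real (j k) * p)"
          by (simp add: B_def D_def powr_diff)
        also have "real (j k) * (1 - p) - \<alpha> * real (j k) * p = - (\<kappa> * real (j k))"
          using False by (simp add: \<kappa>_def algebra_simps)
        also have "B * 2 powr - (\<kappa> * real (j k)) \<le> B * 2 powr (- (2 * real k))"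
        proof -
          have "2 * real (Suc k) \<le> \<kappa> * real M * real (Suc k)"
            using M\<kappa> by (intro mult_right_mono) auto
          then have "2 * real k \<le> \<kappa> * real (j k)" by (simp add: j_def algebra_simps)
          then show ?thesis using B by (intro mult_left_mono powr_mono) auto
        qed
        also have "2 powr (- (2 * real k)) = (1 / 2) ^ k * (1 / 2 :: real) ^ k"
        proof -
          have "2 powr (- (2 * real k)) = inverse (2 powr (real (k + k)))" by (simp add: powr_minus)
          also have "\<dots> = inverse (2 ^ (k + k))" by (subst powr_realpow) auto
          finally show ?thesis by (simp add: power_add power_one_over field_simps)
        qed
        finally have "e * (1 / 2) ^ k \<le> (B * (1 / 2) ^ k) * (1 / 2) ^ k" by (simp add: mult.assoc)
        then show ?thesis by (rule mult_right_le_imp_le) simp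
      qed
      then show False using not_uniformly_below_geometric[OF e, of "1 / 2" B] by (auto simp: not_less[symmetric])
    qed
  qed
  then show ?thesis by blast
qed

theorem theorem4p10:
  fixes p \<alpha> :: real and q :: ennreal and a :: "real \<Rightarrow> complex"
    and \<phi>\<^sub>0 \<phi> :: "real ^ 'n::finite \<Rightarrow> complex"
  assumes "hermite_admissible a"
    and "LP_admissible \<phi>\<^sub>0 \<phi>"
    and "0 < p"
    and "0 < q"
    and "\<alpha> > real CARD('n) * max (1 / p - 1) 0"
  shows "\<exists>f :: real ^ 'n \<Rightarrow> complex.
           (\<forall>\<psi>\<in>schwartz. integrable lborel (\<lambda>x. f x * \<psi> x)) \<and>
           distribution_of f \<in> TL_space \<phi>\<^sub>0 \<phi> \<alpha> p q \<and>
           HTL_norm a \<alpha> p q (distribution_of f) = \<infinity> \<and>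
           distribution_of f \<notin> HTL_space a \<alpha> p q"
proof -
  \<comment> \<open>\<open>undefined\<close> merely names some coordinate direction; the axis is
    arbitrary.\<close>
  obtain s where s: "HTL_norm a \<alpha> p q (comb_dist (undefined :: 'n) s) = \<infinity>"
    using HTL_norm_infinite[OF assms(1,3,4,5)] by blast
  define f where "f z = complex_of_real (gauss_comb (\<lambda>k. axis (undefined :: 'n) (s k)) z)" for z
  have inf: "HTL_norm a \<alpha> p q (distribution_of f) = \<infinity>"
    using s by (simp add: comb_dist_def f_def[abs_def])
  have "\<forall>\<psi>\<in>schwartz. integrable lborel (\<lambda>x. f x * \<psi> x)"
    unfolding f_def by (intro ballI integrable_gauss_comb schwartz_integrable)
  moreover have "distribution_of f \<in> TL_space \<phi>\<^sub>0 \<phi> \<alpha> p q"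
    unfolding TL_space_def f_def[abs_def]
    using tempered_gauss_comb TL_norm_gauss_comb[OF assms(2,3,4)] by blast
  moreover have "distribution_of f \<notin> HTL_space a \<alpha> p q"
    using inf by (simp add: HTL_space_def)
  ultimately show ?thesis using inf by blast
qed

end
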